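(* Let $G$ be a group and $P$ a bounded, ranked $G$-poset of length $n$. Then for all $t\in\mathbb P$, as virtual $G$-representations, \[\bigoplus_{j=1}^n t^j\,L(I_{j-1}(P);G)\cong_G -L\big((P^\ast\ast T_{t,n})^-;G\big).\] Consequently, if $P$ is Cohen–Macaulay then for all $t\in\mathbb P$, \[\bigoplus_{j=1}^n t^j\,\tilde H_{n-2}(I_{j-1}(P))\cong_G\tilde H_{n-1}\big((P^\ast\ast T_{t,n})^-\big).\] Here $t^j V$ denotes the direct sum of $t^j$ copies of $V$.
   Context: $G$ acts on $P$ by order-preserving bijections; this induces actions on the dual $P^\ast$ and on Rees products via $(a,x)g=(ag,x)$. For ranked $P,Q$ the Rees product is $P\ast Q=\{(p,q): r_P(p)\ge r_Q(q)\}$ with $(p_1,q_1)\le(p_2,q_2)$ iff $p_1\le p_2$, $q_1\le q_2$, $r_P(p_2)-r_P(p_1)\ge r_Q(q_2)-r_Q(q_1)$. $X^-$ is $X$ with its minimum removed; $C_n$ is the chain $0<\dots<n-1$; $I_j(P)=\{z\in P^-\ast C_n: z<(\hat1_P,j)\}$. $T_{t,n}$ is the poset whose Hasse diagram is a complete $t$-ary rooted tree of height $n$ with root at the bottom. $\tilde H_k$ is reduced homology over $\mathbb C$ of the order complex; the Lefschetz character of a $G$-poset $X$ of length $m$ is $L(X;G)=\bigoplus_{i}(-1)^i\tilde H_i(X)$ (for the empty poset, the negative of the trivial representation). A poset is Cohen–Macaulay if the homology of every open interval and of the poset itself (and its principal order ideals) is concentrated in top dimension.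
   Formalization: P is taken finite (so that the homology gives virtual representations) and of length n ≥ 1; for n = 0 the left side is 0 while the right side is the trivial representation. *)

theory Defs
  imports "HOL-Algebra.Algebra" "HOL-Library.Poly_Mapping" "HOL-Library.Sublist"
begin

section \<open>Posets\<close>

text \<open>
  A poset is a reflexive relation \<open>P\<close> with \<open>Partial_order P\<close>; its underlying set is \<open>Field P\<close>
  and \<open>(x, y) \<in> P\<close> means \<open>x \<le> y\<close>. The dual poset is \<open>P\<inverse>\<close>. Chains of \<open>P\<close> are the members of
  \<open>Chains P\<close>, the empty chain included. All posets are finite; the definitions that use \<open>card\<close>
  or \<open>Max\<close> are meaningful for finite posets only.
\<close>

definition subposet :: "'a rel \<Rightarrow> 'a set \<Rightarrow> 'a rel" where
  "subposet P A = P \<inter> A \<times> A"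

text \<open>The largest number of steps in a chain; the empty poset has length \<open>-1\<close>.\<close>

definition poset_length :: "'a rel \<Rightarrow> int" where
  "poset_length P = int (Max (card ` Chains P)) - 1"

definition poset_rank :: "'a rel \<Rightarrow> 'a \<Rightarrow> int" where
  "poset_rank P x = poset_length (subposet P (under P x))"

definition maximal_chains :: "'a rel \<Rightarrow> 'a set set" where
  "maximal_chains P = {C \<in> Chains P. \<forall>D \<in> Chains P. C \<subseteq> D \<longrightarrow> C = D}"

text \<open>Ranked: within every principal order ideal all maximal chains have the same length.\<close>

definition ranked :: "'a rel \<Rightarrow> bool" where
  "ranked P \<longleftrightarrow> (\<forall>x \<in> Field P. \<forall>C \<in> maximal_chains (subposet P (under P x)).
     \<forall>D \<in> maximal_chains (subposet P (under P x)). card C = card D)"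

definition is_least :: "'a rel \<Rightarrow> 'a \<Rightarrow> bool" where
  "is_least P x \<longleftrightarrow> x \<in> Field P \<and> (\<forall>y \<in> Field P. (x, y) \<in> P)"

definition is_greatest :: "'a rel \<Rightarrow> 'a \<Rightarrow> bool" where
  "is_greatest P x \<longleftrightarrow> x \<in> Field P \<and> (\<forall>y \<in> Field P. (y, x) \<in> P)"

definition bounded_poset :: "'a rel \<Rightarrow> bool" where
  "bounded_poset P \<longleftrightarrow> (\<exists>x. is_least P x) \<and> (\<exists>x. is_greatest P x)"

definition greatest_elem :: "'a rel \<Rightarrow> 'a" where
  "greatest_elem P = (THE x. is_greatest P x)"

definition remove_min :: "'a rel \<Rightarrow> 'a rel" where
  "remove_min P = subposet P {x \<in> Field P. \<not> is_least P x}"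

definition chain_poset :: "nat \<Rightarrow> nat rel" where
  "chain_poset n = {(i, j). i \<le> j \<and> j < n}"

text \<open>
  The nodes of the complete \<open>t\<close>-ary tree of height \<open>n\<close> are the words of length at most \<open>n\<close> over
  an alphabet with \<open>t\<close> letters, the children of a word being its one-letter extensions.
\<close>

definition tree_poset :: "nat \<Rightarrow> nat \<Rightarrow> nat list rel" where
  "tree_poset t n = {(u, w). prefix u w \<and> w \<in> lists {..<t} \<and> length w \<le> n}"

definition rees_carrier :: "'a rel \<Rightarrow> 'b rel \<Rightarrow> ('a \<times> 'b) set" where
  "rees_carrier P Q = {(p, q). p \<in> Field P \<and> q \<in> Field Q \<and> poset_rank P p \<ge> poset_rank Q q}"

definition rees_product :: "'a rel \<Rightarrow> 'b rel \<Rightarrow> ('a \<times> 'b) rel" where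
  "rees_product P Q = {((p1, q1), (p2, q2)).
     (p1, q1) \<in> rees_carrier P Q \<and> (p2, q2) \<in> rees_carrier P Q \<and>
     (p1, p2) \<in> P \<and> (q1, q2) \<in> Q \<and>
     poset_rank P p2 - poset_rank P p1 \<ge> poset_rank Q q2 - poset_rank Q q1}"

text \<open>\<open>I\<^sub>j(P)\<close> for a bounded ranked poset \<open>P\<close> of length \<open>n\<close>.\<close>

definition rees_ideal :: "'a rel \<Rightarrow> nat \<Rightarrow> nat \<Rightarrow> ('a \<times> nat) rel" where
  "rees_ideal P n j =
     (let R = rees_product (remove_min P) (chain_poset n)
      in subposet R (underS R (greatest_elem P, j)))"


section \<open>Group actions on posets\<close>

text \<open>
  We use left actions, as in the library; a right action is turned into a left one by letting
  \<open>g\<close> act as its inverse.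
\<close>

definition G_poset :: "('g, 'm) monoid_scheme \<Rightarrow> ('g \<Rightarrow> 'a \<Rightarrow> 'a) \<Rightarrow> 'a rel \<Rightarrow> bool" where
  "G_poset G \<phi> P \<longleftrightarrow> Partial_order P \<and> group_action G (Field P) \<phi> \<and>
     (\<forall>g \<in> carrier G. \<forall>(x, y) \<in> P. (\<phi> g x, \<phi> g y) \<in> P)"

definition act_fst :: "('g \<Rightarrow> 'a \<Rightarrow> 'a) \<Rightarrow> 'g \<Rightarrow> 'a \<times> 'b \<Rightarrow> 'a \<times> 'b" where
  "act_fst \<phi> g = (\<lambda>(a, x). (\<phi> g a, x))"


section \<open>Reduced homology of the order complex over the complex numbers\<close>

text \<open>
  Dimensions are integers: the empty chain is the unique simplex of dimension \<open>-1\<close>. Complex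
  vector spaces are HOL-Algebra modules, whose fields \<open>mult\<close> and \<open>one\<close> are irrelevant.
\<close>

definition simplices :: "'a rel \<Rightarrow> int \<Rightarrow> 'a set set" where
  "simplices P k = {C \<in> Chains P. finite C \<and> int (card C) = k + 1}"

definition chain_module :: "'a rel \<Rightarrow> int \<Rightarrow> (complex, 'a set \<Rightarrow>\<^sub>0 complex) module" where
  "chain_module P k =
     \<lparr>carrier = {c. Poly_Mapping.keys c \<subseteq> simplices P k}, monoid.mult = undefined, monoid.one = undefined,
      ring.zero = 0, ring.add = (+), smult = (\<lambda>a. Poly_Mapping.map ((*) a))\<rparr>"

text \<open>
  The linear extension of \<open>[x\<^sub>0 < \<dots> < x\<^sub>k] \<mapsto> \<Sum>i. (-1)\<^sup>i [x\<^sub>0 < \<dots> < x\<^sub>i\<^sub>-\<^sub>1 < x\<^sub>i\<^sub>+\<^sub>1 < \<dots> < x\<^sub>k]\<close>; the index of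
  \<open>x\<close> in the chain \<open>C\<close> is the number of elements of \<open>C\<close> strictly below \<open>x\<close>.
\<close>

definition boundary ::
    "'a rel \<Rightarrow> ('a set \<Rightarrow>\<^sub>0 complex) \<Rightarrow> ('a set \<Rightarrow>\<^sub>0 complex)" where
  "boundary P c = (\<Sum>C \<in> Poly_Mapping.keys c. \<Sum>x \<in> C.
     Poly_Mapping.single (C - {x})
       ((- 1) ^ card (C \<inter> underS P x) * Poly_Mapping.lookup c C))"

definition cycles :: "'a rel \<Rightarrow> int \<Rightarrow> ('a set \<Rightarrow>\<^sub>0 complex) set" where
  "cycles P k = {c \<in> carrier (chain_module P k). boundary P c = 0}"

definition boundaries :: "'a rel \<Rightarrow> int \<Rightarrow> ('a set \<Rightarrow>\<^sub>0 complex) set" where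
  "boundaries P k = boundary P ` carrier (chain_module P (k + 1))"

definition quotient_module :: "('c, 'v) module \<Rightarrow> 'v set \<Rightarrow> ('c, 'v set) module" where
  "quotient_module M N =
     \<lparr>carrier = a_rcosets\<^bsub>M\<^esub> N, monoid.mult = undefined, monoid.one = undefined, ring.zero = N, ring.add = set_add M,
      smult = (\<lambda>a A. \<Union>v \<in> A. N +>\<^bsub>M\<^esub> (a \<odot>\<^bsub>M\<^esub> v))\<rparr>"

definition reduced_homology ::
    "'a rel \<Rightarrow> int \<Rightarrow> (complex, ('a set \<Rightarrow>\<^sub>0 complex) set) module" where
  "reduced_homology P k =
     quotient_module ((chain_module P k)\<lparr>carrier := cycles P k\<rparr>) (boundaries P k)"

definition concentrated_in_top :: "'a rel \<Rightarrow> bool" where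
  "concentrated_in_top P \<longleftrightarrow> (\<forall>k. k \<noteq> poset_length P \<longrightarrow>
     carrier (reduced_homology P k) = {\<zero>\<^bsub>reduced_homology P k\<^esub>})"

text \<open>
  For a bounded poset only the open intervals matter: the other subposets below have a least or a
  greatest element, unless they are empty.
\<close>

definition cohen_macaulay :: "'a rel \<Rightarrow> bool" where
  "cohen_macaulay P \<longleftrightarrow>
     concentrated_in_top P \<and>
     (\<forall>x \<in> Field P. concentrated_in_top (subposet P (under P x)) \<and>
        concentrated_in_top (subposet P (underS P x)) \<and>
        concentrated_in_top (subposet P (aboveS P x))) \<and>
     (\<forall>x y. (x, y) \<in> P \<and> x \<noteq> y \<longrightarrow>
        concentrated_in_top (subposet P (aboveS P x \<inter> underS P y)))"


section \<open>Representations and virtual representations\<close>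

record ('g, 'v) rep =
  space :: "(complex, 'v) module"
  act :: "'g \<Rightarrow> 'v \<Rightarrow> 'v"

definition rep_iso ::
    "('g, 'm) monoid_scheme \<Rightarrow> ('g, 'v) rep \<Rightarrow> ('g, 'w) rep \<Rightarrow> bool" where
  "rep_iso G V W \<longleftrightarrow> (\<exists>f \<in> iso (add_monoid (space V)) (add_monoid (space W)).
     \<forall>v \<in> carrier (space V).
       (\<forall>a. f (a \<odot>\<^bsub>space V\<^esub> v) = a \<odot>\<^bsub>space W\<^esub> f v) \<and>
       (\<forall>g \<in> carrier G. f (act V g v) = act W g (f v)))"

definition rep_sum2 :: "('g, 'v) rep \<Rightarrow> ('g, 'w) rep \<Rightarrow> ('g, 'v \<times> 'w) rep" where
  "rep_sum2 V W =
     \<lparr>space =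
        \<lparr>carrier = carrier (space V) \<times> carrier (space W), monoid.mult = undefined, monoid.one = undefined,
         ring.zero = (\<zero>\<^bsub>space V\<^esub>, \<zero>\<^bsub>space W\<^esub>),
         ring.add = (\<lambda>(v, w) (v', w'). (v \<oplus>\<^bsub>space V\<^esub> v', w \<oplus>\<^bsub>space W\<^esub> w')),
         smult = (\<lambda>a (v, w). (a \<odot>\<^bsub>space V\<^esub> v, a \<odot>\<^bsub>space W\<^esub> w))\<rparr>,
      act = (\<lambda>g (v, w). (act V g v, act W g w))\<rparr>"

text \<open>Direct sum of a family; the index set is meant to be finite.\<close>

definition rep_sum :: "'i set \<Rightarrow> ('i \<Rightarrow> ('g, 'v) rep) \<Rightarrow> ('g, 'i \<Rightarrow> 'v) rep" where
  "rep_sum I V =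
     \<lparr>space =
        \<lparr>carrier = (\<Pi>\<^sub>E i \<in> I. carrier (space (V i))), monoid.mult = undefined, monoid.one = undefined,
         ring.zero = (\<lambda>i \<in> I. \<zero>\<^bsub>space (V i)\<^esub>),
         ring.add = (\<lambda>v w. \<lambda>i \<in> I. v i \<oplus>\<^bsub>space (V i)\<^esub> w i),
         smult = (\<lambda>a v. \<lambda>i \<in> I. a \<odot>\<^bsub>space (V i)\<^esub> v i)\<rparr>,
      act = (\<lambda>g v. \<lambda>i \<in> I. act (V i) g (v i))\<rparr>"

definition rep_copies :: "nat \<Rightarrow> ('g, 'v) rep \<Rightarrow> ('g, nat \<Rightarrow> 'v) rep" where
  "rep_copies m V = rep_sum {..<m} (\<lambda>_. V)"

text \<open>The pair \<open>(A, B)\<close> stands for the virtual representation \<open>A - B\<close>.\<close>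

type_synonym ('g, 'v) virtual_rep = "('g, 'v) rep \<times> ('g, 'v) rep"

text \<open>
  \<open>A - B = C - D\<close> in the representation ring; since finite-dimensional representations obey the
  cancellation law (Krull--Schmidt), no auxiliary summand is needed on the two sides.
\<close>

definition virtual_iso ::
    "('g, 'm) monoid_scheme \<Rightarrow> ('g, 'v) virtual_rep \<Rightarrow> ('g, 'w) virtual_rep \<Rightarrow> bool" where
  "virtual_iso G V W \<longleftrightarrow> rep_iso G (rep_sum2 (fst V) (snd W)) (rep_sum2 (fst W) (snd V))"

definition virtual_neg :: "('g, 'v) virtual_rep \<Rightarrow> ('g, 'v) virtual_rep" where
  "virtual_neg V = (snd V, fst V)"

definition virtual_sum ::
    "'i set \<Rightarrow> ('i \<Rightarrow> ('g, 'v) virtual_rep) \<Rightarrow> ('g, 'i \<Rightarrow> 'v) virtual_rep" where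
  "virtual_sum I V = (rep_sum I (\<lambda>i. fst (V i)), rep_sum I (\<lambda>i. snd (V i)))"

definition virtual_copies :: "nat \<Rightarrow> ('g, 'v) virtual_rep \<Rightarrow> ('g, nat \<Rightarrow> 'v) virtual_rep" where
  "virtual_copies m V = virtual_sum {..<m} (\<lambda>_. V)"


section \<open>Homology representations and the Lefschetz character\<close>

definition chain_map :: "('a \<Rightarrow> 'b) \<Rightarrow> ('a set \<Rightarrow>\<^sub>0 complex) \<Rightarrow> ('b set \<Rightarrow>\<^sub>0 complex)" where
  "chain_map f c =
     (\<Sum>C \<in> Poly_Mapping.keys c. Poly_Mapping.single (f ` C) (Poly_Mapping.lookup c C))"

text \<open>
  An order automorphism maps the boundaries onto themselves, so the image of a homology class,
  which is a coset of the boundaries, is again a homology class.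
\<close>

definition homology_rep ::
    "('g \<Rightarrow> 'a \<Rightarrow> 'a) \<Rightarrow> 'a rel \<Rightarrow> int \<Rightarrow> ('g, ('a set \<Rightarrow>\<^sub>0 complex) set) rep" where
  "homology_rep \<phi> P k =
     \<lparr>space = reduced_homology P k, act = (\<lambda>g A. chain_map (\<phi> g) ` A)\<rparr>"

text \<open>For the empty poset, of length \<open>-1\<close>, this is the negative of the trivial representation.\<close>

definition lefschetz ::
    "('g \<Rightarrow> 'a \<Rightarrow> 'a) \<Rightarrow> 'a rel \<Rightarrow> ('g, int \<Rightarrow> ('a set \<Rightarrow>\<^sub>0 complex) set) virtual_rep" where
  "lefschetz \<phi> P =
     (rep_sum {i \<in> {-1..poset_length P}. even i} (homology_rep \<phi> P),
      rep_sum {i \<in> {-1..poset_length P}. odd i} (homology_rep \<phi> P))"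

end

theory Submission
  imports Defs
begin

text \<open>
  Write \<open>R\<close> for the poset obtained from the Rees product of the dual of \<open>P\<close> with the tree by removing
  its minimum. It is the union of the principal ideals of the maximal elements \<open>(b, w)\<close>, where \<open>b\<close> is
  the minimum of \<open>P\<close> and \<open>w\<close> runs through the words. For \<open>w \<noteq> []\<close> the ideal of \<open>(b, w)\<close> meets the
  ideals of the words that do not extend \<open>w\<close> in a subposet that is anti-isomorphic to
  \<open>I\<^sub>j\<^sub>-\<^sub>1(P)\<close> with \<open>j = length w\<close>, and this subposet also lies below \<open>(b, butlast w)\<close>. Hence \<open>R\<close> arises
  from the cone with apex \<open>(b, [])\<close> by attaching cones along null-homotopic subcomplexes, and gluing
  two cones over a cycle of \<open>I\<^sub>j\<^sub>-\<^sub>1(P)\<close>, with apices \<open>(b, w)\<close> and \<open>(b, butlast w)\<close>, gives an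
  isomorphism of the sum of \<open>t\<^sup>j\<close> copies of \<open>H\<^sub>k\<^sub>-\<^sub>1(I\<^sub>j\<^sub>-\<^sub>1(P))\<close> over all \<open>j\<close> onto \<open>H\<^sub>k(R)\<close>, in every degree
  \<open>k\<close>. The group fixes \<open>b\<close> and all words, so this map is equivariant. Summing over the degrees of
  either parity gives the isomorphism of virtual representations.
\<close>

subsection \<open>Linear extension\<close>

text \<open>Why the link of a word \<open>w\<close> of length \<open>j\<close> is an ideal of the
  other Rees product: a label strictly below \<open>w\<close> is a prefix of \<open>w\<close>, hence
  determined by its length. Reading this length backwards, \<open>i = j - 1 - length u\<close>,
  makes the rank conditions of the two Rees products coincide and reverses the order. The factor
  \<open>t ^ j\<close> counts the words of length \<open>j\<close>; the empty word only contributes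
  a contractible cone. The second apex has to belong to the parent of \<open>w\<close>, not to the
  root: a link may contain elements with nonempty label, and these do not lie below
  \<open>(b, [])\<close>. This choice also decouples the words. The connecting homomorphism of
  \<open>w\<close> sees a cycle glued at \<open>v\<close> only if \<open>w\<close> is a prefix of
  \<open>v\<close> but not of \<open>butlast v\<close>, that is, if \<open>w = v\<close>. So the
  connecting homomorphisms of all words together invert the gluing map, and neither an induction
  over the tree nor an exact sequence is required. As gluing raises the degree by one, it exchanges
  even and odd degrees; this is the origin of the minus sign.\<close>

abbreviation coeff_at :: "('s \<Rightarrow>\<^sub>0 complex) \<Rightarrow> 's \<Rightarrow> complex" where
  "coeff_at \<equiv> Poly_Mapping.lookup"

abbreviation supp :: "('s \<Rightarrow>\<^sub>0 complex) \<Rightarrow> 's set" where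
  "supp \<equiv> Poly_Mapping.keys"

abbreviation scale :: "complex \<Rightarrow> ('s \<Rightarrow>\<^sub>0 complex) \<Rightarrow> ('s \<Rightarrow>\<^sub>0 complex)" where
  "scale a \<equiv> Poly_Mapping.map ((*) a)"

lemma coeff_scale [simp]: "coeff_at (scale a c) k = a * coeff_at c k"
  by (simp add: Poly_Mapping.map.rep_eq when_def)

lemma scale_add: "scale a (c + d) = scale a c + scale a d"
  by (rule poly_mapping_eqI) (simp add: lookup_add algebra_simps)

lemma scale_zero [simp]: "scale a 0 = 0"
  by (rule poly_mapping_eqI) simp

lemma scale_zero_left [simp]: "scale 0 c = 0"
  by (rule poly_mapping_eqI) simp

lemma scale_one [simp]: "scale 1 c = c"
  by (rule poly_mapping_eqI) simp

lemma scale_minus_one: "scale (- 1) c = - c"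
  by (rule poly_mapping_eqI) simp

lemma scale_scale [simp]: "scale a (scale b c) = scale (a * b) c"
  by (rule poly_mapping_eqI) simp

lemma scale_single [simp]: "scale a (Poly_Mapping.single k b) = Poly_Mapping.single k (a * b)"
  by (rule poly_mapping_eqI) (simp add: lookup_single when_def)

lemma scale_sum: "scale a (\<Sum>i\<in>I. f i) = (\<Sum>i\<in>I. scale a (f i))"
  by (induction I rule: infinite_finite_induct) (simp_all add: scale_add)

lemma supp_scale: "supp (scale a c) \<subseteq> supp c"
  by (auto simp: in_keys_iff)

text \<open>Boundary, cone, projection to a set of chains and induced maps are all linear
  extensions, so linearity is proved once, and identities between composites reduce to single chains
  by \<open>lin_ext_lin_ext\<close> and \<open>lin_ext_cong\<close>.\<close>

definition lin_ext :: "('s \<Rightarrow> ('t \<Rightarrow>\<^sub>0 complex)) \<Rightarrow> ('s \<Rightarrow>\<^sub>0 complex) \<Rightarrow> ('t \<Rightarrow>\<^sub>0 complex)" where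
  "lin_ext f c = (\<Sum>C \<in> supp c. scale (coeff_at c C) (f C))"

lemma lin_ext_superset:
  assumes "finite S" "supp c \<subseteq> S"
  shows "lin_ext f c = (\<Sum>C \<in> S. scale (coeff_at c C) (f C))"
  unfolding lin_ext_def by (rule sum.mono_neutral_left) (use assms in \<open>auto simp: in_keys_iff\<close>)

lemma lin_ext_zero [simp]: "lin_ext f 0 = 0"
  by (simp add: lin_ext_def)

lemma lin_ext_add: "lin_ext f (c + d) = lin_ext f c + lin_ext f d"
proof -
  let ?S = "supp c \<union> supp d"
  have "lin_ext f (c + d) = (\<Sum>C \<in> ?S. scale (coeff_at (c + d) C) (f C))"
    by (rule lin_ext_superset) (auto dest: subsetD[OF Poly_Mapping.keys_add])
  also have "\<dots> = (\<Sum>C \<in> ?S. scale (coeff_at c C) (f C) + scale (coeff_at d C) (f C))"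
    by (intro sum.cong refl poly_mapping_eqI) (simp add: lookup_add algebra_simps)
  also have "\<dots> = lin_ext f c + lin_ext f d"
    by (simp add: sum.distrib lin_ext_superset[of ?S])
  finally show ?thesis .
qed

lemma lin_ext_scale: "lin_ext f (scale a c) = scale a (lin_ext f c)"
  by (subst lin_ext_superset[of "supp c"]) (auto simp: supp_scale lin_ext_def scale_sum)

lemma lin_ext_uminus: "lin_ext f (- c) = - lin_ext f c"
  by (metis lin_ext_scale scale_minus_one)

lemma lin_ext_diff: "lin_ext f (c - d) = lin_ext f c - lin_ext f d"
  using lin_ext_add[of f c "- d"] by (simp add: lin_ext_uminus)

lemma lin_ext_sum: "lin_ext f (\<Sum>i\<in>I. c i) = (\<Sum>i\<in>I. lin_ext f (c i))"
  by (induction I rule: infinite_finite_induct) (simp_all add: lin_ext_add)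

lemma lin_ext_single [simp]: "lin_ext f (Poly_Mapping.single C a) = scale a (f C)"
  by (cases "a = 0") (simp_all add: lin_ext_def)

lemma lin_ext_cong: "(\<And>C. C \<in> supp c \<Longrightarrow> f C = g C) \<Longrightarrow> lin_ext f c = lin_ext g c"
  by (simp add: lin_ext_def)

lemma lin_ext_lin_ext: "lin_ext f (lin_ext g c) = lin_ext (\<lambda>C. lin_ext f (g C)) c"
  by (simp add: lin_ext_def[of g c] lin_ext_sum lin_ext_scale
      lin_ext_def[of "\<lambda>C. lin_ext f (g C)" c])

lemma lin_ext_fun_add: "lin_ext (\<lambda>C. f C + g C) c = lin_ext f c + lin_ext g c"
  by (simp add: lin_ext_def scale_add sum.distrib)

lemma lin_ext_fun_uminus: "lin_ext (\<lambda>C. - f C) c = - lin_ext f c"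
  unfolding lin_ext_def sum_negf[symmetric]
  by (intro sum.cong refl) (rule poly_mapping_eqI, simp)

lemma lin_ext_fun_diff: "lin_ext (\<lambda>C. f C - g C) c = lin_ext f c - lin_ext g c"
  using lin_ext_fun_add[of f "\<lambda>C. - g C" c] by (simp add: lin_ext_fun_uminus)

lemma lin_ext_fun_sum: "lin_ext (\<lambda>C. \<Sum>i\<in>I. f i C) c = (\<Sum>i\<in>I. lin_ext (f i) c)"
  unfolding lin_ext_def scale_sum by (rule sum.swap)

lemma lin_ext_id [simp]: "lin_ext (\<lambda>C. Poly_Mapping.single C 1) c = c"
proof -
  have "lin_ext (\<lambda>C. Poly_Mapping.single C 1) c
      = (\<Sum>C\<in>supp c. Poly_Mapping.single C (coeff_at c C))"
    by (simp add: lin_ext_def)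
  also have "\<dots> = c"
    by (rule poly_mapping_eqI) (simp add: lookup_sum lookup_single when_def in_keys_iff)
  finally show ?thesis .
qed

lemma lin_ext_eqI:
  assumes "\<And>C. C \<in> supp c \<Longrightarrow> f C = Poly_Mapping.single C 1"
  shows "lin_ext f c = c"
  using lin_ext_cong[of c f, OF assms] by simp

lemma supp_lin_ext: "supp (lin_ext f c) \<subseteq> (\<Union>C \<in> supp c. supp (f C))"
proof -
  have "supp (lin_ext f c) \<subseteq> (\<Union>C \<in> supp c. supp (scale (coeff_at c C) (f C)))"
    unfolding lin_ext_def by (rule Poly_Mapping.keys_sum)
  with supp_scale show ?thesis by fastforce
qed


subsection \<open>Chains of a poset\<close>

definition bd :: "'a rel \<Rightarrow> 'a set \<Rightarrow> ('a set \<Rightarrow>\<^sub>0 complex)" where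
  "bd P C = (\<Sum>x \<in> C. Poly_Mapping.single (C - {x}) ((- 1) ^ card (C \<inter> underS P x)))"

lemma boundary_eq_lin_ext: "boundary P = lin_ext (bd P)"
  by (rule ext) (simp add: boundary_def lin_ext_def bd_def scale_sum mult.commute)

lemma chain_map_eq_lin_ext: "chain_map f = lin_ext (\<lambda>C. Poly_Mapping.single (f ` C) 1)"
  by (rule ext) (simp add: chain_map_def lin_ext_def)

lemmas boundary_add = lin_ext_add[of "bd P" for P, folded boundary_eq_lin_ext]
lemmas boundary_diff = lin_ext_diff[of "bd P" for P, folded boundary_eq_lin_ext]
lemmas boundary_uminus = lin_ext_uminus[of "bd P" for P, folded boundary_eq_lin_ext]
lemmas boundary_scale = lin_ext_scale[of "bd P" for P, folded boundary_eq_lin_ext]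
lemmas boundary_sum = lin_ext_sum[of "bd P" for P, folded boundary_eq_lin_ext]

lemma boundary_zero [simp]: "boundary P 0 = 0"
  by (simp add: boundary_eq_lin_ext)

text \<open>The simplices of all dimensions together, the empty chain included; most chain-level
  identities do not depend on the dimension.\<close>

definition fin_chains :: "'a rel \<Rightarrow> 'a set set" where
  "fin_chains P = {C \<in> Chains P. finite C}"

lemma simplices_subset_fin_chains: "simplices P k \<subseteq> fin_chains P"
  by (auto simp: simplices_def fin_chains_def)

lemma fin_chains_subset: "C \<in> fin_chains P \<Longrightarrow> D \<subseteq> C \<Longrightarrow> D \<in> fin_chains P"
  unfolding fin_chains_def Chains_def by (auto intro: finite_subset)

lemma fin_chains_insert:
  assumes "C \<in> fin_chains P" "\<And>x. x \<in> C \<Longrightarrow> (x, v) \<in> P" "(v, v) \<in> P"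
  shows "insert v C \<in> fin_chains P"
  using assms unfolding fin_chains_def Chains_def by auto

lemma fin_chain_has_greatest:
  assumes "C \<in> fin_chains P" "C \<noteq> {}" "trans P"
  obtains v where "v \<in> C" "\<And>x. x \<in> C \<Longrightarrow> (x, v) \<in> P"
proof -
  have "finite C" "C \<in> Chains P" using assms by (auto simp: fin_chains_def)
  then have "C \<noteq> {} \<Longrightarrow> \<exists>v\<in>C. \<forall>x\<in>C. (x, v) \<in> P"
  proof (induction C rule: finite_induct)
    case (insert a C)
    show ?case
    proof (cases "C = {}")
      case True
      with insert.prems show ?thesis by (auto simp: Chains_def)
    next
      case False
      with insert obtain v where v: "v \<in> C" "\<forall>x\<in>C. (x, v) \<in> P"
        unfolding Chains_def by blast
      with insert.prems have "(a, v) \<in> P \<or> (v, a) \<in> P" "(a, a) \<in> P"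
        unfolding Chains_def by blast+
      with v \<open>trans P\<close> show ?thesis
        by (metis insert_iff transD)
    qed
  qed simp
  with assms(2) that show ?thesis by blast
qed

text \<open>The vertex \<open>v\<close> is meant to lie above the chains, so its index in
  \<open>insert v C\<close> is \<open>card C\<close>; the sign gives the face opposite to
  \<open>v\<close> the coefficient 1. Chains that already contain \<open>v\<close> would become
  degenerate and go to 0.\<close>

definition cone :: "'a \<Rightarrow> ('a set \<Rightarrow>\<^sub>0 complex) \<Rightarrow> ('a set \<Rightarrow>\<^sub>0 complex)" where
  "cone v = lin_ext (\<lambda>C. if v \<in> C then 0 else Poly_Mapping.single (insert v C) ((- 1) ^ card C))"

lemma bd_insert_top:
  assumes "antisym P" "finite C" "v \<notin> C" "\<And>x. x \<in> C \<Longrightarrow> (x, v) \<in> P"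
  shows "bd P (insert v C) = Poly_Mapping.single C ((- 1) ^ card C) +
     (\<Sum>x \<in> C. Poly_Mapping.single (insert v (C - {x})) ((- 1) ^ card (C \<inter> underS P x)))"
proof -
  have 1: "insert v C \<inter> underS P v = C"
    using assms by (auto simp: underS_def)
  have 2: "insert v C \<inter> underS P x = C \<inter> underS P x" if "x \<in> C" for x
    using assms(1,3) assms(4)[OF that] that by (auto simp: underS_def dest: antisymD)
  have 3: "insert v C - {x} = insert v (C - {x})" if "x \<in> C" for x
    using that assms(3) by auto
  show ?thesis
    using assms(2,3) by (simp add: bd_def 1 2 3)
qed

text \<open>On chains below \<open>v\<close> the cone operator is a contracting homotopy. If
  \<open>v\<close> lies in the chain, only the face without \<open>v\<close> survives coning and
  gives the chain back. Otherwise the cones over the faces occur in the two summands with opposite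
  signs, as a face has one element fewer.\<close>

lemma cone_homotopy:
  assumes "antisym P" "\<And>C. C \<in> supp c \<Longrightarrow> finite C"
    "\<And>C x. C \<in> supp c \<Longrightarrow> x \<in> C \<Longrightarrow> (x, v) \<in> P"
  shows "boundary P (cone v c) + cone v (boundary P c) = c"
proof -
  let ?k = "\<lambda>C. if v \<in> C then 0 else Poly_Mapping.single (insert v C) ((- 1 :: complex) ^ card C)"
  have *: "lin_ext (bd P) (?k C) + lin_ext ?k (bd P C) = Poly_Mapping.single C 1"
    if "C \<in> supp c" for C
  proof (cases "v \<in> C")
    case True
    define D where "D = C - {v}"
    have D: "C = insert v D" "v \<notin> D" "finite D" "\<And>x. x \<in> D \<Longrightarrow> (x, v) \<in> P"
      using True assms that by (auto simp: D_def)
    have "bd P C = Poly_Mapping.single D ((- 1) ^ card D) +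
       (\<Sum>x \<in> D. Poly_Mapping.single (insert v (D - {x})) ((- 1) ^ card (D \<inter> underS P x)))"
      unfolding D(1) by (rule bd_insert_top) (use assms(1) D in auto)
    then have "lin_ext ?k (bd P C) = Poly_Mapping.single C 1"
      using D(1,2) by (simp add: lin_ext_add lin_ext_sum)
    with True show ?thesis by simp
  next
    case False
    have fin: "finite C" and le: "\<And>x. x \<in> C \<Longrightarrow> (x, v) \<in> P" using assms that by auto
    have "lin_ext ?k (bd P C) =
       (\<Sum>x\<in>C. Poly_Mapping.single (insert v (C - {x})) ((- 1) ^ card (C \<inter> underS P x) * (- 1) ^ (card C - 1)))"
      unfolding bd_def lin_ext_sum by (rule sum.cong) (use fin False in auto)
    also have "\<dots> = (\<Sum>x\<in>C. scale (- ((- 1) ^ card C)) (Poly_Mapping.single (insert v (C - {x}))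
        ((- 1) ^ card (C \<inter> underS P x))))"
    proof (rule sum.cong)
      fix x assume "x \<in> C"
      then obtain m where "card C = Suc m" using fin by (metis card_Suc_Diff1)
      then show "Poly_Mapping.single (insert v (C - {x})) ((- 1) ^ card (C \<inter> underS P x) * (- 1) ^ (card C - 1))
        = scale (- ((- 1 :: complex) ^ card C)) (Poly_Mapping.single (insert v (C - {x}))
        ((- 1) ^ card (C \<inter> underS P x)))"
        by (simp add: mult.commute)
    qed simp
    finally have 1: "lin_ext ?k (bd P C) = scale (- ((- 1) ^ card C))
        (\<Sum>x\<in>C. Poly_Mapping.single (insert v (C - {x})) ((- 1) ^ card (C \<inter> underS P x)))"
      by (simp only: scale_sum)
    have 2: "lin_ext (bd P) (?k C) = scale ((- 1) ^ card C) (bd P (insert v C))"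
      using False by simp
    have 3: "bd P (insert v C) = Poly_Mapping.single C ((- 1) ^ card C) +
       (\<Sum>x \<in> C. Poly_Mapping.single (insert v (C - {x})) ((- 1) ^ card (C \<inter> underS P x)))"
      by (rule bd_insert_top) (use assms(1) fin False le in auto)
    show ?thesis
      unfolding 1 2 3 by (rule poly_mapping_eqI) (simp add: lookup_add distrib_left lookup_single when_def)
  qed
  have "boundary P (cone v c) + cone v (boundary P c)
      = lin_ext (\<lambda>C. lin_ext (bd P) (?k C) + lin_ext ?k (bd P C)) c"
    by (simp only: boundary_eq_lin_ext cone_def lin_ext_lin_ext lin_ext_fun_add)
  also have "\<dots> = c" by (rule lin_ext_eqI) (rule *)
  finally show ?thesis .
qed

section \<open>The boundary of a boundary\<close>

lemma supp_bd: "supp (bd P C) \<subseteq> (\<lambda>x. C - {x}) ` C"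
proof -
  have "supp (bd P C) \<subseteq>
      (\<Union>x\<in>C. supp (Poly_Mapping.single (C - {x}) ((- 1 :: complex) ^ card (C \<inter> underS P x))))"
    unfolding bd_def by (rule Poly_Mapping.keys_sum)
  then show ?thesis by auto
qed

lemma supp_boundary: "supp (boundary P c) \<subseteq> (\<Union>C\<in>supp c. (\<lambda>x. C - {x}) ` C)"
  unfolding boundary_eq_lin_ext by (rule order_trans[OF supp_lin_ext UN_mono[OF order_refl supp_bd]])

text \<open>Induction replaces the usual pairing of faces: up to sign \<open>C\<close> is the cone
  over \<open>D\<close> with the greatest element of \<open>C\<close> as apex, and two uses of the
  homotopy formula turn the double boundary of this cone into the cone over the double boundary of
  \<open>D\<close>.\<close>

lemma boundary_boundary_single:
  assumes "antisym P" "trans P" "C \<in> fin_chains P"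
  shows "boundary P (boundary P (Poly_Mapping.single C 1)) = 0"
  using assms(3)
proof (induction "card C" arbitrary: C)
  case 0
  then have "C = {}" by (auto simp: fin_chains_def)
  then show ?case by (simp add: boundary_eq_lin_ext bd_def)
next
  case (Suc m)
  then have "C \<noteq> {}" by auto
  then obtain v where v: "v \<in> C" "\<And>x. x \<in> C \<Longrightarrow> (x, v) \<in> P"
    using fin_chain_has_greatest[OF Suc.prems _ assms(2)] by blast
  have fin: "finite C" using Suc.prems by (simp add: fin_chains_def)
  define D where "D = C - {v}"
  have D: "C = insert v D" "v \<notin> D" "finite D" "card D = m" "D \<in> fin_chains P"
    using v fin Suc fin_chains_subset[OF Suc.prems] by (auto simp: D_def)
  let ?d = "Poly_Mapping.single D (1 :: complex)"
  have le: "(x, v) \<in> P" if "x \<in> D" for x using v that by (auto simp: D_def)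
  have "boundary P (cone v ?d) + cone v (boundary P ?d) = ?d"
    by (rule cone_homotopy) (use assms le D in auto)
  moreover have "boundary P (cone v (boundary P ?d)) + cone v (boundary P (boundary P ?d)) = boundary P ?d"
    by (rule cone_homotopy)
      (use assms(1) le D supp_boundary[of P ?d] in \<open>auto dest!: subsetD\<close>)
  ultimately have "boundary P (boundary P (cone v ?d)) = 0"
    using Suc.hyps(1)[of D] D by (simp add: boundary_diff cone_def flip: eq_diff_eq)
  moreover have "cone v ?d = scale ((- 1) ^ card D) (Poly_Mapping.single C 1)"
    using D by (simp add: cone_def)
  ultimately have "scale ((- 1) ^ card D * (- 1) ^ card D)
      (boundary P (boundary P (Poly_Mapping.single C 1))) = 0"
    by (metis boundary_scale scale_scale scale_zero)
  then show ?case by simp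
qed

lemma boundary_boundary:
  assumes "antisym P" "trans P" "supp c \<subseteq> fin_chains P"
  shows "boundary P (boundary P c) = 0"
proof -
  have "boundary P (boundary P c) = lin_ext (\<lambda>C. lin_ext (bd P) (bd P C)) c"
    by (simp add: boundary_eq_lin_ext lin_ext_lin_ext)
  also have "\<dots> = lin_ext (\<lambda>C. 0) c"
  proof (rule lin_ext_cong)
    fix C assume "C \<in> supp c"
    with boundary_boundary_single[OF assms(1,2), of C] assms(3)
    show "lin_ext (bd P) (bd P C) = 0" by (auto simp: boundary_eq_lin_ext)
  qed
  finally show ?thesis by (simp add: lin_ext_def)
qed


subsection \<open>Homology\<close>

definition lin_subspace :: "('s \<Rightarrow>\<^sub>0 complex) set \<Rightarrow> bool" where
  "lin_subspace S \<longleftrightarrow> 0 \<in> S \<and> (\<forall>x \<in> S. \<forall>y \<in> S. x + y \<in> S) \<and> (\<forall>a. \<forall>x \<in> S. scale a x \<in> S)"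

lemma lin_subspaceD:
  assumes "lin_subspace S"
  shows "0 \<in> S" "x \<in> S \<Longrightarrow> y \<in> S \<Longrightarrow> x + y \<in> S" "x \<in> S \<Longrightarrow> scale a x \<in> S"
    "x \<in> S \<Longrightarrow> - x \<in> S" "x \<in> S \<Longrightarrow> y \<in> S \<Longrightarrow> x - y \<in> S"
proof -
  show 1: "0 \<in> S" "x \<in> S \<Longrightarrow> y \<in> S \<Longrightarrow> x + y \<in> S" "x \<in> S \<Longrightarrow> scale a x \<in> S" for x y a
    using assms by (auto simp: lin_subspace_def)
  show 2: "x \<in> S \<Longrightarrow> - x \<in> S" for x
    using 1(3)[of x "-1"] by (simp add: scale_minus_one)
  show "x \<in> S \<Longrightarrow> y \<in> S \<Longrightarrow> x - y \<in> S"
    using 1(2)[of x "- y"] 2 by simp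
qed

lemma lin_subspace_sum:
  "lin_subspace S \<Longrightarrow> (\<And>i. i \<in> I \<Longrightarrow> f i \<in> S) \<Longrightarrow> (\<Sum>i\<in>I. f i) \<in> S"
  by (induction I rule: infinite_finite_induct) (auto simp: lin_subspaceD)

text \<open>A homology class is literally a set of chains; the order of the summands is that of the
  right cosets to which \<open>quotient_module\<close> unfolds. With \<open>homology_simps\<close>
  all operations on classes move to representatives.\<close>

definition coset :: "('s \<Rightarrow>\<^sub>0 complex) set \<Rightarrow> ('s \<Rightarrow>\<^sub>0 complex) \<Rightarrow> ('s \<Rightarrow>\<^sub>0 complex) set" where
  "coset B z = (\<lambda>b. b + z) ` B"

lemma coset_eq_iff:
  assumes "lin_subspace B"
  shows "coset B x = coset B y \<longleftrightarrow> x - y \<in> B"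
proof
  assume "coset B x = coset B y"
  moreover have "x \<in> coset B x"
    unfolding coset_def using lin_subspaceD(1)[OF assms] by (rule rev_image_eqI) simp
  ultimately obtain b where "b \<in> B" "x = b + y" by (auto simp: coset_def)
  then show "x - y \<in> B" by simp
next
  assume *: "x - y \<in> B"
  show "coset B x = coset B y"
  proof (intro equalityI subsetI)
    fix u assume "u \<in> coset B x"
    then obtain b where "b \<in> B" "u = b + x" by (auto simp: coset_def)
    then show "u \<in> coset B y"
      unfolding coset_def using * lin_subspaceD(2)[OF assms, of b "x - y"]
      by (intro image_eqI[of _ _ "b + (x - y)"]) auto
  next
    fix u assume "u \<in> coset B y"
    then obtain b where "b \<in> B" "u = b + y" by (auto simp: coset_def)
    then show "u \<in> coset B x"
      unfolding coset_def using * lin_subspaceD(5)[OF assms, of b "x - y"]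
      by (intro image_eqI[of _ _ "b - (x - y)"]) auto
  qed
qed

lemma carrier_chain_module: "carrier (chain_module P k) = {c. supp c \<subseteq> simplices P k}"
  by (simp add: chain_module_def)

lemma lin_subspace_chain_module: "lin_subspace (carrier (chain_module P k))"
  unfolding lin_subspace_def carrier_chain_module
  by (auto dest!: subsetD[OF Poly_Mapping.keys_add] subsetD[OF supp_scale])

lemma lin_subspace_cycles: "lin_subspace (cycles P k)"
  using lin_subspace_chain_module[of P k]
  by (auto simp: lin_subspace_def cycles_def boundary_add boundary_scale)

lemma lin_subspace_boundaries: "lin_subspace (boundaries P k)"
  unfolding lin_subspace_def boundaries_def
proof (intro conjI ballI allI)
  note S = lin_subspaceD[OF lin_subspace_chain_module[of P "k + 1"]]
  show "0 \<in> boundary P ` carrier (chain_module P (k + 1))"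
    using S(1) by (intro image_eqI[of _ _ 0]) auto
  fix x assume "x \<in> boundary P ` carrier (chain_module P (k + 1))"
  then obtain c where c: "c \<in> carrier (chain_module P (k + 1))" "x = boundary P c" by auto
  then show "scale a x \<in> boundary P ` carrier (chain_module P (k + 1))" for a
    using S(3) by (intro image_eqI[of _ _ "scale a c"]) (auto simp: boundary_scale)
  fix y assume "y \<in> boundary P ` carrier (chain_module P (k + 1))"
  then obtain d where d: "d \<in> carrier (chain_module P (k + 1))" "y = boundary P d" by auto
  with c show "x + y \<in> boundary P ` carrier (chain_module P (k + 1))"
    using S(2) by (intro image_eqI[of _ _ "c + d"]) (auto simp: boundary_add)
qed

lemma carrier_reduced_homology:
  "carrier (reduced_homology P k) = coset (boundaries P k) ` cycles P k"
  by (auto simp: reduced_homology_def quotient_module_def A_RCOSETS_def RCOSETS_def r_coset_def coset_def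
      chain_module_def)


lemma zero_reduced_homology: "\<zero>\<^bsub>reduced_homology P k\<^esub> = coset (boundaries P k) 0"
  by (simp add: reduced_homology_def quotient_module_def coset_def)

lemma add_reduced_homology:
  "coset (boundaries P k) x \<oplus>\<^bsub>reduced_homology P k\<^esub> coset (boundaries P k) y
    = coset (boundaries P k) (x + y)"
proof -
  let ?B = "boundaries P k"
  have "coset ?B x \<oplus>\<^bsub>reduced_homology P k\<^esub> coset ?B y = {a + b | a b. a \<in> coset ?B x \<and> b \<in> coset ?B y}"
    by (auto simp: reduced_homology_def quotient_module_def set_add_defs chain_module_def)
  also have "\<dots> = coset ?B (x + y)"
  proof (intro equalityI subsetI)
    fix u assume "u \<in> {a + b | a b. a \<in> coset ?B x \<and> b \<in> coset ?B y}"
    then obtain b c where "b \<in> ?B" "c \<in> ?B" "u = (b + x) + (c + y)" by (auto simp: coset_def)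
    then show "u \<in> coset ?B (x + y)"
      unfolding coset_def using lin_subspaceD(2)[OF lin_subspace_boundaries, of b P k c]
      by (intro image_eqI[of _ _ "b + c"]) (auto simp: algebra_simps)
  next
    fix u assume "u \<in> coset ?B (x + y)"
    then obtain b where "b \<in> ?B" "u = (b + x) + (0 + y)" by (auto simp: coset_def algebra_simps)
    then show "u \<in> {a + b | a b. a \<in> coset ?B x \<and> b \<in> coset ?B y}"
      unfolding coset_def using lin_subspaceD(1)[OF lin_subspace_boundaries, of P k] by blast
  qed
  finally show ?thesis .
qed

lemma smult_reduced_homology:
  "a \<odot>\<^bsub>reduced_homology P k\<^esub> coset (boundaries P k) x = coset (boundaries P k) (scale a x)"
proof -
  let ?B = "boundaries P k"
  note S = lin_subspaceD[OF lin_subspace_boundaries[of P k]]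
  have "a \<odot>\<^bsub>reduced_homology P k\<^esub> coset ?B x = (\<Union>v \<in> coset ?B x. coset ?B (scale a v))"
    by (auto simp: reduced_homology_def quotient_module_def a_r_coset_defs coset_def chain_module_def)
  \<comment> \<open>Scaling members of one class gives members of one class, so the union that
    defines the scalar multiple is constant.\<close>
  also have "\<dots> = (\<Union>v \<in> coset ?B x. coset ?B (scale a x))"
  proof (rule SUP_cong)
    fix v assume "v \<in> coset ?B x"
    then obtain b where "b \<in> ?B" "v = b + x" by (auto simp: coset_def)
    then show "coset ?B (scale a v) = coset ?B (scale a x)"
      using S(3) by (simp add: coset_eq_iff[OF lin_subspace_boundaries] scale_add)
  qed simp
  also have "\<dots> = coset ?B (scale a x)"
    using S(1) by (auto simp: coset_def)
  finally show ?thesis .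
qed

lemmas homology_simps = carrier_reduced_homology zero_reduced_homology add_reduced_homology
  smult_reduced_homology

lemma chain_map_coset: "chain_map f ` B = B \<Longrightarrow> chain_map f ` coset B x = coset B (chain_map f x)"
  unfolding coset_def by (force simp: chain_map_eq_lin_ext lin_ext_add image_image)

lemma reduced_homology_trivial:
  assumes "simplices P k = {}"
  shows "carrier (reduced_homology P k) = {\<zero>\<^bsub>reduced_homology P k\<^esub>}"
proof -
  have "cycles P k = {0}"
    using assms by (auto simp: cycles_def carrier_chain_module)
  then show ?thesis by (simp add: homology_simps)
qed


subsection \<open>Maps induced by isomorphisms and anti-isomorphisms\<close>

definition order_aut :: "'a rel \<Rightarrow> ('a \<Rightarrow> 'a) \<Rightarrow> bool" where
  "order_aut P f \<longleftrightarrow> bij_betw f (Field P) (Field P) \<and>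
     (\<forall>x \<in> Field P. \<forall>y \<in> Field P. (f x, f y) \<in> P \<longleftrightarrow> (x, y) \<in> P)"

lemma fin_chains_Field: "C \<in> fin_chains P \<Longrightarrow> C \<subseteq> Field P"
  by (auto simp: fin_chains_def Chains_def Field_def)

lemma bd_image:
  assumes "inj_on f C"
  shows "bd Q (f ` C) =
    (\<Sum>x \<in> C. Poly_Mapping.single (f ` (C - {x})) ((- 1) ^ card (f ` C \<inter> underS Q (f x))))"
  unfolding bd_def by (subst sum.reindex[OF assms]) (auto intro!: sum.cong simp: inj_on_image_set_diff[OF assms])

text \<open>An order embedding keeps the number of chain elements below each vertex, hence all signs
  in the boundary.\<close>

lemma boundary_chain_map:
  assumes "supp c \<subseteq> fin_chains P" "inj_on f (Field P)"
    "\<And>x y. x \<in> Field P \<Longrightarrow> y \<in> Field P \<Longrightarrow> (f x, f y) \<in> Q \<longleftrightarrow> (x, y) \<in> P"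
  shows "boundary Q (chain_map f c) = chain_map f (boundary P c)"
  unfolding boundary_eq_lin_ext chain_map_eq_lin_ext lin_ext_lin_ext
proof (rule lin_ext_cong)
  fix C assume "C \<in> supp c"
  then have C: "C \<subseteq> Field P" "finite C" using assms(1) fin_chains_Field[of C P]
    by (auto simp: fin_chains_def)
  have inj: "inj_on f C" by (rule inj_on_subset[OF assms(2) C(1)])
  have "f ` C \<inter> underS Q (f x) = f ` (C \<inter> underS P x)" if "x \<in> C" for x
    using that C inj assms(3) by (fastforce simp: underS_def inj_on_def)
  moreover have "card (f ` (C \<inter> underS P x)) = card (C \<inter> underS P x)" for x
    by (rule card_image) (rule inj_on_subset[OF inj], auto)
  ultimately show "lin_ext (bd Q) (Poly_Mapping.single (f ` C) 1)
      = lin_ext (\<lambda>C. Poly_Mapping.single (f ` C) 1) (bd P C)"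
    by (simp add: bd_image[OF inj]) (simp add: bd_def lin_ext_sum)
qed

definition dual_map :: "('a \<Rightarrow> 'b) \<Rightarrow> ('a set \<Rightarrow>\<^sub>0 complex) \<Rightarrow> ('b set \<Rightarrow>\<^sub>0 complex)" where
  "dual_map f = lin_ext (\<lambda>C. Poly_Mapping.single (f ` C) ((- 1) ^ (card C choose 2)))"

text \<open>Reversing a chain with \<open>m\<close> elements is a permutation of sign \<open>(-1)\<close> to the power \<open>m choose 2\<close>,
  which is why this sign turns an anti-isomorphism into a chain map.\<close>

lemma boundary_dual_map:
  assumes "supp c \<subseteq> fin_chains P" "\<And>C. C \<in> supp c \<Longrightarrow> C \<subseteq> A" "antisym Q" "inj_on f A"
    "\<And>x y. x \<in> A \<Longrightarrow> y \<in> A \<Longrightarrow> (x, y) \<in> P \<Longrightarrow> (f y, f x) \<in> Q"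
  shows "boundary Q (dual_map f c) = dual_map f (boundary P c)"
  unfolding boundary_eq_lin_ext dual_map_def lin_ext_lin_ext
proof (rule lin_ext_cong)
  fix C assume C0: "C \<in> supp c"
  then have C: "C \<subseteq> A" "finite C" "C \<in> Chains P" using assms(1,2)
    by (auto simp: fin_chains_def)
  have inj: "inj_on f C" by (rule inj_on_subset[OF assms(4) C(1)])
  let ?m = "card C"
  have *: "(- 1) ^ (?m choose 2) * (- 1) ^ card (f ` C \<inter> underS Q (f x))
      = (- 1) ^ card (C \<inter> underS P x) * (- 1 :: complex) ^ (card (C - {x}) choose 2)" if x: "x \<in> C" for x
  proof -
    \<comment> \<open>Only one direction of the order reversal is assumed; comparability inside the
      chain and antisymmetry of \<open>Q\<close> supply the other.\<close>
    have "f ` C \<inter> underS Q (f x) = f ` (C - (insert x (C \<inter> underS P x)))"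
    proof (intro equalityI subsetI)
      fix u assume "u \<in> f ` C \<inter> underS Q (f x)"
      then obtain y where y: "y \<in> C" "u = f y" "f y \<noteq> f x" "(f y, f x) \<in> Q" by (auto simp: underS_def)
      have "(y, x) \<notin> P"
        using y assms(5)[of y x] C(1) x antisymD[OF assms(3)] by blast
      with y show "u \<in> f ` (C - (insert x (C \<inter> underS P x)))" by (auto simp: underS_def)
    next
      fix u assume "u \<in> f ` (C - (insert x (C \<inter> underS P x)))"
      then obtain y where y: "y \<in> C" "u = f y" "y \<noteq> x" "(y, x) \<notin> P" by (auto simp: underS_def)
      with C(3) x have "(x, y) \<in> P" by (auto simp: Chains_def)
      with y x C(1) assms(5)[of x y] have "(f y, f x) \<in> Q" by blast
      with y x inj show "u \<in> f ` C \<inter> underS Q (f x)"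
        by (auto simp: underS_def inj_on_def)
    qed
    then have "card (f ` C \<inter> underS Q (f x)) = card (C - (insert x (C \<inter> underS P x)))"
      by (simp add: card_image inj_on_subset[OF inj])
    also have "\<dots> = ?m - Suc (card (C \<inter> underS P x))"
      using x C(2) by (subst card_Diff_subset) (auto simp: underS_def)
    finally have 1: "card (f ` C \<inter> underS Q (f x)) = ?m - Suc (card (C \<inter> underS P x))" .
    have "card (C \<inter> underS P x) < ?m"
      by (rule psubset_card_mono) (use x C(2) in \<open>auto simp: underS_def\<close>)
    then obtain d where d: "?m = Suc (card (C \<inter> underS P x) + d)"
      by (auto simp: less_iff_Suc_add)
    have 2: "card (C - {x}) = card (C \<inter> underS P x) + d"
      using d x C(2) by simp
    \<comment> \<open>By Pascal's rule the sign exponents of the chain and of its face differ by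
      \<open>card C - 1\<close>, the number of vertices below \<open>x\<close> plus the number
      \<open>d\<close> above it. Adding the reversed index, which is \<open>d\<close>, leaves the
      number below \<open>x\<close> modulo 2.\<close>
    have 3: "?m choose 2 = (card (C \<inter> underS P x) + d) + ((card (C \<inter> underS P x) + d) choose 2)"
      unfolding d numeral_2_eq_2 by simp
    have "card (f ` C \<inter> underS Q (f x)) = d" using 1 d by simp
    then show ?thesis unfolding 2 3 by (simp add: power_add)
  qed
  have "lin_ext (bd Q) (Poly_Mapping.single (f ` C) ((- 1) ^ (?m choose 2)))
    = (\<Sum>x \<in> C. Poly_Mapping.single (f ` (C - {x})) ((- 1) ^ (?m choose 2) * (- 1) ^ card (f ` C \<inter> underS Q (f x))))"
    by (simp add: bd_image[OF inj] scale_sum)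
  also have "\<dots> = (\<Sum>x \<in> C. Poly_Mapping.single (f ` (C - {x}))
      ((- 1) ^ card (C \<inter> underS P x) * (- 1) ^ (card (C - {x}) choose 2)))"
    by (rule sum.cong) (simp_all only: *)
  also have "\<dots> = lin_ext (\<lambda>C. Poly_Mapping.single (f ` C) ((- 1) ^ (card C choose 2))) (bd P C)"
    by (simp add: bd_def lin_ext_sum)
  finally show "lin_ext (bd Q) (Poly_Mapping.single (f ` C) ((- 1) ^ (?m choose 2)))
    = lin_ext (\<lambda>C. Poly_Mapping.single (f ` C) ((- 1) ^ (card C choose 2))) (bd P C)" .
qed

lemma dual_map_inverse:
  assumes "\<And>C. C \<in> supp c \<Longrightarrow> inj_on f C" "\<And>C x. C \<in> supp c \<Longrightarrow> x \<in> C \<Longrightarrow> h (f x) = x"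
  shows "dual_map h (dual_map f c) = c"
  unfolding dual_map_def lin_ext_lin_ext
proof (rule lin_ext_eqI)
  fix C assume C: "C \<in> supp c"
  then have "h ` f ` C = C" using assms(2) by (force simp: image_image)
  with assms(1)[OF C] show "lin_ext (\<lambda>C. Poly_Mapping.single (h ` C) ((- 1) ^ (card C choose 2)))
      (Poly_Mapping.single (f ` C) ((- 1) ^ (card C choose 2))) = Poly_Mapping.single C 1"
    by (simp add: card_image)
qed

lemma supp_dual_map: "supp (dual_map f c) \<subseteq> (\<lambda>C. f ` C) ` supp c"
  unfolding dual_map_def by (rule order_trans[OF supp_lin_ext]) auto

lemma supp_chain_map: "supp (chain_map f c) \<subseteq> (\<lambda>C. f ` C) ` supp c"
  unfolding chain_map_eq_lin_ext by (rule order_trans[OF supp_lin_ext]) auto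

text \<open>The disjunction serves order-preserving and order-reversing maps alike, since a chain
  only asks for comparability.\<close>

lemma image_simplices:
  assumes "C \<in> simplices P k" "C \<subseteq> A" "inj_on f A"
    "\<And>x y. x \<in> A \<Longrightarrow> y \<in> A \<Longrightarrow> (x, y) \<in> P \<Longrightarrow> (f x, f y) \<in> Q \<or> (f y, f x) \<in> Q"
  shows "f ` C \<in> simplices Q k"
  using assms inj_on_subset[OF assms(3,2)]
  by (auto simp: simplices_def card_image Chains_def subset_iff) (metis)

text \<open>The last claim has to be an equality: a group element acts on a class by the image of a
  set, which is a full coset only if no boundary is missed. Surjectivity comes from the chain map of
  the inverse function.\<close>

lemma order_aut_chain_map:
  assumes "order_aut P f"
  shows "c \<in> carrier (chain_module P k) \<Longrightarrow> chain_map f c \<in> carrier (chain_module P k)"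
    "c \<in> cycles P k \<Longrightarrow> chain_map f c \<in> cycles P k"
    "chain_map f ` boundaries P k = boundaries P k"
proof -
  have bij: "bij_betw f (Field P) (Field P)"
    and iff: "\<And>x y. x \<in> Field P \<Longrightarrow> y \<in> Field P \<Longrightarrow> (f x, f y) \<in> P \<longleftrightarrow> (x, y) \<in> P"
    using assms by (auto simp: order_aut_def)
  have F: "C \<subseteq> Field P" if "C \<in> simplices P k" for C k
    using that simplices_subset_fin_chains fin_chains_Field by blast
  have inj: "inj_on f (Field P)" using bij by (simp add: bij_betw_def)
  have comm: "boundary P (chain_map f c) = chain_map f (boundary P c)"
    if "c \<in> carrier (chain_module P k)" for c k
    by (rule boundary_chain_map)
      (use that iff inj simplices_subset_fin_chains[of P k] in \<open>auto simp: carrier_chain_module\<close>)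
  show 1: "chain_map f c \<in> carrier (chain_module P k)" if "c \<in> carrier (chain_module P k)" for c k
    unfolding carrier_chain_module
  proof safe
    fix D assume "D \<in> supp (chain_map f c)"
    with that supp_chain_map[of f c] obtain C where "C \<in> simplices P k" "D = f ` C"
      unfolding carrier_chain_module by blast
    then show "D \<in> simplices P k"
      using F[of C k] image_simplices[of C P k "Field P" f P] inj iff by blast
  qed
  show "chain_map f c \<in> cycles P k" if "c \<in> cycles P k"
    using that 1 comm by (auto simp: cycles_def chain_map_eq_lin_ext)
  have "chain_map f ` carrier (chain_module P k) = carrier (chain_module P k)" for k
  proof (intro equalityI subsetI)
    fix c assume c: "c \<in> carrier (chain_module P k)"
    let ?h = "the_inv_into (Field P) f"
    have h: "?h x \<in> Field P" "f (?h x) = x" if "x \<in> Field P" for x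
      using bij that by (auto simp: bij_betw_def the_inv_into_into f_the_inv_into_f)
    have hinj: "inj_on ?h (Field P)"
      by (metis h(2) inj_onI)
    have hiff: "(?h x, ?h y) \<in> P" if "(x, y) \<in> P" for x y
    proof -
      have "x \<in> Field P" "y \<in> Field P" using that by (auto simp: Field_def)
      with iff[of "?h x" "?h y"] h that show ?thesis by simp
    qed
    have "chain_map f (chain_map ?h c) = c"
      unfolding chain_map_eq_lin_ext lin_ext_lin_ext
    proof (rule lin_ext_eqI)
      fix C assume "C \<in> supp c"
      then have "C \<subseteq> Field P" using c F by (auto simp: carrier_chain_module)
      then have "f ` ?h ` C = C" using h(2) by (force simp: image_image)
      then show "lin_ext (\<lambda>C. Poly_Mapping.single (f ` C) 1) (Poly_Mapping.single (?h ` C) 1)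
        = Poly_Mapping.single C 1" by simp
    qed
    moreover have "chain_map ?h c \<in> carrier (chain_module P k)"
      unfolding carrier_chain_module
    proof safe
      fix D assume "D \<in> supp (chain_map ?h c)"
      with c supp_chain_map[of ?h c] obtain C where "C \<in> simplices P k" "D = ?h ` C"
        unfolding carrier_chain_module by blast
      then show "D \<in> simplices P k"
        using F[of C k] image_simplices[of C P k "Field P" ?h P] hinj hiff by blast
    qed
    ultimately show "c \<in> chain_map f ` carrier (chain_module P k)" by (metis imageI)
  qed (use 1 in blast)
  note onto = this
  have "chain_map f ` boundaries P k = boundary P ` chain_map f ` carrier (chain_module P (k + 1))"
    unfolding boundaries_def image_image by (rule image_cong) (auto simp: comm)
  then show "chain_map f ` boundaries P k = boundaries P k"
    by (simp add: onto boundaries_def)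
qed


subsection \<open>Isomorphisms of representations\<close>

definition rep_ok :: "('g, 'm) monoid_scheme \<Rightarrow> ('g, 'v) rep \<Rightarrow> bool" where
  "rep_ok G V \<longleftrightarrow>
     (\<forall>v \<in> carrier (space V). \<forall>w \<in> carrier (space V). v \<oplus>\<^bsub>space V\<^esub> w \<in> carrier (space V)) \<and>
     (\<forall>a. \<forall>v \<in> carrier (space V). a \<odot>\<^bsub>space V\<^esub> v \<in> carrier (space V)) \<and>
     (\<forall>g \<in> carrier G. \<forall>v \<in> carrier (space V). act V g v \<in> carrier (space V))"

lemma rep_isoI:
  assumes "bij_betw f (carrier (space V)) (carrier (space W))"
    "\<And>v w. v \<in> carrier (space V) \<Longrightarrow> w \<in> carrier (space V) \<Longrightarrow> f (v \<oplus>\<^bsub>space V\<^esub> w) = f v \<oplus>\<^bsub>space W\<^esub> f w"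
    "\<And>a v. v \<in> carrier (space V) \<Longrightarrow> f (a \<odot>\<^bsub>space V\<^esub> v) = a \<odot>\<^bsub>space W\<^esub> f v"
    "\<And>g v. g \<in> carrier G \<Longrightarrow> v \<in> carrier (space V) \<Longrightarrow> f (act V g v) = act W g (f v)"
  shows "rep_iso G V W"
  unfolding rep_iso_def
  by (rule bexI[of _ f]) (use assms bij_betwE[OF assms(1)] in \<open>auto simp: iso_def hom_def\<close>)

lemma rep_isoE:
  assumes "rep_iso G V W"
  obtains f where "bij_betw f (carrier (space V)) (carrier (space W))"
    "\<And>v w. v \<in> carrier (space V) \<Longrightarrow> w \<in> carrier (space V) \<Longrightarrow> f (v \<oplus>\<^bsub>space V\<^esub> w) = f v \<oplus>\<^bsub>space W\<^esub> f w"
    "\<And>a v. v \<in> carrier (space V) \<Longrightarrow> f (a \<odot>\<^bsub>space V\<^esub> v) = a \<odot>\<^bsub>space W\<^esub> f v"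
    "\<And>g v. g \<in> carrier G \<Longrightarrow> v \<in> carrier (space V) \<Longrightarrow> f (act V g v) = act W g (f v)"
  using assms unfolding rep_iso_def by (auto simp: iso_def hom_def intro: that)

lemma rep_iso_trans [trans]:
  assumes "rep_iso G U V" "rep_iso G V W"
  shows "rep_iso G U W"
proof -
  obtain f where f: "bij_betw f (carrier (space U)) (carrier (space V))"
    "\<And>v w. v \<in> carrier (space U) \<Longrightarrow> w \<in> carrier (space U) \<Longrightarrow> f (v \<oplus>\<^bsub>space U\<^esub> w) = f v \<oplus>\<^bsub>space V\<^esub> f w"
    "\<And>a v. v \<in> carrier (space U) \<Longrightarrow> f (a \<odot>\<^bsub>space U\<^esub> v) = a \<odot>\<^bsub>space V\<^esub> f v"
    "\<And>g v. g \<in> carrier G \<Longrightarrow> v \<in> carrier (space U) \<Longrightarrow> f (act U g v) = act V g (f v)"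
    using rep_isoE[OF assms(1)] by blast
  obtain h where h: "bij_betw h (carrier (space V)) (carrier (space W))"
    "\<And>v w. v \<in> carrier (space V) \<Longrightarrow> w \<in> carrier (space V) \<Longrightarrow> h (v \<oplus>\<^bsub>space V\<^esub> w) = h v \<oplus>\<^bsub>space W\<^esub> h w"
    "\<And>a v. v \<in> carrier (space V) \<Longrightarrow> h (a \<odot>\<^bsub>space V\<^esub> v) = a \<odot>\<^bsub>space W\<^esub> h v"
    "\<And>g v. g \<in> carrier G \<Longrightarrow> v \<in> carrier (space V) \<Longrightarrow> h (act V g v) = act W g (h v)"
    using rep_isoE[OF assms(2)] by blast
  show ?thesis
    by (rule rep_isoI[of "h \<circ> f"])
      (use bij_betw_trans[OF f(1) h(1)] f(2-4) h(2-4) bij_betwE[OF f(1)] in auto)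
qed

text \<open>The inverse is compared with the operations by applying \<open>f\<close>, which is
  possible only for sums, multiples and translates that stay inside \<open>V\<close>; this closure
  is what \<open>rep_ok\<close> records.\<close>

lemma rep_iso_sym:
  assumes "rep_iso G V W" "rep_ok G V"
  shows "rep_iso G W V"
proof -
  obtain f where f: "bij_betw f (carrier (space V)) (carrier (space W))"
    "\<And>v w. v \<in> carrier (space V) \<Longrightarrow> w \<in> carrier (space V) \<Longrightarrow> f (v \<oplus>\<^bsub>space V\<^esub> w) = f v \<oplus>\<^bsub>space W\<^esub> f w"
    "\<And>a v. v \<in> carrier (space V) \<Longrightarrow> f (a \<odot>\<^bsub>space V\<^esub> v) = a \<odot>\<^bsub>space W\<^esub> f v"
    "\<And>g v. g \<in> carrier G \<Longrightarrow> v \<in> carrier (space V) \<Longrightarrow> f (act V g v) = act W g (f v)"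
    using rep_isoE[OF assms(1)] by blast
  let ?h = "the_inv_into (carrier (space V)) f"
  have inj: "inj_on f (carrier (space V))" using f(1) by (simp add: bij_betw_def)
  have h: "?h w \<in> carrier (space V)" "f (?h w) = w" if "w \<in> carrier (space W)" for w
    using f(1) that by (auto simp: bij_betw_def the_inv_into_into f_the_inv_into_f)
  have hI: "?h w = v" if "f v = w" "v \<in> carrier (space V)" for v w
    using that inj by (simp add: the_inv_into_f_eq)
  note ok = assms(2)[unfolded rep_ok_def, THEN conjunct1, rule_format]
    assms(2)[unfolded rep_ok_def, THEN conjunct2, THEN conjunct1, rule_format]
    assms(2)[unfolded rep_ok_def, THEN conjunct2, THEN conjunct2, rule_format]
  show ?thesis
  proof (rule rep_isoI[of ?h])
    show "bij_betw ?h (carrier (space W)) (carrier (space V))"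
      by (rule bij_betw_the_inv_into[OF f(1)])
  qed (intro hI; use h f(2-4) ok in simp)+
qed

section \<open>Direct sums of representations\<close>

lemma rep_sum_simps:
  "carrier (space (rep_sum I V)) = (\<Pi>\<^sub>E i \<in> I. carrier (space (V i)))"
  "\<zero>\<^bsub>space (rep_sum I V)\<^esub> = (\<lambda>i \<in> I. \<zero>\<^bsub>space (V i)\<^esub>)"
  "v \<oplus>\<^bsub>space (rep_sum I V)\<^esub> w = (\<lambda>i \<in> I. v i \<oplus>\<^bsub>space (V i)\<^esub> w i)"
  "a \<odot>\<^bsub>space (rep_sum I V)\<^esub> v = (\<lambda>i \<in> I. a \<odot>\<^bsub>space (V i)\<^esub> v i)"
  "act (rep_sum I V) g v = (\<lambda>i \<in> I. act (V i) g (v i))"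
  by (simp_all add: rep_sum_def)

lemma rep_sum2_simps:
  "carrier (space (rep_sum2 V W)) = carrier (space V) \<times> carrier (space W)"
  "(v, w) \<oplus>\<^bsub>space (rep_sum2 V W)\<^esub> (v', w') = (v \<oplus>\<^bsub>space V\<^esub> v', w \<oplus>\<^bsub>space W\<^esub> w')"
  "a \<odot>\<^bsub>space (rep_sum2 V W)\<^esub> (v, w) = (a \<odot>\<^bsub>space V\<^esub> v, a \<odot>\<^bsub>space W\<^esub> w)"
  "act (rep_sum2 V W) g (v, w) = (act V g v, act W g w)"
  by (simp_all add: rep_sum2_def)

lemma rep_ok_rep_sum: "(\<And>i. i \<in> I \<Longrightarrow> rep_ok G (V i)) \<Longrightarrow> rep_ok G (rep_sum I V)"
  unfolding rep_ok_def rep_sum_simps by (auto simp: PiE_iff)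

lemma rep_sum2_cong:
  assumes "rep_iso G V V'" "rep_iso G W W'"
  shows "rep_iso G (rep_sum2 V W) (rep_sum2 V' W')"
proof -
  obtain f where f: "bij_betw f (carrier (space V)) (carrier (space V'))"
    "\<And>v w. v \<in> carrier (space V) \<Longrightarrow> w \<in> carrier (space V) \<Longrightarrow> f (v \<oplus>\<^bsub>space V\<^esub> w) = f v \<oplus>\<^bsub>space V'\<^esub> f w"
    "\<And>a v. v \<in> carrier (space V) \<Longrightarrow> f (a \<odot>\<^bsub>space V\<^esub> v) = a \<odot>\<^bsub>space V'\<^esub> f v"
    "\<And>g v. g \<in> carrier G \<Longrightarrow> v \<in> carrier (space V) \<Longrightarrow> f (act V g v) = act V' g (f v)"
    using rep_isoE[OF assms(1)] by blast
  obtain h where h: "bij_betw h (carrier (space W)) (carrier (space W'))"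
    "\<And>v w. v \<in> carrier (space W) \<Longrightarrow> w \<in> carrier (space W) \<Longrightarrow> h (v \<oplus>\<^bsub>space W\<^esub> w) = h v \<oplus>\<^bsub>space W'\<^esub> h w"
    "\<And>a v. v \<in> carrier (space W) \<Longrightarrow> h (a \<odot>\<^bsub>space W\<^esub> v) = a \<odot>\<^bsub>space W'\<^esub> h v"
    "\<And>g v. g \<in> carrier G \<Longrightarrow> v \<in> carrier (space W) \<Longrightarrow> h (act W g v) = act W' g (h v)"
    using rep_isoE[OF assms(2)] by blast
  show ?thesis
  proof (rule rep_isoI[of "map_prod f h"])
    show "bij_betw (map_prod f h) (carrier (space (rep_sum2 V W))) (carrier (space (rep_sum2 V' W')))"
      unfolding rep_sum2_simps by (rule bij_betw_map_prod[OF f(1) h(1)])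
  qed (auto simp: rep_sum2_simps f h)
qed

lemma rep_sum_cong:
  assumes "\<And>i. i \<in> I \<Longrightarrow> rep_iso G (V i) (W i)"
  shows "rep_iso G (rep_sum I V) (rep_sum I W)"
proof -
  have "\<forall>i \<in> I. \<exists>f. bij_betw f (carrier (space (V i))) (carrier (space (W i))) \<and>
    (\<forall>v \<in> carrier (space (V i)). \<forall>w \<in> carrier (space (V i)). f (v \<oplus>\<^bsub>space (V i)\<^esub> w) = f v \<oplus>\<^bsub>space (W i)\<^esub> f w) \<and>
    (\<forall>a. \<forall>v \<in> carrier (space (V i)). f (a \<odot>\<^bsub>space (V i)\<^esub> v) = a \<odot>\<^bsub>space (W i)\<^esub> f v) \<and>
    (\<forall>g \<in> carrier G. \<forall>v \<in> carrier (space (V i)). f (act (V i) g v) = act (W i) g (f v))"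
  proof
    fix i assume "i \<in> I"
    from rep_isoE[OF assms[OF this]] show "\<exists>f. bij_betw f (carrier (space (V i))) (carrier (space (W i))) \<and>
    (\<forall>v \<in> carrier (space (V i)). \<forall>w \<in> carrier (space (V i)). f (v \<oplus>\<^bsub>space (V i)\<^esub> w) = f v \<oplus>\<^bsub>space (W i)\<^esub> f w) \<and>
    (\<forall>a. \<forall>v \<in> carrier (space (V i)). f (a \<odot>\<^bsub>space (V i)\<^esub> v) = a \<odot>\<^bsub>space (W i)\<^esub> f v) \<and>
    (\<forall>g \<in> carrier G. \<forall>v \<in> carrier (space (V i)). f (act (V i) g v) = act (W i) g (f v))"
      by metis
  qed
  from bchoice[OF this] obtain f where
    bij: "\<And>i. i \<in> I \<Longrightarrow> bij_betw (f i) (carrier (space (V i))) (carrier (space (W i)))" and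
    f: "\<And>i v w. i \<in> I \<Longrightarrow> v \<in> carrier (space (V i)) \<Longrightarrow> w \<in> carrier (space (V i)) \<Longrightarrow>
          f i (v \<oplus>\<^bsub>space (V i)\<^esub> w) = f i v \<oplus>\<^bsub>space (W i)\<^esub> f i w"
       "\<And>i a v. i \<in> I \<Longrightarrow> v \<in> carrier (space (V i)) \<Longrightarrow> f i (a \<odot>\<^bsub>space (V i)\<^esub> v) = a \<odot>\<^bsub>space (W i)\<^esub> f i v"
       "\<And>i g v. i \<in> I \<Longrightarrow> g \<in> carrier G \<Longrightarrow> v \<in> carrier (space (V i)) \<Longrightarrow> f i (act (V i) g v) = act (W i) g (f i v)"
    by blast
  let ?F = "\<lambda>v. \<lambda>i \<in> I. f i (v i)"
  let ?H = "\<lambda>v. \<lambda>i \<in> I. the_inv_into (carrier (space (V i))) (f i) (v i)"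
  have inj: "inj_on (f i) (carrier (space (V i)))" if "i \<in> I" for i
    using bij[OF that] by (simp add: bij_betw_def)
  have f_in: "f i v \<in> carrier (space (W i))" if "i \<in> I" "v \<in> carrier (space (V i))" for i v
    using bij_betwE[OF bij[OF that(1)]] that(2) by blast
  have h: "the_inv_into (carrier (space (V i))) (f i) w \<in> carrier (space (V i))"
    "f i (the_inv_into (carrier (space (V i))) (f i) w) = w"
    if "i \<in> I" "w \<in> carrier (space (W i))" for i w
    using bij[OF that(1)] that(2) by (auto simp: bij_betw_def the_inv_into_into f_the_inv_into_f)
  show ?thesis
  proof (rule rep_isoI[of ?F])
    show "bij_betw ?F (carrier (space (rep_sum I V))) (carrier (space (rep_sum I W)))"
      unfolding rep_sum_simps
      by (rule bij_betw_byWitness[where f' = ?H])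
        (auto simp: PiE_iff h f_in the_inv_into_f_f[OF inj] extensional_def intro!: ext)
  qed (auto simp: rep_sum_simps PiE_iff f intro!: restrict_ext)
qed

lemma rep_sum_reindex:
  assumes "bij_betw h I J"
  shows "rep_iso G (rep_sum J V) (rep_sum I (\<lambda>i. V (h i)))"
proof (rule rep_isoI[of "\<lambda>v. \<lambda>i \<in> I. v (h i)"])
  have h: "h i \<in> J" if "i \<in> I" for i using bij_betwE[OF assms] that by blast
  let ?k = "the_inv_into I h"
  have k: "?k j \<in> I" "h (?k j) = j" if "j \<in> J" for j
    using assms that by (auto simp: bij_betw_def the_inv_into_into f_the_inv_into_f)
  have kh: "?k (h i) = i" if "i \<in> I" for i
    using assms that by (simp add: bij_betw_def the_inv_into_f_f)
  show "bij_betw (\<lambda>v. \<lambda>i \<in> I. v (h i)) (carrier (space (rep_sum J V)))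
      (carrier (space (rep_sum I (\<lambda>i. V (h i)))))"
    unfolding rep_sum_simps
  proof (rule bij_betw_byWitness[where f' = "\<lambda>v. \<lambda>j \<in> J. v (?k j)"])
    show "(\<lambda>v. \<lambda>j\<in>J. v (?k j)) ` (\<Pi>\<^sub>E i\<in>I. carrier (space (V (h i)))) \<subseteq> (\<Pi>\<^sub>E i\<in>J. carrier (space (V i)))"
    proof safe
      fix v j assume v: "v \<in> (\<Pi>\<^sub>E i\<in>I. carrier (space (V (h i))))" and j: "j \<in> J"
      from PiE_mem[OF v k(1)[OF j]] k(2)[OF j] j
      show "(\<lambda>j\<in>J. v (?k j)) j \<in> carrier (space (V j))" by simp
    qed (simp add: restrict_def)
  qed (auto simp: PiE_iff h k kh extensional_def intro!: ext)
  show "(\<lambda>i\<in>I. (v \<oplus>\<^bsub>space (rep_sum J V)\<^esub> w) (h i)) =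
     (\<lambda>i\<in>I. v (h i)) \<oplus>\<^bsub>space (rep_sum I (\<lambda>i. V (h i)))\<^esub> (\<lambda>i\<in>I. w (h i))" for v w
    by (auto simp: rep_sum_simps h intro!: restrict_ext)
  show "(\<lambda>i\<in>I. (a \<odot>\<^bsub>space (rep_sum J V)\<^esub> v) (h i)) =
     a \<odot>\<^bsub>space (rep_sum I (\<lambda>i. V (h i)))\<^esub> (\<lambda>i\<in>I. v (h i))" for a v
    by (auto simp: rep_sum_simps h intro!: restrict_ext)
  show "(\<lambda>i\<in>I. act (rep_sum J V) g v (h i)) = act (rep_sum I (\<lambda>i. V (h i))) g (\<lambda>i\<in>I. v (h i))" for g v
    by (auto simp: rep_sum_simps h intro!: restrict_ext)
qed

lemma rep_sum_Sigma:
  "rep_iso G (rep_sum I (\<lambda>i. rep_sum (K i) (V i))) (rep_sum (Sigma I K) (\<lambda>(i, k). V i k))"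
proof (rule rep_isoI[of "\<lambda>v. \<lambda>(i, k) \<in> Sigma I K. v i k"])
  show "bij_betw (\<lambda>v. \<lambda>(i, k) \<in> Sigma I K. v i k) (carrier (space (rep_sum I (\<lambda>i. rep_sum (K i) (V i)))))
     (carrier (space (rep_sum (Sigma I K) (\<lambda>(i, k). V i k))))"
    unfolding rep_sum_simps
    by (rule bij_betw_byWitness[where f' = "\<lambda>v. \<lambda>i \<in> I. \<lambda>k \<in> K i. v (i, k)"])
      (auto simp: PiE_iff extensional_def split: prod.splits if_splits intro!: ext)
qed (auto simp: rep_sum_simps restrict_def split: prod.splits intro!: ext)

lemma rep_sum_swap:
  "rep_iso G (rep_sum I (\<lambda>i. rep_sum K (V i))) (rep_sum K (\<lambda>k. rep_sum I (\<lambda>i. V i k)))"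
proof (rule rep_isoI[of "\<lambda>v. \<lambda>k \<in> K. \<lambda>i \<in> I. v i k"])
  show "bij_betw (\<lambda>v. \<lambda>k \<in> K. \<lambda>i \<in> I. v i k) (carrier (space (rep_sum I (\<lambda>i. rep_sum K (V i)))))
     (carrier (space (rep_sum K (\<lambda>k. rep_sum I (\<lambda>i. V i k)))))"
    unfolding rep_sum_simps
    by (rule bij_betw_byWitness[where f' = "\<lambda>v. \<lambda>i \<in> I. \<lambda>k \<in> K. v k i"])
      (auto simp: PiE_iff extensional_def intro!: ext)
qed (auto simp: rep_sum_simps restrict_def intro!: ext)

text \<open>Adding or dropping zero summands lets Lefschetz sums over different ranges of degrees be
  compared over a common range. By \<open>rep_ok\<close> the operations preserve the zeros that are
  filled in.\<close>

lemma rep_sum_restrict: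
  assumes "A \<subseteq> B" "\<And>i. i \<in> B - A \<Longrightarrow> carrier (space (V i)) = {\<zero>\<^bsub>space (V i)\<^esub>}"
    "\<And>i. i \<in> B - A \<Longrightarrow> rep_ok G (V i)"
  shows "rep_iso G (rep_sum B V) (rep_sum A V)"
    and "rep_iso G (rep_sum A V) (rep_sum B V)"
proof -
  have ok: "v \<oplus>\<^bsub>space (V i)\<^esub> w = \<zero>\<^bsub>space (V i)\<^esub>" "a \<odot>\<^bsub>space (V i)\<^esub> v = \<zero>\<^bsub>space (V i)\<^esub>"
    "g \<in> carrier G \<Longrightarrow> act (V i) g v = \<zero>\<^bsub>space (V i)\<^esub>"
    if "i \<in> B" "i \<notin> A" "v = \<zero>\<^bsub>space (V i)\<^esub>" "w = \<zero>\<^bsub>space (V i)\<^esub>" for i a g v w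
    using assms(2,3)[of i] that unfolding rep_ok_def by auto
  let ?F = "\<lambda>v. \<lambda>i \<in> A. v i"
  let ?H = "\<lambda>v. \<lambda>i \<in> B. if i \<in> A then v i else \<zero>\<^bsub>space (V i)\<^esub>"
  have 1: "\<forall>v \<in> (\<Pi>\<^sub>E i\<in>B. carrier (space (V i))). ?H (?F v) = v"
    using assms(1,2) by (fastforce simp: PiE_iff extensional_def)
  have 2: "\<forall>v \<in> (\<Pi>\<^sub>E i\<in>A. carrier (space (V i))). ?F (?H v) = v"
    using assms(1) by (auto simp: PiE_iff extensional_def intro!: ext)
  have 3: "?F ` (\<Pi>\<^sub>E i\<in>B. carrier (space (V i))) \<subseteq> (\<Pi>\<^sub>E i\<in>A. carrier (space (V i)))"
    using assms(1) by (auto simp: PiE_iff)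
  have 4: "?H ` (\<Pi>\<^sub>E i\<in>A. carrier (space (V i))) \<subseteq> (\<Pi>\<^sub>E i\<in>B. carrier (space (V i)))"
    using assms(1,2) by (auto simp: PiE_iff)
  show "rep_iso G (rep_sum B V) (rep_sum A V)"
  proof (rule rep_isoI[of ?F])
    show "bij_betw ?F (carrier (space (rep_sum B V))) (carrier (space (rep_sum A V)))"
      unfolding rep_sum_simps by (rule bij_betw_byWitness[OF 1 2 3 4])
  qed (use assms(1) in \<open>auto simp: rep_sum_simps intro!: restrict_ext\<close>)
  show "rep_iso G (rep_sum A V) (rep_sum B V)"
  proof (rule rep_isoI[of ?H])
    show "bij_betw ?H (carrier (space (rep_sum A V))) (carrier (space (rep_sum B V)))"
      unfolding rep_sum_simps by (rule bij_betw_byWitness[OF 2 1 4 3])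
  qed (auto simp: rep_sum_simps ok intro!: restrict_ext)
qed


subsection \<open>Homology representations\<close>

lemma homology_rep_simps:
  "space (homology_rep \<phi> P k) = reduced_homology P k"
  "act (homology_rep \<phi> P k) g A = chain_map (\<phi> g) ` A"
  by (simp_all add: homology_rep_def)

lemma rep_ok_homology_rep:
  assumes "\<And>g. g \<in> carrier G \<Longrightarrow> order_aut P (\<phi> g)"
  shows "rep_ok G (homology_rep \<phi> P k)"
  unfolding rep_ok_def homology_rep_simps
  using order_aut_chain_map[OF assms] lin_subspaceD[OF lin_subspace_cycles]
  by (auto simp: homology_simps chain_map_coset intro!: imageI)

text \<open>Moves an isomorphism of homology to the level of chains. Injectivity and surjectivity
  are required of the whole family at once, because the images must also form a direct sum. The
  degrees \<open>l\<close> and \<open>k\<close> are independent, as gluing cones will raise the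
  degree.\<close>

lemma homology_rep_direct_sum:
  fixes Q :: "'i \<Rightarrow> 'x rel" and R :: "'y rel" and \<Psi> :: "'i \<Rightarrow> ('x set \<Rightarrow>\<^sub>0 complex) \<Rightarrow> ('y set \<Rightarrow>\<^sub>0 complex)"
  assumes autQ: "\<And>i g. i \<in> J \<Longrightarrow> g \<in> carrier G \<Longrightarrow> order_aut (Q i) (\<phi> g)"
    and autR: "\<And>g. g \<in> carrier G \<Longrightarrow> order_aut R (\<phi>' g)"
    and add: "\<And>i c d. i \<in> J \<Longrightarrow> \<Psi> i (c + d) = \<Psi> i c + \<Psi> i d"
    and scale: "\<And>i a c. i \<in> J \<Longrightarrow> \<Psi> i (scale a c) = scale a (\<Psi> i c)"
    and cyc: "\<And>i c. i \<in> J \<Longrightarrow> c \<in> cycles (Q i) l \<Longrightarrow> \<Psi> i c \<in> cycles R k"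
    and bnd: "\<And>i c. i \<in> J \<Longrightarrow> c \<in> boundaries (Q i) l \<Longrightarrow> \<Psi> i c \<in> boundaries R k"
    and inj: "\<And>c i. (\<And>i. i \<in> J \<Longrightarrow> c i \<in> cycles (Q i) l) \<Longrightarrow> (\<Sum>i\<in>J. \<Psi> i (c i)) \<in> boundaries R k \<Longrightarrow>
        i \<in> J \<Longrightarrow> c i \<in> boundaries (Q i) l"
    and surj: "\<And>z. z \<in> cycles R k \<Longrightarrow>
        \<exists>c. (\<forall>i \<in> J. c i \<in> cycles (Q i) l) \<and> z - (\<Sum>i\<in>J. \<Psi> i (c i)) \<in> boundaries R k"
    and equivariant: "\<And>i g c. i \<in> J \<Longrightarrow> g \<in> carrier G \<Longrightarrow> c \<in> cycles (Q i) l \<Longrightarrow>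
        \<Psi> i (chain_map (\<phi> g) c) = chain_map (\<phi>' g) (\<Psi> i c)"
  shows "rep_iso G (rep_sum J (\<lambda>i. homology_rep \<phi> (Q i) l)) (homology_rep \<phi>' R k)"
proof -
  let ?B = "\<lambda>i. boundaries (Q i) l"
  let ?BR = "boundaries R k"
  note SR = lin_subspaceD[OF lin_subspace_boundaries[of R k]]
  note SZ = lin_subspaceD[OF lin_subspace_cycles]
  define rp where "rp i A = (SOME c. c \<in> cycles (Q i) l \<and> A = coset (?B i) c)" for i A
  have rp: "rp i A \<in> cycles (Q i) l" "coset (?B i) (rp i A) = A"
    if A: "A \<in> carrier (reduced_homology (Q i) l)" for i A
  proof -
    have "\<exists>c. c \<in> cycles (Q i) l \<and> A = coset (?B i) c"
      using A by (auto simp: homology_simps)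
    from someI_ex[OF this] show "rp i A \<in> cycles (Q i) l" "coset (?B i) (rp i A) = A"
      by (auto simp: rp_def)
  qed
  \<comment> \<open>The representatives are chosen arbitrarily; \<open>F_eq\<close> shows that any
    others give the same class, and each later check picks those that are convenient.\<close>
  define F where "F v = coset ?BR (\<Sum>i\<in>J. \<Psi> i (rp i (v i)))" for v
  have F_eq: "F v = coset ?BR (\<Sum>i\<in>J. \<Psi> i (c i))"
    if c: "\<And>i. i \<in> J \<Longrightarrow> c i \<in> cycles (Q i) l" and v: "\<And>i. i \<in> J \<Longrightarrow> v i = coset (?B i) (c i)" for v c
  proof -
    have "\<Psi> i (rp i (v i)) - \<Psi> i (c i) \<in> ?BR" if i: "i \<in> J" for i
    proof -
      have "v i \<in> carrier (reduced_homology (Q i) l)"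
        using c v i by (auto simp: homology_simps)
      from rp[OF this] have "rp i (v i) - c i \<in> ?B i"
        using v[OF i] by (simp add: coset_eq_iff[OF lin_subspace_boundaries])
      then have "\<Psi> i (rp i (v i) - c i) \<in> ?BR" by (rule bnd[OF i])
      moreover have "\<Psi> i (rp i (v i)) = \<Psi> i (rp i (v i) - c i) + \<Psi> i (c i)"
        using add[OF i, of "rp i (v i) - c i" "c i"] by simp
      ultimately show ?thesis by simp
    qed
    then have "(\<Sum>i\<in>J. \<Psi> i (rp i (v i)) - \<Psi> i (c i)) \<in> ?BR"
      by (rule lin_subspace_sum[OF lin_subspace_boundaries])
    then show ?thesis
      by (simp add: F_def coset_eq_iff[OF lin_subspace_boundaries] sum_subtractf)
  qed
  let ?V = "rep_sum J (\<lambda>i. homology_rep \<phi> (Q i) l)"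
  have carrierD: "\<exists>c. (\<forall>i\<in>J. c i \<in> cycles (Q i) l \<and> v i = coset (?B i) (c i))"
    if "v \<in> carrier (space ?V)" for v
    using rp that by (intro exI[of _ "\<lambda>i. rp i (v i)"]) (auto simp: rep_sum_simps homology_rep_simps PiE_iff)
  show ?thesis
  proof (rule rep_isoI[of F])
    show "bij_betw F (carrier (space ?V)) (carrier (space (homology_rep \<phi>' R k)))"
    proof (rule bij_betw_imageI)
      show "inj_on F (carrier (space ?V))"
      proof (rule inj_onI)
        fix v w assume vw: "v \<in> carrier (space ?V)" "w \<in> carrier (space ?V)" "F v = F w"
        obtain c where c: "\<And>i. i \<in> J \<Longrightarrow> c i \<in> cycles (Q i) l" "\<And>i. i \<in> J \<Longrightarrow> v i = coset (?B i) (c i)"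
          using carrierD[OF vw(1)] by blast
        obtain d where d: "\<And>i. i \<in> J \<Longrightarrow> d i \<in> cycles (Q i) l" "\<And>i. i \<in> J \<Longrightarrow> w i = coset (?B i) (d i)"
          using carrierD[OF vw(2)] by blast
        have "F v = coset ?BR (\<Sum>i\<in>J. \<Psi> i (c i))" "F w = coset ?BR (\<Sum>i\<in>J. \<Psi> i (d i))"
          by (rule F_eq; use c d in simp)+
        with vw(3) have "coset ?BR (\<Sum>i\<in>J. \<Psi> i (c i)) = coset ?BR (\<Sum>i\<in>J. \<Psi> i (d i))"
          by simp
        then have "(\<Sum>i\<in>J. \<Psi> i (c i) - \<Psi> i (d i)) \<in> ?BR"
          by (simp only: coset_eq_iff[OF lin_subspace_boundaries] sum_subtractf)
        also have "(\<Sum>i\<in>J. \<Psi> i (c i) - \<Psi> i (d i)) = (\<Sum>i\<in>J. \<Psi> i (c i - d i))"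
        proof (rule sum.cong)
          fix i assume "i \<in> J"
          from add[OF this, of "c i - d i" "d i"] show "\<Psi> i (c i) - \<Psi> i (d i) = \<Psi> i (c i - d i)"
            by simp
        qed simp
        finally have sum: "(\<Sum>i\<in>J. \<Psi> i (c i - d i)) \<in> ?BR" .
        have "c i - d i \<in> ?B i" if "i \<in> J" for i
          by (rule inj[of "\<lambda>i. c i - d i", OF _ sum that]) (rule SZ(5)[OF c(1) d(1)])
        then have eq: "v i = w i" if "i \<in> J" for i
          unfolding c(2)[OF that] d(2)[OF that]
          using that by (simp add: coset_eq_iff[OF lin_subspace_boundaries])
        show "v = w"
          using vw(1,2) unfolding rep_sum_simps by (rule PiE_ext) (rule eq)
      qed
      show "F ` carrier (space ?V) = carrier (space (homology_rep \<phi>' R k))"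
      proof (intro equalityI subsetI)
        fix A assume "A \<in> F ` carrier (space ?V)"
        then obtain v where v: "v \<in> carrier (space ?V)" "A = F v" by blast
        then obtain c where c: "\<And>i. i \<in> J \<Longrightarrow> c i \<in> cycles (Q i) l" "\<And>i. i \<in> J \<Longrightarrow> v i = coset (?B i) (c i)"
          using carrierD by blast
        have "A = coset ?BR (\<Sum>i\<in>J. \<Psi> i (c i))" unfolding v(2) by (rule F_eq; use c in simp)
        moreover have "(\<Sum>i\<in>J. \<Psi> i (c i)) \<in> cycles R k"
          by (rule lin_subspace_sum[OF lin_subspace_cycles]) (use c cyc in blast)
        ultimately show "A \<in> carrier (space (homology_rep \<phi>' R k))"
          by (auto simp: homology_rep_simps homology_simps)
      next
        fix A assume "A \<in> carrier (space (homology_rep \<phi>' R k))"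
        then obtain z where z: "z \<in> cycles R k" "A = coset ?BR z"
          by (auto simp: homology_rep_simps homology_simps)
        obtain c where c: "\<And>i. i \<in> J \<Longrightarrow> c i \<in> cycles (Q i) l" "z - (\<Sum>i\<in>J. \<Psi> i (c i)) \<in> ?BR"
          using surj[OF z(1)] by blast
        have "A = coset ?BR (\<Sum>i\<in>J. \<Psi> i (c i))"
          using z(2) c(2) by (simp add: coset_eq_iff[OF lin_subspace_boundaries])
        also have "\<dots> = F (\<lambda>i\<in>J. coset (?B i) (c i))"
          by (rule F_eq[symmetric]) (use c(1) in auto)
        finally show "A \<in> F ` carrier (space ?V)"
          using c(1) by (auto simp: rep_sum_simps homology_rep_simps homology_simps)
      qed
    qed
  next
    fix v w assume vw: "v \<in> carrier (space ?V)" "w \<in> carrier (space ?V)"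
    obtain c where c: "\<And>i. i \<in> J \<Longrightarrow> c i \<in> cycles (Q i) l" "\<And>i. i \<in> J \<Longrightarrow> v i = coset (?B i) (c i)"
      using carrierD[OF vw(1)] by blast
    obtain d where d: "\<And>i. i \<in> J \<Longrightarrow> d i \<in> cycles (Q i) l" "\<And>i. i \<in> J \<Longrightarrow> w i = coset (?B i) (d i)"
      using carrierD[OF vw(2)] by blast
    have "F v = coset ?BR (\<Sum>i\<in>J. \<Psi> i (c i))" "F w = coset ?BR (\<Sum>i\<in>J. \<Psi> i (d i))"
      by (rule F_eq; use c d in simp)+
    moreover have "F (v \<oplus>\<^bsub>space ?V\<^esub> w) = coset ?BR (\<Sum>i\<in>J. \<Psi> i (c i + d i))"
      by (rule F_eq) (use c d in \<open>auto simp: rep_sum_simps homology_rep_simps homology_simps intro: SZ(2)\<close>)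
    ultimately show "F (v \<oplus>\<^bsub>space ?V\<^esub> w) = F v \<oplus>\<^bsub>space (homology_rep \<phi>' R k)\<^esub> F w"
      by (simp add: homology_rep_simps homology_simps add sum.distrib)
  next
    fix a v assume v: "v \<in> carrier (space ?V)"
    obtain c where c: "\<And>i. i \<in> J \<Longrightarrow> c i \<in> cycles (Q i) l" "\<And>i. i \<in> J \<Longrightarrow> v i = coset (?B i) (c i)"
      using carrierD[OF v] by blast
    have "F v = coset ?BR (\<Sum>i\<in>J. \<Psi> i (c i))"
      by (rule F_eq; use c in simp)
    moreover have "F (a \<odot>\<^bsub>space ?V\<^esub> v) = coset ?BR (\<Sum>i\<in>J. \<Psi> i (scale a (c i)))"
      by (rule F_eq) (use c in \<open>auto simp: rep_sum_simps homology_rep_simps homology_simps intro: SZ(3)\<close>)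
    ultimately show "F (a \<odot>\<^bsub>space ?V\<^esub> v) = a \<odot>\<^bsub>space (homology_rep \<phi>' R k)\<^esub> F v"
      by (simp add: homology_rep_simps homology_simps scale scale_sum)
  next
    fix g v assume g: "g \<in> carrier G" and v: "v \<in> carrier (space ?V)"
    obtain c where c: "\<And>i. i \<in> J \<Longrightarrow> c i \<in> cycles (Q i) l" "\<And>i. i \<in> J \<Longrightarrow> v i = coset (?B i) (c i)"
      using carrierD[OF v] by blast
    have "F v = coset ?BR (\<Sum>i\<in>J. \<Psi> i (c i))"
      by (rule F_eq; use c in simp)
    moreover have "F (act ?V g v) = coset ?BR (\<Sum>i\<in>J. \<Psi> i (chain_map (\<phi> g) (c i)))"
      by (rule F_eq) (use c order_aut_chain_map[OF autQ[OF _ g]] in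
          \<open>auto simp: rep_sum_simps homology_rep_simps chain_map_coset\<close>)
    moreover have "(\<Sum>i\<in>J. \<Psi> i (chain_map (\<phi> g) (c i))) = chain_map (\<phi>' g) (\<Sum>i\<in>J. \<Psi> i (c i))"
      unfolding chain_map_eq_lin_ext lin_ext_sum
      by (intro sum.cong refl equivariant[unfolded chain_map_eq_lin_ext]) (use g c in auto)
    ultimately show "F (act ?V g v) = act (homology_rep \<phi>' R k) g (F v)"
      using order_aut_chain_map(3)[OF autR[OF g]]
      by (simp add: homology_rep_simps chain_map_coset)
  qed
qed


subsection \<open>Trees of cones\<close>

lemma supp_cone_avoiding:
  "D \<in> supp (cone v c) \<Longrightarrow> \<exists>C \<in> supp c. v \<notin> C \<and> D = insert v C"
proof -
  assume "D \<in> supp (cone v c)"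
  then obtain C where "C \<in> supp c" "D \<in> supp
      (if v \<in> C then 0 else Poly_Mapping.single (insert v C) ((- 1 :: complex) ^ card C))"
    unfolding cone_def by (blast dest: subsetD[OF supp_lin_ext])
  then show ?thesis by (auto split: if_splits)
qed

text \<open>
  A poset that is the union of the principal ideals of maximal elements \<open>vx w\<close>, indexed by the
  words \<open>w\<close> of a tree: the ideal of \<open>vx w\<close> meets the ideals of the words that do not extend \<open>w\<close>
  in \<open>link w\<close>, which already lies below \<open>vx\<close> of the parent of \<open>w\<close>. Thus the poset is
  obtained from the cone with apex \<open>vx []\<close> by attaching cones along null-homotopic subcomplexes.
\<close>

locale cone_tree =
  fixes R :: "'y rel" and T :: "'l list set" and lab :: "'y \<Rightarrow> 'l list" and vx :: "'l list \<Rightarrow> 'y"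
  assumes antisym_R: "antisym R" and trans_R: "trans R" and finite_T: "finite T"
    and Nil_in: "[] \<in> T"
    and prefix_closed: "w \<in> T \<Longrightarrow> prefix u w \<Longrightarrow> u \<in> T"
    and lab_in: "y \<in> Field R \<Longrightarrow> lab y \<in> T"
    and lab_mono: "(y, y') \<in> R \<Longrightarrow> prefix (lab y) (lab y')"
    and lab_vx: "w \<in> T \<Longrightarrow> lab (vx w) = w"
    and vx_refl: "w \<in> T \<Longrightarrow> (vx w, vx w) \<in> R"
    and le_vx: "y \<in> Field R \<Longrightarrow> (y, vx (lab y)) \<in> R"
    and le_vx_prefix: "(y, vx u) \<in> R \<Longrightarrow> prefix (lab y) w \<Longrightarrow> prefix w u \<Longrightarrow> u \<in> T \<Longrightarrow> (y, vx w) \<in> R"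
    and vx_antichain: "u \<in> T \<Longrightarrow> w \<in> T \<Longrightarrow> (vx u, vx w) \<in> R \<Longrightarrow> u = w"
begin

text \<open>By \<open>lab_mono\<close> and \<open>lab_vx\<close> an element with label
  \<open>w\<close> lies below \<open>vx u\<close> only for words \<open>u\<close> that extend
  \<open>w\<close>. Strictness of the prefix therefore selects what the ideal of \<open>vx w\<close>
  shares with the ideals of the other words.\<close>

definition link :: "'l list \<Rightarrow> 'y set" where
  "link w = {y. (y, vx w) \<in> R \<and> strict_prefix (lab y) w}"

text \<open>The label of the greatest element of a chain; the empty chain gets the label \<open>[]\<close>.\<close>

definition lbl :: "'y set \<Rightarrow> 'l list" where
  "lbl C = (THE u. u \<in> insert [] (lab ` C) \<and> (\<forall>y \<in> C. prefix (lab y) u))"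

lemma lbl_eqI:
  assumes "u \<in> insert [] (lab ` C)" "\<And>y. y \<in> C \<Longrightarrow> prefix (lab y) u"
  shows "lbl C = u"
  unfolding lbl_def
proof (rule the_equality)
  fix v assume "v \<in> insert [] (lab ` C) \<and> (\<forall>y \<in> C. prefix (lab y) v)"
  then have "prefix u v" "prefix v u" using assms by auto
  then show "v = u" by (rule prefix_order.antisym[rotated])
qed (use assms in auto)

lemma lbl_greatest:
  assumes "\<And>y. y \<in> C \<Longrightarrow> (y, g) \<in> R" "g \<in> C"
  shows "lbl C = lab g"
  by (rule lbl_eqI) (use assms lab_mono in auto)

lemma lbl_props:
  assumes "C \<in> fin_chains R"
  shows "lbl C \<in> insert [] (lab ` C)" "y \<in> C \<Longrightarrow> prefix (lab y) (lbl C)"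
proof -
  have "lbl C \<in> insert [] (lab ` C) \<and> (\<forall>y \<in> C. prefix (lab y) (lbl C))"
  proof (cases "C = {}")
    case True
    then show ?thesis using lbl_eqI[of "[]" C] by auto
  next
    case False
    obtain g where "g \<in> C" "\<And>x. x \<in> C \<Longrightarrow> (x, g) \<in> R"
      using fin_chain_has_greatest[OF assms False trans_R] by blast
    then show ?thesis using lbl_greatest[of C g] lab_mono by auto
  qed
  then show "lbl C \<in> insert [] (lab ` C)" "y \<in> C \<Longrightarrow> prefix (lab y) (lbl C)" by auto
qed

lemma lbl_in: "C \<in> fin_chains R \<Longrightarrow> lbl C \<in> T"
  using lbl_props(1)[of C] lab_in fin_chains_Field[of C R] Nil_in by auto

text \<open>So every chain with label \<open>w\<close> lies under the single apex
  \<open>vx w\<close>, and cycles made of such chains can be coned off, as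
  \<open>boundary_if_res_zero\<close> does.\<close>

lemma le_vx_lbl:
  assumes "C \<in> fin_chains R" "x \<in> C"
  shows "(x, vx (lbl C)) \<in> R"
proof -
  obtain g where g: "g \<in> C" "\<And>x. x \<in> C \<Longrightarrow> (x, g) \<in> R"
    using fin_chain_has_greatest[OF assms(1) _ trans_R] assms(2) by blast
  have "(x, g) \<in> R" "(g, vx (lab g)) \<in> R"
    using g assms fin_chains_Field[OF assms(1)] by (auto intro: le_vx)
  then have "(x, vx (lab g)) \<in> R" by (rule transD[OF trans_R])
  then show ?thesis using lbl_greatest[of C g] g by simp
qed

text \<open>Hence the chains whose label does not extend a given word are closed under faces and
  form a subcomplex.\<close>

lemma lbl_mono:
  assumes "C \<in> fin_chains R" "D \<subseteq> C"
  shows "prefix (lbl D) (lbl C)"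
  using lbl_props(1)[OF fin_chains_subset[OF assms]] lbl_props(2)[OF assms(1)] assms(2) by auto

section \<open>The connecting homomorphism of a word\<close>

definition restr :: "'l list \<Rightarrow> ('y set \<Rightarrow>\<^sub>0 complex) \<Rightarrow> ('y set \<Rightarrow>\<^sub>0 complex)" where
  "restr w = lin_ext (\<lambda>C. if prefix w (lbl C) then Poly_Mapping.single C 1 else 0)"

text \<open>
  The connecting homomorphism of the pair formed by the poset and its subcomplex of all chains whose
  label does not extend \<open>w\<close>.
\<close>

definition res :: "'l list \<Rightarrow> ('y set \<Rightarrow>\<^sub>0 complex) \<Rightarrow> ('y set \<Rightarrow>\<^sub>0 complex)" where
  "res w z = boundary R (restr w z) - restr w (boundary R z)"

lemma res_diff: "res w (c - d) = res w c - res w d"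
  by (simp add: res_def restr_def boundary_diff lin_ext_diff)

lemma res_sum: "res w (\<Sum>i\<in>I. c i) = (\<Sum>i\<in>I. res w (c i))"
  by (simp add: res_def restr_def boundary_sum lin_ext_sum sum_subtractf)

lemma supp_restr: "supp (restr w z) \<subseteq> supp z"
  unfolding restr_def by (rule order_trans[OF supp_lin_ext]) (auto split: if_splits)

text \<open>If deleting \<open>x\<close> destroys the property that the label extends
  \<open>w\<close>, then \<open>x\<close> carried the label and is the top of the chain. The
  remaining label and \<open>w\<close> are both prefixes of the old label, hence comparable, and so
  the remaining one is a proper prefix of \<open>w\<close>. The rest of the chain lies below
  \<open>x\<close>, thus below \<open>vx (lab x)\<close>, and \<open>le_vx_prefix\<close> brings it
  below \<open>vx w\<close>.\<close>

lemma link_if_lost: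
  assumes "C \<in> fin_chains R" "w \<noteq> []" "prefix w (lbl C)" "\<not> prefix w (lbl (C - {x}))" "y \<in> C - {x}"
    "w \<in> T"
  shows "y \<in> link w"
proof -
  have D: "C - {x} \<in> fin_chains R" by (rule fin_chains_subset[OF assms(1)]) auto
  obtain x' where x': "x' \<in> C" "lbl C = lab x'"
    using lbl_props(1)[OF assms(1)] assms(2,3) by auto
  have "x' = x"
    using lbl_props(2)[OF D, of x'] x' assms(3,4) prefix_order.trans by fastforce
  note x = x'[unfolded this]
  have y: "y \<in> C" using assms(5) by auto
  have yD: "prefix (lab y) (lbl (C - {x}))" by (rule lbl_props(2)[OF D assms(5)])
  have "prefix (lbl (C - {x})) (lbl C)" by (rule lbl_mono[OF assms(1)]) auto
  then have Dw: "prefix (lbl (C - {x})) w"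
    using assms(3,4) prefix_same_cases by blast
  have yw: "prefix (lab y) w" using yD Dw prefix_order.trans by blast
  have "lab y \<noteq> w" using yD assms(4) by auto
  moreover have "(x, y) \<notin> R"
    using lab_mono[of x y] yD assms(3,4) x(2) prefix_order.trans by metis
  then have "(y, x) \<in> R"
    using assms(1) x(1) y by (auto simp: fin_chains_def Chains_def)
  moreover have xF: "x \<in> Field R" using fin_chains_Field[OF assms(1)] x(1) by auto
  ultimately have "(y, vx (lab x)) \<in> R"
    using le_vx[OF xF] transD[OF trans_R] by metis
  then have "(y, vx w) \<in> R"
    by (rule le_vx_prefix[OF _ yw]) (use assms(3) x xF lab_in in auto)
  with yw \<open>lab y \<noteq> w\<close> show ?thesis by (simp add: link_def strict_prefix_def)
qed

text \<open>The two terms of \<open>res\<close> agree on a face unless the chain has a label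
  extending \<open>w\<close> and the face does not; \<open>link_if_lost\<close> puts such a face
  inside the link.\<close>

lemma supp_res:
  assumes "supp z \<subseteq> fin_chains R" "w \<in> T" "w \<noteq> []" "D \<in> supp (res w z)"
  shows "D \<subseteq> link w \<and> (\<exists>C \<in> supp z. \<exists>x \<in> C. D = C - {x})"
proof -
  let ?r = "\<lambda>C. if prefix w (lbl C) then Poly_Mapping.single C (1 :: complex) else 0"
  have eq: "res w z = lin_ext (\<lambda>C. lin_ext (bd R) (?r C) - lin_ext ?r (bd R C)) z"
    by (simp only: res_def restr_def boundary_eq_lin_ext lin_ext_lin_ext lin_ext_fun_diff)
  obtain C where C: "C \<in> supp z" "D \<in> supp (lin_ext (bd R) (?r C) - lin_ext ?r (bd R C))"
    using subsetD[OF supp_lin_ext assms(4)[unfolded eq]] by (rule UN_E)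
  let ?s = "\<lambda>x. (- 1 :: complex) ^ card (C \<inter> underS R x)"
  have "lin_ext (bd R) (?r C) = (\<Sum>x\<in>C. if prefix w (lbl C) then Poly_Mapping.single (C - {x}) (?s x) else 0)"
    by (simp add: bd_def)
  moreover have "lin_ext ?r (bd R C) =
      (\<Sum>x\<in>C. if prefix w (lbl (C - {x})) then Poly_Mapping.single (C - {x}) (?s x) else 0)"
    unfolding bd_def lin_ext_sum by (rule sum.cong) auto
  ultimately have "lin_ext (bd R) (?r C) - lin_ext ?r (bd R C) =
     (\<Sum>x\<in>C. (if prefix w (lbl C) then Poly_Mapping.single (C - {x}) (?s x) else 0) -
        (if prefix w (lbl (C - {x})) then Poly_Mapping.single (C - {x}) (?s x) else 0))"
    by (simp add: sum_subtractf)
  with C(2) obtain x where x: "x \<in> C" "D \<in> supp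
      ((if prefix w (lbl C) then Poly_Mapping.single (C - {x}) (?s x) else 0) -
        (if prefix w (lbl (C - {x})) then Poly_Mapping.single (C - {x}) (?s x) else 0))"
    by (auto dest!: subsetD[OF Poly_Mapping.keys_sum])
  have CR: "C \<in> fin_chains R" using C(1) assms(1) by auto
  have "prefix w (lbl (C - {x})) \<Longrightarrow> prefix w (lbl C)"
    using lbl_mono[OF CR, of "C - {x}"] prefix_order.trans by blast
  with x(2) have "D = C - {x}" "prefix w (lbl C)" "\<not> prefix w (lbl (C - {x}))"
    by (auto split: if_splits)
  with C(1) x(1) link_if_lost[OF CR assms(3) _ _ _ assms(2), of x] show ?thesis by auto
qed

text \<open>Both sides reduce to the boundary of the restricted boundary, as double boundaries
  vanish; the sign comes from the second term of \<open>res\<close>.\<close>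

lemma boundary_res:
  assumes "supp z \<subseteq> fin_chains R"
  shows "boundary R (res w z) = - res w (boundary R z)"
proof -
  have "supp (restr w z) \<subseteq> fin_chains R" using assms supp_restr[of w z] by blast
  then show ?thesis
    using boundary_boundary[OF antisym_R trans_R] assms
    by (simp add: res_def boundary_diff) (simp add: restr_def)
qed

section \<open>Gluing two cones along a link\<close>

definition link_chains :: "'l list \<Rightarrow> ('y set \<Rightarrow>\<^sub>0 complex) set" where
  "link_chains w = {c. supp c \<subseteq> fin_chains R \<inter> Pow (link w)}"

text \<open>For a cycle the two cones have the same boundary, so their difference is a cycle. An
  empty link is no exception: its empty chain yields the difference of the two apices.\<close>

definition attach :: "'l list \<Rightarrow> ('y set \<Rightarrow>\<^sub>0 complex) \<Rightarrow> ('y set \<Rightarrow>\<^sub>0 complex)" where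
  "attach w c = cone (vx w) c - cone (vx (butlast w)) c"

lemma butlast_in: "w \<in> T \<Longrightarrow> butlast w \<in> T"
  by (rule prefix_closed) (auto simp: prefixeq_butlast)

lemma strict_prefix_butlast: "strict_prefix u w \<Longrightarrow> prefix u (butlast w)"
  by (cases w rule: rev_cases) (auto simp: strict_prefix_def)

text \<open>The inequalities allow the link to be coned from both apices. Since no element of the
  link is an apex, neither cone operator drops a chain of the link.\<close>

lemma link_le:
  assumes "y \<in> link w" "w \<in> T"
  shows "(y, vx w) \<in> R" "(y, vx (butlast w)) \<in> R" "y \<noteq> vx w" "y \<noteq> vx (butlast w)"
    "prefix (lab y) w" "prefix (lab y) (butlast w)"
proof -
  have y: "(y, vx w) \<in> R" "strict_prefix (lab y) w" using assms(1) by (auto simp: link_def)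
  then show "(y, vx w) \<in> R" "prefix (lab y) w" "prefix (lab y) (butlast w)"
    by (auto simp: strict_prefix_butlast prefix_order.less_imp_le)
  then show "(y, vx (butlast w)) \<in> R"
    using le_vx_prefix[of y w "butlast w"] assms(2) prefixeq_butlast by blast
  show "y \<noteq> vx w" using y(2) lab_vx[OF assms(2)] by auto
  have "butlast w \<noteq> w" using y(2) by (cases w rule: rev_cases) auto
  then show "y \<noteq> vx (butlast w)"
    using y(1) vx_antichain[OF butlast_in[OF assms(2)] assms(2)] by auto
qed

lemma cone_link:
  assumes "c \<in> link_chains w" "w \<in> T" "v = vx w \<or> v = vx (butlast w)"
  shows "boundary R (cone v c) + cone v (boundary R c) = c"
  by (rule cone_homotopy) (use antisym_R assms link_le[OF _ assms(2)] in
      \<open>auto simp: link_chains_def fin_chains_def dest!: subsetD\<close>)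

text \<open>The two copies of \<open>c\<close> in the homotopy formulas cancel. The identity covers
  all chains of the link, not only cycles, so that boundaries are sent to boundaries.\<close>

lemma boundary_attach:
  assumes "c \<in> link_chains w" "w \<in> T"
  shows "boundary R (attach w c) = - attach w (boundary R c)"
  using cone_link[OF assms, of "vx w"] cone_link[OF assms, of "vx (butlast w)"]
  by (simp add: attach_def boundary_diff algebra_simps)

lemma attach_in_chain_module:
  assumes "c \<in> link_chains w" "w \<in> T" "c \<in> carrier (chain_module R k)"
  shows "attach w c \<in> carrier (chain_module R (k + 1))"
proof -
  have "cone v c \<in> carrier (chain_module R (k + 1))" if v: "v = vx w \<or> v = vx (butlast w)" for v
    unfolding carrier_chain_module
  proof safe
    fix D assume "D \<in> supp (cone v c)"
    from supp_cone_avoiding[OF this] obtain C where C: "C \<in> supp c" "v \<notin> C" "D = insert v C"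
      by (elim bexE conjE)
    then have C': "C \<in> fin_chains R" "C \<subseteq> link w" "C \<in> simplices R k"
      using assms(1,3) by (auto simp: link_chains_def carrier_chain_module)
    have "(x, v) \<in> R" if "x \<in> C" for x
      using v link_le(1,2)[OF subsetD[OF C'(2) that] assms(2)] by auto
    moreover have "(v, v) \<in> R"
      using v vx_refl[OF assms(2)] vx_refl[OF butlast_in[OF assms(2)]] by auto
    ultimately have "insert v C \<in> fin_chains R"
      by (rule fin_chains_insert[OF C'(1)])
    with C C'(3) show "D \<in> simplices R (k + 1)"
      by (auto simp: simplices_def fin_chains_def)
  qed
  then show ?thesis
    unfolding attach_def by (intro lin_subspaceD[OF lin_subspace_chain_module]) auto
qed

text \<open>All chains of this cone contain the apex and have its label, so the projection keeps
  either the whole cone or nothing.\<close>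

lemma restr_cone:
  assumes "c \<in> link_chains v" "v \<in> T" "u = v \<or> u = butlast v"
  shows "restr w (cone (vx u) c) = (if prefix w u then cone (vx u) c else 0)"
proof -
  have "u \<in> T" using assms(2,3) butlast_in by auto
  have *: "lbl (insert (vx u) C) = u" if "C \<in> supp c" for C
  proof (rule lbl_eqI)
    have "C \<subseteq> link v" using that assms(1) by (auto simp: link_chains_def)
    then show "prefix (lab y) u" if "y \<in> insert (vx u) C" for y
      using that link_le[OF _ assms(2)] lab_vx[OF \<open>u \<in> T\<close>] assms(3) by auto
  qed (use lab_vx[OF \<open>u \<in> T\<close>] in auto)
  have "restr w (cone (vx u) c) = lin_ext (\<lambda>C. if prefix w u then
      (if vx u \<in> C then 0 else Poly_Mapping.single (insert (vx u) C) ((- 1) ^ card C)) else 0) c"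
    unfolding restr_def cone_def lin_ext_lin_ext by (rule lin_ext_cong) (auto simp: *)
  then show ?thesis by (simp add: cone_def lin_ext_def[of "\<lambda>_. 0"])
qed

text \<open>Both cones over the cycle \<open>c\<close> have boundary \<open>c\<close>. A word is a
  prefix of both \<open>v\<close> and \<open>butlast v\<close> or of neither, except for
  \<open>v\<close> itself; hence the contributions cancel unless \<open>w = v\<close>.\<close>

lemma res_attach:
  assumes "c \<in> link_chains v" "v \<in> T" "v \<noteq> []" "w \<noteq> []" "boundary R c = 0"
  shows "res w (attach v c) = (if w = v then c else 0)"
proof -
  have 0: "boundary R (attach v c) = 0"
    using boundary_attach[OF assms(1,2)] assms(5) by (simp add: attach_def cone_def)
  have *: "boundary R (cone (vx u) c) = c" if "u = v \<or> u = butlast v" for u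
    using cone_link[OF assms(1,2), of "vx u"] that assms(5) by (auto simp: cone_def)
  have "res w (attach v c) = boundary R (restr w (cone (vx v) c)) - boundary R (restr w (cone (vx (butlast v)) c))"
    by (simp add: res_def 0) (simp add: restr_def attach_def lin_ext_diff boundary_diff)
  also have "\<dots> = (if prefix w v then c else 0) - (if prefix w (butlast v) then c else 0)"
    using * by (simp add: restr_cone[OF assms(1,2)])
  also have "\<dots> = (if w = v then c else 0)"
  proof -
    obtain u x where "v = u @ [x]" using assms(3) by (cases v rule: rev_cases) auto
    then show ?thesis using prefix_length_le[of "u @ [x]" u] by auto
  qed
  finally show ?thesis .
qed

text \<open>If all connecting homomorphisms vanish on \<open>z\<close>, every projection
  \<open>restr w z\<close> is a cycle. Then so is the part of \<open>z\<close> made of the chains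
  with label exactly \<open>w\<close>, and this part bounds its cone with apex \<open>vx w\<close>.
  Adding up these cones fills \<open>z\<close>.\<close>

lemma boundary_if_res_zero:
  assumes "z \<in> cycles R k" "\<And>w. w \<in> T \<Longrightarrow> w \<noteq> [] \<Longrightarrow> res w z = 0"
  shows "z \<in> boundaries R k"
proof -
  have z: "supp z \<subseteq> simplices R k" "boundary R z = 0"
    using assms(1) by (auto simp: cycles_def carrier_chain_module)
  have zR: "supp z \<subseteq> fin_chains R" using z(1) simplices_subset_fin_chains by blast
  define piece where "piece w = lin_ext (\<lambda>C. if lbl C = w then Poly_Mapping.single C (1 :: complex) else 0)" for w
  have "boundary R (restr w z) = 0" if "w \<in> T" for w
  proof (cases "w = []")
    \<comment> \<open>Every label extends the empty word, so \<open>restr []\<close> is the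
      identity.\<close>
    case True
    then show ?thesis using z(2) by (simp add: restr_def)
  next
    case False
    with assms(2)[OF that] show ?thesis by (simp add: res_def z(2)) (simp add: restr_def)
  qed
  note restr0 = this
  \<comment> \<open>The last letters of the children of \<open>w\<close>. A label that properly
    extends \<open>w\<close> extends exactly one child, so subtracting the projections of the
    children from that of \<open>w\<close> leaves the chains with label \<open>w\<close>.\<close>
  let ?X = "\<lambda>w. {x. w @ [x] \<in> T}"
  \<comment> \<open>The alphabet may be infinite, and a sum over an infinite index set would be
    0.\<close>
  have finX: "finite (?X w)" for w
  proof -
    have "(\<lambda>x. w @ [x]) ` ?X w \<subseteq> T" by auto
    then show ?thesis using finite_T by (rule finite_imageD[OF finite_subset]) (auto simp: inj_on_def)
  qed
  have piece: "piece w z = restr w z - (\<Sum>x \<in> ?X w. restr (w @ [x]) z)" for w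
  proof -
    have pointwise: "(if lbl C = w then Poly_Mapping.single C (1 :: complex) else 0) =
       (if prefix w (lbl C) then Poly_Mapping.single C 1 else 0) -
       (\<Sum>x \<in> ?X w. if prefix (w @ [x]) (lbl C) then Poly_Mapping.single C 1 else 0)"
      if C: "C \<in> fin_chains R" for C
    proof (cases "prefix w (lbl C) \<and> lbl C \<noteq> w")
      case False
      then have "\<not> prefix (w @ [x]) (lbl C)" for x
        by (auto simp: prefix_def)
      with False show ?thesis by auto
    next
      case True
      then obtain a us where us: "lbl C = w @ a # us"
        by (metis append_Nil2 neq_Nil_conv prefix_def)
      then have "a \<in> ?X w"
        using lbl_in[OF C] prefix_closed[of "lbl C" "w @ [a]"] by (auto simp: prefix_def)
      moreover have "prefix (w @ [x]) (lbl C) \<longleftrightarrow> x = a" for x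
        using us by (auto simp: prefix_def)
      ultimately show ?thesis using us finX[of w] by (simp add: prefix_def)
    qed
    have "piece w z = lin_ext (\<lambda>C. (if prefix w (lbl C) then Poly_Mapping.single C 1 else 0) -
       (\<Sum>x \<in> ?X w. if prefix (w @ [x]) (lbl C) then Poly_Mapping.single C 1 else 0)) z"
      unfolding piece_def by (intro lin_ext_cong pointwise) (use zR in auto)
    then show ?thesis
      unfolding restr_def lin_ext_fun_diff lin_ext_fun_sum .
  qed
  have piece0: "boundary R (piece w z) = 0" if "w \<in> T" for w
    unfolding piece using restr0 that by (simp add: boundary_diff boundary_sum)
  have supp_piece: "C \<in> supp z \<and> lbl C = w" if "C \<in> supp (piece w z)" for C w
    using that unfolding piece_def by (auto dest!: subsetD[OF supp_lin_ext] split: if_splits)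
  have cone_piece: "boundary R (cone (vx w) (piece w z)) = piece w z" if "w \<in> T" for w
  proof -
    have "boundary R (cone (vx w) (piece w z)) + cone (vx w) (boundary R (piece w z)) = piece w z"
      by (rule cone_homotopy)
        (use antisym_R zR supp_piece le_vx_lbl in \<open>auto simp: fin_chains_def dest!: subsetD\<close>)
    then show ?thesis by (simp add: piece0[OF that] cone_def)
  qed
  have sum_piece: "(\<Sum>w \<in> T. piece w z) = z"
  proof -
    have "(\<Sum>w \<in> T. piece w z) = lin_ext (\<lambda>C. \<Sum>w \<in> T. if lbl C = w then Poly_Mapping.single C 1 else 0) z"
      by (simp add: piece_def lin_ext_fun_sum)
    also have "\<dots> = z"
      by (rule lin_ext_eqI) (use zR lbl_in finite_T in auto)
    finally show ?thesis .
  qed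
  let ?y = "\<Sum>w \<in> T. cone (vx w) (piece w z)"
  have "cone (vx w) (piece w z) \<in> carrier (chain_module R (k + 1))" if "w \<in> T" for w
    unfolding carrier_chain_module
  proof safe
    fix D assume "D \<in> supp (cone (vx w) (piece w z))"
    from supp_cone_avoiding[OF this]
    obtain C where C: "C \<in> supp (piece w z)" "vx w \<notin> C" "D = insert (vx w) C"
      by (elim bexE conjE)
    from C(1) supp_piece have C': "C \<in> supp z" "lbl C = w" by auto
    with zR z(1) have "C \<in> fin_chains R" "C \<in> simplices R k" by auto
    moreover have "insert (vx w) C \<in> fin_chains R"
      by (rule fin_chains_insert)
        (use C' calculation le_vx_lbl[of C] vx_refl[OF that] in auto)
    ultimately show "D \<in> simplices R (k + 1)"
      using C(2,3) by (auto simp: simplices_def fin_chains_def)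
  qed
  then have "?y \<in> carrier (chain_module R (k + 1))"
    by (rule lin_subspace_sum[OF lin_subspace_chain_module])
  note y = imageI[OF this, of "boundary R"]
  have "boundary R ?y = z"
    by (simp add: boundary_sum cone_piece sum_piece)
  with y show ?thesis by (simp only: boundaries_def)
qed

end


text \<open>Under these assumptions the case distinction in \<open>cone\<close> never yields 0, and
  the composite becomes one linear extension whose signs depend on cardinalities only. This form is
  used to check equivariance.\<close>

lemma cone_dual_map:
  assumes "\<And>C. C \<in> supp c \<Longrightarrow> v \<notin> h ` C" "\<And>C. C \<in> supp c \<Longrightarrow> inj_on h C"
  shows "cone v (dual_map h c) = lin_ext (\<lambda>C. Poly_Mapping.single (insert v (h ` C))
    ((- 1) ^ (card C choose 2) * (- 1) ^ card C)) c"
  unfolding cone_def dual_map_def lin_ext_lin_ext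
  by (rule lin_ext_cong) (use assms in \<open>auto simp: card_image\<close>)

section \<open>The homology of a tree of cones\<close>

context cone_tree
begin

text \<open>The map is \<open>attach\<close> after the anti-isomorphism onto the link. Applying
  \<open>res\<close> for one word to a sum of glued cycles recovers the summand of that word, which
  gives injectivity; \<open>boundary_if_res_zero\<close> gives surjectivity. The degree
  \<open>k - 1\<close> accounts for the apex that coning adds.\<close>

lemma homology_rep_iso:
  fixes Q :: "'i \<Rightarrow> 'x rel" and wd :: "'i \<Rightarrow> 'l list" and h :: "'i \<Rightarrow> 'x \<Rightarrow> 'y"
  assumes wd: "bij_betw wd J (T - {[]})"
    and antisym_Q: "\<And>i. i \<in> J \<Longrightarrow> antisym (Q i)"
    and h: "\<And>i. i \<in> J \<Longrightarrow> bij_betw (h i) (Field (Q i)) (link (wd i))"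
    and h_iff: "\<And>i x y. i \<in> J \<Longrightarrow> x \<in> Field (Q i) \<Longrightarrow> y \<in> Field (Q i) \<Longrightarrow>
        (h i y, h i x) \<in> R \<longleftrightarrow> (x, y) \<in> Q i"
    and autQ: "\<And>i g. i \<in> J \<Longrightarrow> g \<in> carrier G \<Longrightarrow> order_aut (Q i) (\<phi> g)"
    and autR: "\<And>g. g \<in> carrier G \<Longrightarrow> order_aut R (\<phi>' g)"
    and h_act: "\<And>i g x. i \<in> J \<Longrightarrow> g \<in> carrier G \<Longrightarrow> x \<in> Field (Q i) \<Longrightarrow> h i (\<phi> g x) = \<phi>' g (h i x)"
    and vx_act: "\<And>g w. g \<in> carrier G \<Longrightarrow> w \<in> T \<Longrightarrow> \<phi>' g (vx w) = vx w"
  shows "rep_iso G (rep_sum J (\<lambda>i. homology_rep \<phi> (Q i) (k - 1))) (homology_rep \<phi>' R k)"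
proof -
  let ?h' = "\<lambda>i. the_inv_into (Field (Q i)) (h i)"
  define \<delta> where "\<delta> i = dual_map (h i)" for i
  define \<delta>' where "\<delta>' i = dual_map (?h' i)" for i
  have wdT: "wd i \<in> T" "wd i \<noteq> []" if "i \<in> J" for i
    using bij_betwE[OF wd] that by auto
  have inj_wd: "inj_on wd J" using wd by (simp add: bij_betw_def)
  have finJ: "finite J" using wd finite_T by (simp add: bij_betw_finite)
  have inj_h: "inj_on (h i) (Field (Q i))" if "i \<in> J" for i
    using h[OF that] by (simp add: bij_betw_def)
  have h_in: "h i x \<in> link (wd i)" if "i \<in> J" "x \<in> Field (Q i)" for i x
    using bij_betwE[OF h[OF that(1)]] that(2) by blast
  have h'_in: "?h' i y \<in> Field (Q i)" "h i (?h' i y) = y" if "i \<in> J" "y \<in> link (wd i)" for i y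
    using h[OF that(1)] that(2) by (auto simp: bij_betw_def the_inv_into_into f_the_inv_into_f)
  have inj_h': "inj_on (?h' i) (link (wd i))" if "i \<in> J" for i
    by (rule inj_onI) (metis h'_in(2) that)
  have h'_h: "?h' i (h i x) = x" if "i \<in> J" "x \<in> Field (Q i)" for i x
    by (rule the_inv_into_f_f[OF inj_h[OF that(1)] that(2)])
  have h'_rev: "(?h' i y, ?h' i x) \<in> Q i" if "i \<in> J" "x \<in> link (wd i)" "y \<in> link (wd i)" "(x, y) \<in> R" for i x y
    using h_iff[of i "?h' i y" "?h' i x"] h'_in that by simp
  have SQ: "C \<in> fin_chains (Q i)" "C \<subseteq> Field (Q i)" if "C \<in> simplices (Q i) l" for C i l
    using that simplices_subset_fin_chains fin_chains_Field by blast+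
  have \<delta>_link: "\<delta> i c \<in> link_chains (wd i)" "\<delta> i c \<in> carrier (chain_module R l)"
    if i: "i \<in> J" and c: "c \<in> carrier (chain_module (Q i) l)" for i c l
  proof -
    have "D \<in> simplices R l \<and> D \<subseteq> link (wd i)" if "D \<in> supp (\<delta> i c)" for D
    proof -
      from subsetD[OF supp_dual_map that[unfolded \<delta>_def]]
      obtain C where C: "C \<in> supp c" "D = h i ` C" by blast
      then have CS: "C \<in> simplices (Q i) l" using c by (auto simp: carrier_chain_module)
      have "h i ` C \<in> simplices R l"
        by (rule image_simplices[OF CS SQ(2)[OF CS] inj_h[OF i]]) (use h_iff[OF i] in blast)
      then show ?thesis using C SQ(2)[OF CS] h_in[OF i] by auto
    qed
    then show "\<delta> i c \<in> link_chains (wd i)" "\<delta> i c \<in> carrier (chain_module R l)"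
      using simplices_subset_fin_chains[of R l] unfolding link_chains_def carrier_chain_module by blast+
  qed
  have \<delta>_boundary: "boundary R (\<delta> i c) = \<delta> i (boundary (Q i) c)"
    if i: "i \<in> J" and c: "c \<in> carrier (chain_module (Q i) l)" for i c l
    unfolding \<delta>_def
  proof (rule boundary_dual_map[where A = "Field (Q i)"])
    have "supp c \<subseteq> simplices (Q i) l" using c by (simp add: carrier_chain_module)
    with SQ[of _ i l] show "supp c \<subseteq> fin_chains (Q i)" "C \<in> supp c \<Longrightarrow> C \<subseteq> Field (Q i)" for C
      by blast+
  qed (use inj_h[OF i] antisym_R h_iff[OF i] in auto)
  have \<delta>'_mem: "\<delta>' i d \<in> carrier (chain_module (Q i) l)"
    if i: "i \<in> J" and d: "d \<in> link_chains (wd i)" "d \<in> carrier (chain_module R l)" for i d l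
    unfolding carrier_chain_module
  proof safe
    fix D assume "D \<in> supp (\<delta>' i d)"
    then obtain C where C: "C \<in> supp d" "D = ?h' i ` C"
      unfolding \<delta>'_def by (blast dest: subsetD[OF supp_dual_map])
    then have CS: "C \<in> simplices R l" "C \<subseteq> link (wd i)"
      using d by (auto simp: carrier_chain_module link_chains_def)
    show "D \<in> simplices (Q i) l" unfolding C(2)
      by (rule image_simplices[OF CS inj_h'[OF i]]) (use h'_rev[OF i] in blast)
  qed
  have \<delta>'_boundary: "boundary (Q i) (\<delta>' i d) = \<delta>' i (boundary R d)"
    if i: "i \<in> J" and d: "d \<in> link_chains (wd i)" for i d
    unfolding \<delta>'_def
    by (rule boundary_dual_map[where A = "link (wd i)"])
      (use d inj_h'[OF i] antisym_Q[OF i] h'_rev[OF i] in \<open>auto simp: link_chains_def\<close>)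
  have \<delta>'_\<delta>: "\<delta>' i (\<delta> i c) = c" if i: "i \<in> J" and c: "c \<in> carrier (chain_module (Q i) l)" for i c l
    unfolding \<delta>_def \<delta>'_def
  proof (rule dual_map_inverse)
    fix C assume "C \<in> supp c"
    then have "C \<subseteq> Field (Q i)" using SQ(2)[of C i l] c by (auto simp: carrier_chain_module)
    then show "inj_on (h i) C" "x \<in> C \<Longrightarrow> ?h' i (h i x) = x" for x
      using inj_on_subset[OF inj_h[OF i]] h'_h[OF i] by auto
  qed
  have \<delta>_\<delta>': "\<delta> i (\<delta>' i d) = d" if i: "i \<in> J" and d: "d \<in> link_chains (wd i)" for i d
    unfolding \<delta>_def \<delta>'_def
  proof (rule dual_map_inverse)
    fix C assume "C \<in> supp d"
    then have "C \<subseteq> link (wd i)" using d by (auto simp: link_chains_def)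
    then show "inj_on (?h' i) C" "x \<in> C \<Longrightarrow> h i (?h' i x) = x" for x
      using inj_on_subset[OF inj_h'[OF i]] h'_in(2)[OF i] by auto
  qed
  have res_mem: "res (wd i) z \<in> link_chains (wd i)" "res (wd i) z \<in> carrier (chain_module R (l - 1))"
    if i: "i \<in> J" and z: "z \<in> carrier (chain_module R l)" for i z l
  proof -
    have zR: "supp z \<subseteq> fin_chains R" "supp z \<subseteq> simplices R l"
      using z simplices_subset_fin_chains[of R l] by (auto simp: carrier_chain_module)
    have "D \<in> fin_chains R \<and> D \<in> simplices R (l - 1) \<and> D \<subseteq> link (wd i)" if "D \<in> supp (res (wd i) z)" for D
    proof -
      from supp_res[OF zR(1) wdT[OF i] that]
      obtain C x where C: "D \<subseteq> link (wd i)" "C \<in> supp z" "x \<in> C" "D = C - {x}" by blast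
      then have "C \<in> simplices R l" "C \<in> fin_chains R" using zR by auto
      moreover have "D \<in> fin_chains R"
        using fin_chains_subset[OF calculation(2), of D] C(4) by auto
      moreover have "card C = Suc (card D)"
        using card_Suc_Diff1[of C x] C(3,4) calculation(2) by (simp only: fin_chains_def) simp
      ultimately show ?thesis
        using C(1) by (auto simp: simplices_def fin_chains_def)
    qed
    then show "res (wd i) z \<in> link_chains (wd i)" "res (wd i) z \<in> carrier (chain_module R (l - 1))"
      by (auto simp: link_chains_def carrier_chain_module)
  qed
  define \<Psi> where "\<Psi> i c = attach (wd i) (\<delta> i c)" for i c
  have \<Psi>_add: "\<Psi> i (c + d) = \<Psi> i c + \<Psi> i d" for i c d
    by (simp add: \<Psi>_def \<delta>_def attach_def cone_def dual_map_def lin_ext_add)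
  have \<Psi>_scale: "\<Psi> i (scale a c) = scale a (\<Psi> i c)" for i a c
  proof -
    have "scale a (x - y) = scale a x - scale a y" for x y :: "'y set \<Rightarrow>\<^sub>0 complex"
      by (rule poly_mapping_eqI) (simp add: lookup_minus right_diff_distrib)
    then show ?thesis
      by (simp add: \<Psi>_def \<delta>_def attach_def cone_def dual_map_def lin_ext_scale)
  qed
  have \<Psi>_zero: "\<Psi> i 0 = 0" for i
    by (simp add: \<Psi>_def \<delta>_def attach_def cone_def dual_map_def)
  have \<Psi>_mem: "\<Psi> i c \<in> carrier (chain_module R (l + 1))"
    if "i \<in> J" "c \<in> carrier (chain_module (Q i) l)" for i c l
    unfolding \<Psi>_def by (rule attach_in_chain_module[OF \<delta>_link(1)[OF that] wdT(1)[OF that(1)] \<delta>_link(2)[OF that]])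
  have \<Psi>_boundary: "boundary R (\<Psi> i c) = - \<Psi> i (boundary (Q i) c)"
    if "i \<in> J" "c \<in> carrier (chain_module (Q i) l)" for i c l
    unfolding \<Psi>_def boundary_attach[OF \<delta>_link(1)[OF that] wdT(1)[OF that(1)]] \<delta>_boundary[OF that] ..
  have \<delta>_zero: "\<delta> i 0 = 0" for i by (simp add: \<delta>_def dual_map_def)
  \<comment> \<open>The connecting homomorphisms are dual to the glued cycles; injectivity of
    \<open>wd\<close> turns equality of words into equality of indices.\<close>
  have res_\<Psi>: "res (wd i) (\<Psi> j c) = (if i = j then \<delta> i c else 0)"
    if "i \<in> J" "j \<in> J" "c \<in> cycles (Q j) l" for i j c l
  proof -
    have c: "c \<in> carrier (chain_module (Q j) l)" "boundary (Q j) c = 0"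
      using that(3) by (auto simp: cycles_def)
    have "res (wd i) (\<Psi> j c) = (if wd i = wd j then \<delta> j c else 0)"
      unfolding \<Psi>_def
      by (rule res_attach[OF \<delta>_link(1)[OF that(2) c(1)]])
        (use that wdT c in \<open>auto simp: \<delta>_boundary[OF that(2) c(1)] \<delta>_zero\<close>)
    then show ?thesis using that inj_wd by (auto dest: inj_onD)
  qed
  have res_sum_\<Psi>: "res (wd i) (\<Sum>j\<in>J. \<Psi> j (c j)) = \<delta> i (c i)"
    if "i \<in> J" "\<And>j. j \<in> J \<Longrightarrow> c j \<in> cycles (Q j) l" for i c l
  proof -
    have "res (wd i) (\<Sum>j\<in>J. \<Psi> j (c j)) = (\<Sum>j\<in>J. if i = j then \<delta> i (c j) else 0)"
      unfolding res_sum by (rule sum.cong[OF refl]) (rule res_\<Psi>[OF that(1) _ that(2)])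
    then show ?thesis using finJ that(1) by simp
  qed
  have \<Psi>_cycles: "\<Psi> i c \<in> cycles R k" if "i \<in> J" "c \<in> cycles (Q i) (k - 1)" for i c
    using \<Psi>_mem[of i c "k - 1"] \<Psi>_boundary[of i c "k - 1"] that by (auto simp: cycles_def \<Psi>_zero)
  show ?thesis
  proof (rule homology_rep_direct_sum[where \<Psi> = \<Psi>, OF autQ autR \<Psi>_add \<Psi>_scale \<Psi>_cycles])
    fix i c assume i: "i \<in> J" and "c \<in> boundaries (Q i) (k - 1)"
    then obtain d where d: "d \<in> carrier (chain_module (Q i) k)" "c = boundary (Q i) d"
      by (auto simp: boundaries_def)
    \<comment> \<open>Gluing anticommutes with the boundary, hence the sign of the filling.\<close>
    have "boundary R (- \<Psi> i d) = \<Psi> i c"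
      unfolding boundary_uminus \<Psi>_boundary[OF i d(1)] d(2) by simp
    moreover have "- \<Psi> i d \<in> carrier (chain_module R (k + 1))"
      by (rule lin_subspaceD(4)[OF lin_subspace_chain_module \<Psi>_mem[OF i d(1)]])
    ultimately show "\<Psi> i c \<in> boundaries R k"
      unfolding boundaries_def by (intro image_eqI[of _ _ "- \<Psi> i d"]) simp_all
  next
    fix c i assume c: "\<And>i. i \<in> J \<Longrightarrow> c i \<in> cycles (Q i) (k - 1)"
      and "(\<Sum>i\<in>J. \<Psi> i (c i)) \<in> boundaries R k" and i: "i \<in> J"
    then obtain y where y: "y \<in> carrier (chain_module R (k + 1))" "(\<Sum>i\<in>J. \<Psi> i (c i)) = boundary R y"
      by (auto simp: boundaries_def)
    have yR: "supp y \<subseteq> fin_chains R"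
      using y(1) simplices_subset_fin_chains[of R "k + 1"] by (auto simp: carrier_chain_module)
    have m: "res (wd i) y \<in> link_chains (wd i)" "res (wd i) y \<in> carrier (chain_module R k)"
      using res_mem[OF i y(1)] by simp_all
    have ci: "c i \<in> carrier (chain_module (Q i) (k - 1))" using c[OF i] by (simp add: cycles_def)
    \<comment> \<open>Applied to the bounding chain \<open>y\<close>, the connecting homomorphism
      yields, up to sign, a filling inside the link, which \<open>\<delta>'\<close> carries back to
      \<open>Q i\<close>.\<close>
    have "\<delta> i (c i) = - boundary R (res (wd i) y)"
      using res_sum_\<Psi>[OF i c] boundary_res[OF yR, of "wd i"] y(2) by simp
    then have "c i = \<delta>' i (- boundary R (res (wd i) y))"
      using \<delta>'_\<delta>[OF i ci] by simp
    also have "\<dots> = boundary (Q i) (- \<delta>' i (res (wd i) y))"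
      unfolding boundary_uminus \<delta>'_boundary[OF i m(1)] by (simp add: \<delta>'_def dual_map_def lin_ext_uminus)
    finally show "c i \<in> boundaries (Q i) (k - 1)"
      unfolding boundaries_def
      using lin_subspaceD(4)[OF lin_subspace_chain_module \<delta>'_mem[OF i m]] by simp
  next
    fix z assume z: "z \<in> cycles R k"
    then have z': "z \<in> carrier (chain_module R k)" "boundary R z = 0" by (auto simp: cycles_def)
    have zR: "supp z \<subseteq> fin_chains R"
      using z'(1) simplices_subset_fin_chains[of R k] by (auto simp: carrier_chain_module)
    \<comment> \<open>The only possible coordinates of \<open>z\<close>, in view of
      \<open>res_sum_\<Psi>\<close>. After subtraction of the glued cycles every connecting
      homomorphism vanishes, so the difference bounds.\<close>
    let ?c = "\<lambda>i. \<delta>' i (res (wd i) z)"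
    have c: "?c i \<in> cycles (Q i) (k - 1)" if i: "i \<in> J" for i
      using \<delta>'_mem[OF i res_mem[OF i z'(1)]] \<delta>'_boundary[OF i res_mem(1)[OF i z'(1)]]
        boundary_res[OF zR, of "wd i"] z'(2)
      by (simp add: cycles_def res_def restr_def \<delta>'_def dual_map_def)
    have "z - (\<Sum>i\<in>J. \<Psi> i (?c i)) \<in> boundaries R k"
    proof (rule boundary_if_res_zero)
      show "z - (\<Sum>i\<in>J. \<Psi> i (?c i)) \<in> cycles R k"
        by (intro lin_subspaceD(5)[OF lin_subspace_cycles] z lin_subspace_sum[OF lin_subspace_cycles] \<Psi>_cycles c)
      fix w assume "w \<in> T" "w \<noteq> []"
      then obtain i where i: "i \<in> J" "w = wd i" using wd by (auto simp: bij_betw_def)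
      have "res (wd i) (\<Sum>j\<in>J. \<Psi> j (?c j)) = \<delta> i (?c i)"
        by (rule res_sum_\<Psi>[OF i(1) c])
      then show "res w (z - (\<Sum>i\<in>J. \<Psi> i (?c i))) = 0"
        using \<delta>_\<delta>'[OF i(1) res_mem(1)[OF i(1) z'(1)]] by (simp add: i(2) res_diff)
    qed
    then show "\<exists>c. (\<forall>i\<in>J. c i \<in> cycles (Q i) (k - 1)) \<and> z - (\<Sum>i\<in>J. \<Psi> i (c i)) \<in> boundaries R k"
      using c by (intro exI[of _ ?c]) auto
  next
    fix i g c assume i: "i \<in> J" and g: "g \<in> carrier G" and "c \<in> cycles (Q i) (k - 1)"
    then have c: "c \<in> carrier (chain_module (Q i) (k - 1))" by (simp add: cycles_def)
    have c': "chain_map (\<phi> g) c \<in> carrier (chain_module (Q i) (k - 1))"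
      by (rule order_aut_chain_map(1)[OF autQ[OF i g] c])
    have \<phi>_in: "\<phi> g x \<in> Field (Q i)" if "x \<in> Field (Q i)" for x
      using autQ[OF i g] that unfolding order_aut_def by (blast dest: bij_betwE)
    have \<phi>_inj: "inj_on (\<phi> g) (Field (Q i))"
      using autQ[OF i g] by (simp add: order_aut_def bij_betw_def)
    \<comment> \<open>The group fixes both apices and preserves cardinalities, hence signs; so each
      of the two cones is equivariant by itself.\<close>
    have "cone v (\<delta> i (chain_map (\<phi> g) c)) = chain_map (\<phi>' g) (cone v (\<delta> i c))"
      if v: "v = vx (wd i) \<or> v = vx (butlast (wd i))" for v
    proof -
      have F: "C \<subseteq> Field (Q i)" "\<phi> g ` C \<subseteq> Field (Q i)" if "C \<in> supp c" for C
        using SQ(2)[of C i "k - 1"] \<phi>_in that c unfolding carrier_chain_module by blast+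
      have a: "v \<notin> h i ` C" "inj_on (h i) C" if "C \<subseteq> Field (Q i)" for C
        using that inj_on_subset[OF inj_h[OF i] that] h_in[OF i] link_le(3,4)[OF _ wdT(1)[OF i]] v by auto
      have F': "C \<subseteq> Field (Q i)" if "C \<in> supp (chain_map (\<phi> g) c)" for C
        using that c' SQ(2)[of C i "k - 1"] by (auto simp: carrier_chain_module)
      have "\<phi>' g v = v" using vx_act[OF g] v wdT(1)[OF i] butlast_in by auto
      then have img: "insert v (h i ` \<phi> g ` C) = \<phi>' g ` insert v (h i ` C)" if "C \<in> supp c" for C
        using F(1)[OF that] h_act[OF i g] by (auto simp: image_image subset_iff)
      have cards: "card (\<phi> g ` C) = card C" if "C \<in> supp c" for C
        by (rule card_image[OF inj_on_subset[OF \<phi>_inj F(1)[OF that]]])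
      have "cone v (\<delta> i (chain_map (\<phi> g) c)) = lin_ext (\<lambda>C. Poly_Mapping.single (insert v (h i ` C))
          ((- 1) ^ (card C choose 2) * (- 1) ^ card C)) (chain_map (\<phi> g) c)"
        unfolding \<delta>_def by (rule cone_dual_map) (use F' a in auto)
      also have "\<dots> = lin_ext (\<lambda>C. Poly_Mapping.single (\<phi>' g ` insert v (h i ` C))
          ((- 1) ^ (card C choose 2) * (- 1) ^ card C)) c"
        unfolding chain_map_eq_lin_ext lin_ext_lin_ext
        by (rule lin_ext_cong) (simp add: img[symmetric] cards del: image_insert)
      also have "\<dots> = chain_map (\<phi>' g) (lin_ext (\<lambda>C. Poly_Mapping.single (insert v (h i ` C))
          ((- 1) ^ (card C choose 2) * (- 1) ^ card C)) c)"
        by (simp add: chain_map_eq_lin_ext lin_ext_lin_ext del: image_insert)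
      also have "\<dots> = chain_map (\<phi>' g) (cone v (\<delta> i c))"
        unfolding \<delta>_def by (subst cone_dual_map) (use F a in auto)
      finally show ?thesis .
    qed
    then show "\<Psi> i (chain_map (\<phi> g) c) = chain_map (\<phi>' g) (\<Psi> i c)"
      by (simp add: \<Psi>_def attach_def) (simp add: chain_map_eq_lin_ext lin_ext_diff)
  qed
qed

end


subsection \<open>Ranks\<close>

lemma Partial_orderD:
  assumes "Partial_order P"
  shows "antisym P" "trans P" "x \<in> Field P \<Longrightarrow> (x, x) \<in> P"
  using assms by (auto simp: partial_order_on_def preorder_on_def refl_on_def)

lemma Chains_subposet: "Chains (subposet P A) = {C \<in> Chains P. C \<subseteq> A}"
  by (auto simp: Chains_def subposet_def)

lemma finite_Chains:
  assumes "finite P"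
  shows "finite (Chains P)" "C \<in> Chains P \<Longrightarrow> finite C"
proof -
  have "Chains P \<subseteq> Pow (Field P)" by (auto simp: Chains_def Field_def)
  then show "finite (Chains P)" "C \<in> Chains P \<Longrightarrow> finite C"
    using finite_Field[OF assms] by (auto intro: finite_subset)
qed

lemma card_chain_le:
  assumes "finite P" "C \<in> Chains P"
  shows "int (card C) \<le> poset_length P + 1"
  using Max_ge[of "card ` Chains P" "card C"] finite_Chains(1)[OF assms(1)] assms(2)
  by (simp add: poset_length_def)

lemma longest_chain:
  assumes "finite P"
  obtains C where "C \<in> Chains P" "int (card C) = poset_length P + 1"
proof -
  have "{} \<in> Chains P" by (simp add: Chains_def)
  then have "Max (card ` Chains P) \<in> card ` Chains P"
    using finite_Chains(1)[OF assms] by (intro Max_in) auto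
  then show ?thesis using that by (auto simp: poset_length_def)
qed

lemma simplices_empty:
  assumes "finite P" "k < - 1 \<or> poset_length P < k"
  shows "simplices P k = {}"
proof -
  have False if "C \<in> Chains P" "int (card C) = k + 1" for C
    using card_chain_le[OF assms(1) that(1)] that(2) assms(2) by auto
  then show ?thesis by (auto simp: simplices_def)
qed

lemma finite_subposet: "finite P \<Longrightarrow> finite (subposet P A)"
  by (simp add: subposet_def)

lemma card_chain_le_rank:
  assumes "finite P" "C \<in> Chains P" "C \<subseteq> under P x"
  shows "int (card C) \<le> poset_rank P x + 1"
  unfolding poset_rank_def using assms
  by (intro card_chain_le finite_subposet) (auto simp: Chains_subposet)

lemma longest_chain_under:
  assumes "finite P"
  obtains C where "C \<in> Chains P" "C \<subseteq> under P x" "int (card C) = poset_rank P x + 1"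
  using longest_chain[OF finite_subposet[OF assms], of "under P x"]
  by (auto simp: Chains_subposet poset_rank_def)

lemma rank_total:
  assumes "finite P" "\<And>y z. y \<in> under P x \<Longrightarrow> z \<in> under P x \<Longrightarrow> (y, z) \<in> P \<or> (z, y) \<in> P"
  shows "poset_rank P x = int (card (under P x)) - 1"
proof -
  have U: "under P x \<in> Chains P" using assms(2) by (auto simp: Chains_def)
  obtain C where C: "C \<in> Chains P" "C \<subseteq> under P x" "int (card C) = poset_rank P x + 1"
    using longest_chain_under[OF assms(1)] .
  have "card C \<le> card (under P x)"
    by (rule card_mono[OF finite_Chains(2)[OF assms(1) U] C(2)])
  with card_chain_le_rank[OF assms(1) U order_refl] C(3) show ?thesis by simp
qed

section \<open>Ranks in chains and trees\<close>

lemma Field_chain_poset: "Field (chain_poset n) = {..<n}"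
  by (auto simp: chain_poset_def Field_def)

lemma finite_chain_poset: "finite (chain_poset n)"
  by (rule finite_subset[of _ "{..<n} \<times> {..<n}"]) (auto simp: chain_poset_def)

lemma rank_chain_poset:
  assumes "i < n"
  shows "poset_rank (chain_poset n) i = int i"
proof -
  have "under (chain_poset n) i = {..i}" using assms by (auto simp: under_def chain_poset_def)
  with assms show ?thesis
    by (subst rank_total[OF finite_chain_poset]) (auto simp: chain_poset_def)
qed

definition words :: "nat \<Rightarrow> nat \<Rightarrow> nat list set" where
  "words t n = {w. set w \<subseteq> {..<t} \<and> length w \<le> n}"

lemma finite_words: "finite (words t n)"
  unfolding words_def by (rule finite_lists_length_le) simp

lemma words_prefix: "w \<in> words t n \<Longrightarrow> prefix u w \<Longrightarrow> u \<in> words t n"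
  unfolding words_def by (auto dest: prefix_length_le set_mono_prefix)

lemma tree_poset_iff: "(u, w) \<in> tree_poset t n \<longleftrightarrow> prefix u w \<and> w \<in> words t n"
  by (auto simp: tree_poset_def words_def in_lists_conv_set)

lemma Field_tree_poset: "Field (tree_poset t n) = words t n"
  using words_prefix by (force simp: Field_def tree_poset_iff)

lemma finite_tree_poset: "finite (tree_poset t n)"
  by (rule finite_subset[of _ "words t n \<times> words t n"])
    (auto simp: tree_poset_iff finite_words intro: words_prefix)

lemma rank_tree_poset:
  assumes "w \<in> words t n"
  shows "poset_rank (tree_poset t n) w = int (length w)"
proof -
  have U: "under (tree_poset t n) w = set (prefixes w)"
    using assms by (auto simp: under_def tree_poset_iff)
  have "(u, v) \<in> tree_poset t n \<or> (v, u) \<in> tree_poset t n" if "prefix u w" "prefix v w" for u v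
    using that assms words_prefix[OF assms] prefix_same_cases[OF that] by (auto simp: tree_poset_iff)
  then have "poset_rank (tree_poset t n) w = int (card (set (prefixes w))) - 1"
    unfolding U[symmetric] by (intro rank_total finite_tree_poset) (auto simp: U)
  also have "\<dots> = int (length w)"
    by (subst distinct_card) (auto simp: distinct_prefixes)
  finally show ?thesis .
qed

section \<open>Ranks in a bounded ranked poset and its Rees products\<close>

locale graded_poset =
  fixes P :: "'a rel" and n :: nat and b top :: 'a
  assumes po: "Partial_order P" and fin: "finite P" and rk: "ranked P"
    and len: "poset_length P = int n" and n_pos: "n \<ge> 1"
    and least: "is_least P b" and greatest: "is_greatest P top"
begin

abbreviation r :: "'a \<Rightarrow> int" where "r \<equiv> poset_rank P"

lemmas antisym_P = Partial_orderD(1)[OF po]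
lemmas trans_P = Partial_orderD(2)[OF po]
lemmas refl_P = Partial_orderD(3)[OF po]

lemma b_le: "p \<in> Field P \<Longrightarrow> (b, p) \<in> P" and b_in: "b \<in> Field P"
  using least by (auto simp: is_least_def)

lemma le_top: "p \<in> Field P \<Longrightarrow> (p, top) \<in> P" and top_in: "top \<in> Field P"
  using greatest by (auto simp: is_greatest_def)

lemma greatest_elem_P: "greatest_elem P = top"
  unfolding greatest_elem_def
  by (rule the_equality[of "is_greatest P"])
    (use greatest antisym_P in \<open>auto simp: is_greatest_def dest: antisymD\<close>)

lemma is_least_iff: "is_least P x \<longleftrightarrow> x = b"
  using least antisymD[OF antisym_P] by (auto simp: is_least_def)

lemma Field_subposet: "Field (subposet P A) = Field P \<inter> A"
  using refl_P by (auto simp: subposet_def Field_def)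

lemma remove_min_P: "remove_min P = subposet P (Field P - {b})"
  unfolding remove_min_def is_least_iff by (rule arg_cong[where f = "subposet P"]) auto

lemma Field_remove_min: "Field (remove_min P) = Field P - {b}"
  by (auto simp: remove_min_P Field_subposet)

text \<open>Chains below \<open>p\<close> in the two posets correspond by inserting or deleting
  \<open>b\<close>, which changes the largest cardinality by exactly one.\<close>

lemma rank_remove_min:
  assumes "p \<in> Field P" "p \<noteq> b"
  shows "poset_rank (remove_min P) p = r p - 1"
proof -
  let ?M = "remove_min P"
  have finM: "finite ?M" using fin by (simp add: remove_min_P finite_subposet)
  have ChM: "C \<in> Chains ?M \<longleftrightarrow> C \<in> Chains P \<and> b \<notin> C" for C
    by (auto simp: remove_min_P Chains_subposet) (auto simp: Chains_def Field_def)
  have U: "under ?M p = under P p - {b}"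
    using assms(2) by (auto simp: remove_min_P under_def subposet_def Field_def)
  obtain C where C: "C \<in> Chains ?M" "C \<subseteq> under ?M p" "int (card C) = poset_rank ?M p + 1"
    using longest_chain_under[OF finM] .
  have "(b, x) \<in> P" if "x \<in> C" for x
    using that C(1) unfolding ChM by (intro b_le) (auto simp: Chains_def Field_def)
  then have "insert b C \<in> Chains P"
    using C(1) b_le[OF b_in] unfolding ChM by (auto simp: Chains_def)
  moreover have "insert b C \<subseteq> under P p"
    using C(2) b_le assms(1) unfolding U by (auto simp: under_def)
  ultimately have "int (card (insert b C)) \<le> r p + 1"
    by (rule card_chain_le_rank[OF fin])
  moreover have "card (insert b C) = Suc (card C)"
    using C(1) finite_Chains(2)[OF finM C(1)] unfolding ChM by simp
  moreover obtain D where D: "D \<in> Chains P" "D \<subseteq> under P p" "int (card D) = r p + 1"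
    using longest_chain_under[OF fin] .
  have "D - {b} \<in> Chains ?M" "D - {b} \<subseteq> under ?M p"
    using D(1,2) unfolding ChM U by (auto simp: Chains_def)
  then have "int (card (D - {b})) \<le> poset_rank ?M p + 1"
    by (rule card_chain_le_rank[OF finM])
  moreover have "card D \<le> Suc (card (D - {b}))"
    using card_mono[of "insert b (D - {b})" D] finite_Chains(2)[OF fin D(1)]
      card_insert_disjoint[of "D - {b}" b] by auto
  ultimately show ?thesis using C(3) D(3) by simp
qed

text \<open>A longest chain below \<open>p\<close> and a longest chain above \<open>p\<close> share
  only \<open>p\<close> and unite to a maximal chain. Rankedness enters here: this maximal chain
  must be as long as a longest chain of \<open>P\<close>.\<close>

lemma rank_converse:
  assumes "p \<in> Field P"
  shows "poset_rank (P\<inverse>) p = int n - r p"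
proof -
  have finC: "finite (P\<inverse>)" using fin by simp
  have ChC: "Chains (P\<inverse>) = Chains P" by (auto simp: Chains_def)
  obtain C where C: "C \<in> Chains P" "C \<subseteq> under P p" "int (card C) = r p + 1"
    using longest_chain_under[OF fin] .
  obtain D where D: "D \<in> Chains P" "D \<subseteq> under (P\<inverse>) p" "int (card D) = poset_rank (P\<inverse>) p + 1"
    using longest_chain_under[OF finC] unfolding ChC by blast
  have finE: "finite E" if "E \<in> Chains P" for E using finite_Chains(2)[OF fin that] .
  have pp: "(p, p) \<in> P" using refl_P assms by blast
  have "p \<in> C"
  proof (rule ccontr)
    assume "p \<notin> C"
    moreover have "insert p C \<in> Chains P" "insert p C \<subseteq> under P p"
      using C pp by (auto simp: Chains_def under_def)
    ultimately show False
      using card_chain_le_rank[OF fin, of "insert p C" p] C(3) finE[OF C(1)] by simp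
  qed
  have "p \<in> D"
  proof (rule ccontr)
    assume "p \<notin> D"
    moreover have "insert p D \<in> Chains (P\<inverse>)" "insert p D \<subseteq> under (P\<inverse>) p"
      using D pp by (auto simp: Chains_def under_def)
    ultimately show False
      using card_chain_le_rank[OF finC, of "insert p D" p] D(3) finE[OF D(1)] by simp
  qed
  have CD: "C \<inter> D = {p}"
    using C(2) D(2) \<open>p \<in> C\<close> \<open>p \<in> D\<close> antisymD[OF antisym_P] by (auto simp: under_def)
  have cmp: "(x, y) \<in> P" if "x \<in> C" "y \<in> D" for x y
    using subsetD[OF C(2) that(1)] subsetD[OF D(2) that(2)] transD[OF trans_P, of x p y]
    by (simp add: under_def)
  have U: "C \<union> D \<in> Chains P"
    using C(1) D(1) cmp by (auto simp: Chains_def)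
  \<comment> \<open>A chain that contains \<open>p\<close> splits at \<open>p\<close> into a lower
    and an upper half, and neither half can exceed the longest one.\<close>
  have maxU: "C \<union> D = E" if E: "E \<in> Chains P" "C \<union> D \<subseteq> E" for E
  proof -
    have "E \<inter> under P p \<in> Chains P" "E \<inter> under (P\<inverse>) p \<in> Chains (P\<inverse>)"
      using E(1) by (auto simp: Chains_def)
    then have "int (card (E \<inter> under P p)) \<le> int (card C)" "int (card (E \<inter> under (P\<inverse>) p)) \<le> int (card D)"
      using card_chain_le_rank[OF fin, of "E \<inter> under P p" p]
        card_chain_le_rank[OF finC, of "E \<inter> under (P\<inverse>) p" p] C(3) D(3) by auto
    moreover have "C \<subseteq> E \<inter> under P p" "D \<subseteq> E \<inter> under (P\<inverse>) p" using C(2) D(2) E(2) by auto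
    ultimately have "C = E \<inter> under P p" "D = E \<inter> under (P\<inverse>) p"
      using card_seteq[of "E \<inter> under P p" C] card_seteq[of "E \<inter> under (P\<inverse>) p" D] finE[OF E(1)]
      by simp_all
    moreover have "E \<subseteq> under P p \<union> under (P\<inverse>) p"
    proof
      fix x assume "x \<in> E"
      moreover have "p \<in> E" using \<open>p \<in> C\<close> E(2) by auto
      ultimately show "x \<in> under P p \<union> under (P\<inverse>) p"
        using E(1) by (auto simp: Chains_def under_def)
    qed
    ultimately show ?thesis by auto
  qed
  \<comment> \<open>Rankedness speaks of principal ideals; the ideal of \<open>top\<close> is all of
    \<open>P\<close>.\<close>
  have whole: "subposet P (under P top) = P"
    using le_top by (auto simp: subposet_def under_def Field_def)
  obtain L where L: "L \<in> Chains P" "int (card L) = int n + 1"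
    using longest_chain[OF fin] len by metis
  have maxL: "L = E" if E: "E \<in> Chains P" "L \<subseteq> E" for E
    by (rule card_seteq[OF finE[OF E(1)] E(2)])
      (use card_chain_le[OF fin E(1)] len L(2) in simp)
  have "C \<union> D \<in> maximal_chains P"
    unfolding maximal_chains_def using U maxU by blast
  moreover have "L \<in> maximal_chains P"
    unfolding maximal_chains_def using L(1) maxL by blast
  ultimately have "card (C \<union> D) = card L"
    using rk[unfolded ranked_def, rule_format, OF top_in, unfolded whole] by blast
  moreover have "card (C \<union> D) + 1 = card C + card D"
    using card_Un_Int[OF finE[OF C(1)] finE[OF D(1)]] CD by simp
  ultimately show ?thesis using L(2) C(3) D(3) by simp
qed

lemma rank_nonneg: "p \<in> Field P \<Longrightarrow> 0 \<le> r p"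
  using card_chain_le_rank[OF fin, of "{p}" p] refl_P by (auto simp: Chains_def under_def)

lemma rank_b: "r b = 0"
proof -
  have "under P b = {b}"
    using b_le b_in antisymD[OF antisym_P] by (auto simp: under_def Field_def)
  then show ?thesis
    using rank_total[OF fin, of b] refl_P[OF b_in] by simp
qed

lemma rank_top: "r top = int n"
proof -
  have "subposet P (under P top) = P"
    using le_top by (auto simp: subposet_def under_def Field_def)
  then show ?thesis using len by (simp add: poset_rank_def)
qed

lemma b_neq_top: "b \<noteq> top"
  using rank_b rank_top n_pos by auto

text \<open>Removing the minimum lowers ranks by one: \<open>int i + 1 \<le> r p\<close> is
  membership in the Rees product, and \<open>r p + int j \<le> int n + int i + 1\<close> compares
  the rank differences up to the pair of \<open>top\<close>, of rank \<open>n - 1\<close>, and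
  \<open>j - 1\<close>.\<close>

lemma underS_rees_product:
  assumes "1 \<le> j" "j \<le> n"
  shows "underS (rees_product (remove_min P) (chain_poset n)) (greatest_elem P, j - 1) =
     {(p, i). p \<in> Field P \<and> i < j \<and> int i + 1 \<le> r p \<and> r p + int j \<le> int n + int i + 1 \<and> (p, i) \<noteq> (top, j - 1)}"
  (is "?L = ?S")
proof (rule Set.set_eqI)
  fix y :: "'a \<times> nat"
  obtain p i where y: "y = (p, i)" by force
  have jn: "j - 1 < n" using assms by auto
  show "y \<in> ?L \<longleftrightarrow> y \<in> ?S"
  proof (cases "p \<in> Field P \<and> p \<noteq> b \<and> i < n")
    case True
    then have "(p, top) \<in> remove_min P"
      using le_top top_in b_neq_top by (auto simp: remove_min_P subposet_def)
    with True jn assms top_in b_neq_top show ?thesis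
      by (auto simp: y greatest_elem_P underS_def rees_product_def rees_carrier_def Field_remove_min
          Field_chain_poset rank_remove_min rank_chain_poset rank_top) (auto simp: chain_poset_def)
  next
    case False
    then have "y \<notin> ?L"
      by (auto simp: y underS_def rees_product_def rees_carrier_def Field_remove_min Field_chain_poset)
    moreover have "y \<notin> ?S" using False rank_b assms by (auto simp: y)
    ultimately show ?thesis by simp
  qed
qed

lemma rees_ideal_iff:
  assumes "1 \<le> j" "j \<le> n"
  shows "((p, i), (q, k)) \<in> rees_ideal P n (j - 1) \<longleftrightarrow>
    (p, q) \<in> P \<and> i \<le> k \<and> int k - int i \<le> r q - r p \<and>
    i < j \<and> int i + 1 \<le> r p \<and> r p + int j \<le> int n + int i + 1 \<and> (p, i) \<noteq> (top, j - 1) \<and>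
    k < j \<and> int k + 1 \<le> r q \<and> r q + int j \<le> int n + int k + 1 \<and> (q, k) \<noteq> (top, j - 1)"
  (is "?L \<longleftrightarrow> ?R")
proof (cases "p \<in> Field P \<and> q \<in> Field P \<and> p \<noteq> b \<and> q \<noteq> b \<and> i < n \<and> k < n")
  case True
  then show ?thesis
    unfolding rees_ideal_def Let_def subposet_def underS_rees_product[OF assms]
    by (auto simp: rees_product_def rees_carrier_def Field_remove_min Field_chain_poset
        rank_remove_min rank_chain_poset) (auto simp: remove_min_P subposet_def chain_poset_def)
next
  case False
  \<comment> \<open>The minimum is excluded on this side by \<open>r b = 0\<close> against
    \<open>int i + 1 \<le> r p\<close>.\<close>
  have "\<not> ?R"
    using False rank_b assms(2) by (auto simp: Field_def)
  moreover have "\<not> ?L"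
    using False unfolding rees_ideal_def Let_def subposet_def
    by (auto simp: rees_product_def rees_carrier_def Field_remove_min Field_chain_poset)
  ultimately show ?thesis by simp
qed

text \<open>Since the dual rank of \<open>p\<close> is \<open>n - r p\<close>, membership in the
  Rees product becomes \<open>length u + r p \<le> n\<close>, and rank differences change sign. The
  minimum is \<open>(top, [])\<close>, because \<open>top\<close> is the least element of the
  dual.\<close>

lemma remove_min_rees_product_iff:
  "((p, u), (q, v)) \<in> remove_min (rees_product (P\<inverse>) (tree_poset t n)) \<longleftrightarrow>
    (q, p) \<in> P \<and> prefix u v \<and> v \<in> words t n \<and> int (length v) - int (length u) \<le> r p - r q \<and>
    int (length u) + r p \<le> int n \<and> int (length v) + r q \<le> int n \<and>
    (p, u) \<noteq> (top, []) \<and> (q, v) \<noteq> (top, [])"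
proof -
  let ?M = "rees_product (P\<inverse>) (tree_poset t n)"
  have M: "((p, u), (q, v)) \<in> ?M \<longleftrightarrow> (q, p) \<in> P \<and> prefix u v \<and> v \<in> words t n \<and>
    int (length v) - int (length u) \<le> r p - r q \<and> int (length u) + r p \<le> int n \<and> int (length v) + r q \<le> int n"
    for p u q v
  proof (cases "p \<in> Field P \<and> q \<in> Field P \<and> u \<in> words t n \<and> v \<in> words t n")
    case True
    then show ?thesis
      by (auto simp: rees_product_def rees_carrier_def Field_tree_poset rank_tree_poset
          rank_converse tree_poset_iff)
  next
    case False
    have "(q, p) \<in> P \<and> prefix u v \<and> v \<in> words t n \<Longrightarrow> False"
      using False words_prefix[of v t n u] by (auto simp: Field_def)
    moreover have "((p, u), (q, v)) \<in> ?M \<Longrightarrow> False"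
      using False by (auto simp: rees_product_def rees_carrier_def Field_tree_poset)
    ultimately show ?thesis by blast
  qed
  have FM: "(p, u) \<in> Field ?M \<longleftrightarrow> p \<in> Field P \<and> u \<in> words t n \<and> int (length u) + r p \<le> int n" for p u
  proof
    assume "(p, u) \<in> Field ?M"
    then obtain q v where "((p, u), (q, v)) \<in> ?M \<or> ((q, v), (p, u)) \<in> ?M" by (auto simp: Field_def)
    then show "p \<in> Field P \<and> u \<in> words t n \<and> int (length u) + r p \<le> int n"
      unfolding M using words_prefix by (auto simp: Field_def)
  next
    assume "p \<in> Field P \<and> u \<in> words t n \<and> int (length u) + r p \<le> int n"
    then have "((p, u), (p, u)) \<in> ?M" unfolding M using refl_P by auto
    then show "(p, u) \<in> Field ?M" by (auto simp: Field_def)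
  qed
  have least_M: "is_least ?M x \<longleftrightarrow> x = (top, [])" for x
  proof -
    have Nil: "(top, []) \<in> Field ?M"
      unfolding FM using top_in rank_top by (auto simp: words_def)
    obtain p u where x: "x = (p, u)" by force
    show ?thesis
    proof
      assume "is_least ?M x"
      then have "((p, u), (top, [])) \<in> ?M" using Nil by (simp add: is_least_def x)
      then have "(top, p) \<in> P" "u = []" unfolding M by auto
      moreover have "(p, top) \<in> P" using \<open>(top, p) \<in> P\<close> le_top by (auto simp: Field_def)
      ultimately show "x = (top, [])" using antisymD[OF antisym_P] x by blast
    next
      assume "x = (top, [])"
      \<comment> \<open>From \<open>(top, [])\<close> the condition on rank differences is the same
        as membership of \<open>(q, v)\<close> in the Rees product.\<close>
      moreover have "((top, []), (q, v)) \<in> ?M" if "(q, v) \<in> Field ?M" for q v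
        using that le_top n_pos unfolding M FM by (auto simp: rank_top)
      ultimately show "is_least ?M x" using Nil by (auto simp: is_least_def)
    qed
  qed
  have "((p, u), (q, v)) \<in> remove_min ?M \<longleftrightarrow> ((p, u), (q, v)) \<in> ?M \<and> (p, u) \<noteq> (top, []) \<and> (q, v) \<noteq> (top, [])"
    unfolding remove_min_def least_M subposet_def by (auto simp: Field_def)
  then show ?thesis by (simp add: M)
qed

end


subsection \<open>The homology of the Rees product with a tree\<close>

text \<open>Serves both Rees products. Reflexivity identifies the underlying set with the diagonal
  of \<open>S\<close>, so invariance of the relation also gives invariance of the set.\<close>

lemma order_aut_act_fst:
  assumes "order_aut P f"
    and F: "\<And>p u q v. ((p, u), (q, v)) \<in> S \<Longrightarrow> p \<in> Field P \<and> q \<in> Field P"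
    and refl: "\<And>x. x \<in> Field S \<Longrightarrow> (x, x) \<in> S"
    and iff: "\<And>p u q v. p \<in> Field P \<Longrightarrow> q \<in> Field P \<Longrightarrow>
        ((f p, u), (f q, v)) \<in> S \<longleftrightarrow> ((p, u), (q, v)) \<in> S"
  shows "order_aut S (\<lambda>(a, x). (f a, x))"
proof -
  have bij: "bij_betw f (Field P) (Field P)" using assms(1) by (simp add: order_aut_def)
  have FS: "x \<in> Field S \<longleftrightarrow> (x, x) \<in> S" for x
    using refl[of x] by (blast intro: FieldI1)
  have FP: "p \<in> Field P" if "(p, u) \<in> Field S" for p u
    using F[of p u p u] that by (simp add: FS)
  have mem: "(f p, u) \<in> Field S \<longleftrightarrow> (p, u) \<in> Field S" if "p \<in> Field P" for p u
    using iff[OF that that] by (simp add: FS)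
  have "bij_betw (\<lambda>(a, x). (f a, x)) (Field S) (Field S)"
  proof (rule bij_betw_imageI)
    show "inj_on (\<lambda>(a, x). (f a, x)) (Field S)"
      using bij FP by (auto simp: inj_on_def bij_betw_def)
    show "(\<lambda>(a, x). (f a, x)) ` Field S = Field S"
    proof (intro equalityI subsetI)
      fix y assume y: "y \<in> Field S"
      obtain q u where q: "y = (q, u)" by force
      then obtain p where p: "p \<in> Field P" "q = f p" using bij FP[of q u] y by (auto simp: bij_betw_def)
      then have "(p, u) \<in> Field S" using mem y q by blast
      then show "y \<in> (\<lambda>(a, x). (f a, x)) ` Field S" using p q by force
    qed (use mem FP in auto)
  qed
  with iff FP show ?thesis by (auto simp: order_aut_def)
qed

context graded_poset
begin

text \<open>The shift makes \<open>j\<close> the length of the words whose links are modelled by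
  this ideal.\<close>

definition lower_ideal :: "nat \<Rightarrow> ('a \<times> nat) rel" where
  "lower_ideal j = rees_ideal P n (j - 1)"

lemmas lower_ideal_iff = rees_ideal_iff[folded lower_ideal_def]

definition tree_product :: "nat \<Rightarrow> ('a \<times> nat list) rel" where
  "tree_product t = remove_min (rees_product (P\<inverse>) (tree_poset t n))"

lemmas tree_product_iff = remove_min_rees_product_iff[folded tree_product_def]

lemma tree_product_refl: "x \<in> Field (tree_product t) \<Longrightarrow> (x, x) \<in> tree_product t"
proof -
  assume "x \<in> Field (tree_product t)"
  then obtain y where "(x, y) \<in> tree_product t \<or> (y, x) \<in> tree_product t"
    unfolding Field_def by blast
  moreover obtain p u q v where "x = (p, u)" "y = (q, v)" by force
  ultimately show ?thesis
    using refl_P words_prefix[of v t n u] by (auto simp: tree_product_iff intro: FieldI1 FieldI2)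
qed

lemma lower_ideal_refl:
  assumes "1 \<le> j" "j \<le> n"
  shows "x \<in> Field (lower_ideal j) \<Longrightarrow> (x, x) \<in> lower_ideal j"
proof -
  assume "x \<in> Field (lower_ideal j)"
  then obtain y where "(x, y) \<in> lower_ideal j \<or> (y, x) \<in> lower_ideal j"
    unfolding Field_def by blast
  moreover obtain p u q v where "x = (p, u)" "y = (q, v)" by force
  ultimately show ?thesis
    using refl_P by (auto simp: lower_ideal_iff[OF assms] intro: FieldI1 FieldI2)
qed

lemma Field_tree_product_iff: "x \<in> Field (tree_product t) \<longleftrightarrow> (x, x) \<in> tree_product t"
  using tree_product_refl by (blast intro: FieldI1)

lemma Field_lower_ideal_iff:
  "1 \<le> j \<Longrightarrow> j \<le> n \<Longrightarrow> x \<in> Field (lower_ideal j) \<longleftrightarrow> (x, x) \<in> lower_ideal j"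
  using lower_ideal_refl by (blast intro: FieldI1)

lemma finite_tree_product: "finite (tree_product t)"
proof (rule finite_subset)
  show "tree_product t \<subseteq> (Field P \<times> words t n) \<times> (Field P \<times> words t n)"
    by (auto simp: tree_product_iff intro: words_prefix FieldI1 FieldI2)
  show "finite ((Field P \<times> words t n) \<times> (Field P \<times> words t n))"
    by (intro finite_cartesian_product finite_words finite_Field fin)
qed

lemma finite_lower_ideal:
  assumes "1 \<le> j" "j \<le> n"
  shows "finite (lower_ideal j)"
proof (rule finite_subset)
  show "lower_ideal j \<subseteq> (Field P \<times> {..<j}) \<times> (Field P \<times> {..<j})"
    by (auto simp: lower_ideal_iff[OF assms] intro: FieldI1 FieldI2)
  show "finite ((Field P \<times> {..<j}) \<times> (Field P \<times> {..<j}))"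
    by (intro finite_cartesian_product finite_lessThan finite_Field fin)
qed

lemma antisym_lower_ideal: "1 \<le> j \<Longrightarrow> j \<le> n \<Longrightarrow> antisym (lower_ideal j)"
  using antisymD[OF antisym_P] by (auto simp: antisym_def lower_ideal_iff)

lemma cone_tree_product: "cone_tree (tree_product t) (words t n) snd (\<lambda>w. (b, w))"
proof
  show "antisym (tree_product t)"
    using antisymD[OF antisym_P] by (auto simp: antisym_def tree_product_iff intro: prefix_order.antisym)
  show "trans (tree_product t)"
    using transD[OF trans_P] by (auto simp: trans_def tree_product_iff intro: prefix_order.trans)
  show "finite (words t n)" by (rule finite_words)
  show "[] \<in> words t n" by (simp add: words_def)
  show "w \<in> words t n \<Longrightarrow> prefix u w \<Longrightarrow> u \<in> words t n" for u w by (rule words_prefix)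
  show "snd y \<in> words t n" if "y \<in> Field (tree_product t)" for y
    using that by (cases y) (simp add: Field_tree_product_iff tree_product_iff)
  show "prefix (snd y) (snd y')" if "(y, y') \<in> tree_product t" for y y'
    using that by (cases y, cases y') (simp add: tree_product_iff)
  show "snd (b, w) = w" for w :: "nat list" by simp
  show "((b, w), (b, w)) \<in> tree_product t" if "w \<in> words t n" for w
    using that b_le b_in b_neq_top rank_b by (auto simp: tree_product_iff words_def)
  show "(y, (b, snd y)) \<in> tree_product t" if "y \<in> Field (tree_product t)" for y
  proof -
    obtain p u where y: "y = (p, u)" by force
    have "((p, u), (p, u)) \<in> tree_product t" using that Field_tree_product_iff y by blast
    moreover from this have "p \<in> Field P" by (auto simp: tree_product_iff Field_def)
    ultimately show ?thesis
      using b_le b_neq_top rank_b rank_nonneg by (auto simp: y tree_product_iff words_def)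
  qed
  \<comment> \<open>A shorter word demands a smaller rank difference, so the inequality for
    \<open>u\<close> implies the one for \<open>w\<close>.\<close>
  show "(y, (b, w)) \<in> tree_product t"
    if "(y, (b, u)) \<in> tree_product t" "prefix (snd y) w" "prefix w u" "u \<in> words t n" for y u w
    using that prefix_length_le[OF that(3)] words_prefix[OF that(4,3)] b_neq_top rank_b
    by (cases y) (auto simp: tree_product_iff)
  \<comment> \<open>Equal first components leave no rank difference to spend in the tree, so the
    prefix has full length.\<close>
  show "u = w" if "((b, u), (b, w)) \<in> tree_product t" for u w
    using that by (auto simp: tree_product_iff prefix_def)
qed

section \<open>Invariance under the group\<close>

lemma rank_le_image:
  assumes "inj_on f (Field P)" "\<And>x y. (x, y) \<in> P \<Longrightarrow> (f x, f y) \<in> P"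
  shows "r p \<le> r (f p)"
proof -
  obtain C where C: "C \<in> Chains P" "C \<subseteq> under P p" "int (card C) = r p + 1"
    using longest_chain_under[OF fin] .
  have "C \<subseteq> Field P" using C(1) by (auto simp: Chains_def Field_def)
  then have "card (f ` C) = card C" by (intro card_image inj_on_subset[OF assms(1)])
  moreover have "f ` C \<in> Chains P" "f ` C \<subseteq> under P (f p)"
    using C(1,2) assms(2) by (auto simp: Chains_def under_def) blast+
  then have "int (card (f ` C)) \<le> r (f p) + 1" by (rule card_chain_le_rank[OF fin])
  ultimately show ?thesis using C(3) by simp
qed

text \<open>These are the data on which \<open>lower_ideal_iff\<close>,
  \<open>tree_product_iff\<close> and the apices depend. Invariance of the rank results from
  \<open>rank_le_image\<close> for the group element and for its inverse.\<close>

lemma G_action: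
  assumes "group G" "G_poset G \<phi> P" "g \<in> carrier G"
  shows "order_aut P (\<phi> g)" "p \<in> Field P \<Longrightarrow> \<phi> g p \<in> Field P" "p \<in> Field P \<Longrightarrow> r (\<phi> g p) = r p"
    "\<phi> g b = b" "p \<in> Field P \<Longrightarrow> \<phi> g p = top \<longleftrightarrow> p = top"
proof -
  interpret group_action G "Field P" \<phi> using assms(2) by (simp add: G_poset_def)
  interpret group G by (rule assms(1))
  have mono: "(\<phi> g x, \<phi> g y) \<in> P" if "g \<in> carrier G" "(x, y) \<in> P" for g x y
    using assms(2) that by (auto simp: G_poset_def)
  have gi: "inv\<^bsub>G\<^esub> g \<in> carrier G" using assms(3) by simp
  have inv: "\<phi> (inv\<^bsub>G\<^esub> g) (\<phi> g p) = p" if "p \<in> Field P" for p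
    using orbit_sym_aux[OF assms(3) that refl] .
  show im: "\<phi> g p \<in> Field P" if "p \<in> Field P" for p
    using element_image[OF assms(3) that refl] .
  have iff: "(\<phi> g x, \<phi> g y) \<in> P \<longleftrightarrow> (x, y) \<in> P" if "x \<in> Field P" "y \<in> Field P" for x y
    using mono[OF assms(3), of x y] mono[OF gi, of "\<phi> g x" "\<phi> g y"] inv that by auto
  have bij: "bij_betw (\<phi> g) (Field P) (Field P)"
    using inj_prop[OF assms(3)] surj_prop[OF assms(3)] by (simp add: bij_betw_def)
  then show "order_aut P (\<phi> g)" using iff by (auto simp: order_aut_def)
  show "r (\<phi> g p) = r p" if "p \<in> Field P" for p
    using rank_le_image[OF inj_prop[OF assms(3)] mono[OF assms(3)], of p]
      rank_le_image[OF inj_prop[OF gi] mono[OF gi], of "\<phi> g p"] inv[OF that] by simp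
  show "\<phi> g b = b"
  proof (rule antisymD[OF antisym_P])
    obtain x where "x \<in> Field P" "b = \<phi> g x" using surj_prop[OF assms(3)] b_in by blast
    then show "(\<phi> g b, b) \<in> P" using b_le iff b_in by auto
  qed (use b_le im b_in in auto)
  have top: "\<phi> g top = top"
  proof (rule antisymD[OF antisym_P])
    obtain x where "x \<in> Field P" "top = \<phi> g x" using surj_prop[OF assms(3)] top_in by blast
    then show "(top, \<phi> g top) \<in> P" using le_top iff top_in by auto
  qed (use le_top im top_in in auto)
  show "\<phi> g p = top \<longleftrightarrow> p = top" if "p \<in> Field P"
    using top inj_prop[OF assms(3)] that top_in by (metis inj_onD)
qed

lemma order_aut_tree_product:
  assumes "group G" "G_poset G \<phi> P" "g \<in> carrier G"
  shows "order_aut (tree_product t) (act_fst \<phi> g)"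
  unfolding act_fst_def
proof (rule order_aut_act_fst[OF G_action(1)[OF assms]])
  show "((\<phi> g p, u), \<phi> g q, v) \<in> tree_product t \<longleftrightarrow> ((p, u), q, v) \<in> tree_product t"
    if "p \<in> Field P" "q \<in> Field P" for p u q v
    using that G_action(1,3,5)[OF assms] by (simp add: tree_product_iff order_aut_def)
qed (auto simp: tree_product_iff tree_product_refl intro: FieldI1 FieldI2)

lemma order_aut_lower_ideal:
  assumes "group G" "G_poset G \<phi> P" "g \<in> carrier G" "1 \<le> j" "j \<le> n"
  shows "order_aut (lower_ideal j) (act_fst \<phi> g)"
  unfolding act_fst_def
proof (rule order_aut_act_fst[OF G_action(1)[OF assms(1-3)]])
  show "((\<phi> g p, u), \<phi> g q, v) \<in> lower_ideal j \<longleftrightarrow> ((p, u), q, v) \<in> lower_ideal j"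
    if "p \<in> Field P" "q \<in> Field P" for p u q v
    using that G_action(1,3,5)[OF assms(1-3)] by (simp add: lower_ideal_iff[OF assms(4,5)] order_aut_def)
qed (auto simp: lower_ideal_iff[OF assms(4,5)] lower_ideal_refl[OF assms(4,5)] intro: FieldI1 FieldI2)

lemma homology_tree_product:
  assumes "group G" "G_poset G \<phi> P"
  shows "rep_iso G
    (rep_sum {1..n} (\<lambda>j. rep_copies (t ^ j) (homology_rep (act_fst \<phi>) (lower_ideal j) (k - 1))))
    (homology_rep (act_fst \<phi>) (tree_product t) k)"
proof -
  interpret cone_tree "tree_product t" "words t n" snd "\<lambda>w. (b, w)" by (rule cone_tree_product)
  let ?W = "\<lambda>j. {w. set w \<subseteq> {..<t} \<and> length w = j}"
  have "\<exists>e. bij_betw e {..<t ^ j} (?W j)" for j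
  proof -
    have "finite (?W j)" "card (?W j) = t ^ j"
      using finite_lists_length_eq[of "{..<t}" j] card_lists_length_eq[of "{..<t}" j] by simp_all
    then show ?thesis using ex_bij_betw_nat_finite[of "?W j"] by (simp add: lessThan_atLeast0)
  qed
  \<comment> \<open>Copies are indexed by numbers below \<open>t ^ j\<close>, links by words;
    \<open>e j\<close> numbers the words of length \<open>j\<close>.\<close>
  then obtain e where e: "bij_betw (e j) {..<t ^ j} (?W j)" for j by metis
  let ?J = "Sigma {1..n} (\<lambda>j. {..<t ^ j})"
  define wd where "wd = (\<lambda>(j, m). e j m)"
  have wdD: "set (wd x) \<subseteq> {..<t}" "length (wd x) = fst x" "1 \<le> fst x" "fst x \<le> n" if "x \<in> ?J" for x
    using that bij_betwE[OF e] by (auto simp: wd_def)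
  have wd: "bij_betw wd ?J (words t n - {[]})"
  proof (rule bij_betw_imageI)
    show "inj_on wd ?J"
    proof (rule inj_onI)
      fix x y assume x: "x \<in> ?J" and y: "y \<in> ?J" and eq: "wd x = wd y"
      from wdD(2)[OF x] wdD(2)[OF y] eq have "fst x = fst y" by simp
      moreover obtain j m m' where "x = (j, m)" "y = (j, m')"
        using \<open>fst x = fst y\<close> by (metis prod.collapse)
      ultimately show "x = y"
        using x y eq e[of j] by (auto simp: wd_def bij_betw_def dest: inj_onD)
    qed
    show "wd ` ?J = words t n - {[]}"
    proof (intro equalityI subsetI)
      fix w assume "w \<in> wd ` ?J"
      then obtain x where x: "x \<in> ?J" "w = wd x" by blast
      with wdD[OF x(1)] show "w \<in> words t n - {[]}" by (auto simp: words_def)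
    next
      fix w assume w: "w \<in> words t n - {[]}"
      then have "w \<in> ?W (length w)" by (auto simp: words_def)
      then have "w \<in> e (length w) ` {..<t ^ length w}"
        using e[of "length w"] unfolding bij_betw_def by blast
      then obtain m where "m < t ^ length w" "w = e (length w) m" by blast
      then show "w \<in> wd ` ?J"
        using w by (intro image_eqI[of _ _ "(length w, m)"]) (auto simp: wd_def words_def Suc_le_eq)
    qed
  qed
  define Q where "Q x = lower_ideal (fst x)" for x :: "nat \<times> nat"
  \<comment> \<open>Inverse of the substitution \<open>i = j - 1 - length u\<close> with
    \<open>j = fst x\<close>: the prefix of the word is recovered from its length. Smaller
    \<open>i\<close> means a longer prefix, and \<open>(top, j - 1)\<close> corresponds to the
    removed minimum \<open>(top, [])\<close>.\<close>
  define h where "h x = (\<lambda>(p, i). (p :: 'a, take (fst x - 1 - i) (wd x)))" for x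
  have h_simp: "h x (p, i) = (p, take (fst x - 1 - i) (wd x))" for x p i by (simp add: h_def)
  have main: "rep_iso G (rep_sum ?J (\<lambda>x. homology_rep (act_fst \<phi>) (Q x) (k - 1)))
      (homology_rep (act_fst \<phi>) (tree_product t) k)"
  proof (rule homology_rep_iso[OF wd, where h = h])
    fix x assume x: "x \<in> ?J"
    note w = wdD[OF x]
    show "antisym (Q x)" unfolding Q_def by (rule antisym_lower_ideal[OF w(3,4)])
    have FQ: "(p, i) \<in> Field (Q x) \<longleftrightarrow> p \<in> Field P \<and> i < fst x \<and> int i + 1 \<le> r p \<and>
        r p + int (fst x) \<le> int n + int i + 1 \<and> (p, i) \<noteq> (top, fst x - 1)" for p i
      unfolding Q_def Field_lower_ideal_iff[OF w(3,4)] lower_ideal_iff[OF w(3,4)]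
      using refl_P by (auto simp: Field_def)
    \<comment> \<open>Under this substitution the bound
      \<open>int (fst x) \<le> r p + int (length u)\<close> becomes
      \<open>int i + 1 \<le> r p\<close> in \<open>FQ\<close>, and
      \<open>int (length u) + r p \<le> int n\<close> becomes the upper bound there.\<close>
    have link: "(p, u) \<in> link (wd x) \<longleftrightarrow> p \<in> Field P \<and> strict_prefix u (wd x) \<and>
        int (fst x) \<le> r p + int (length u) \<and> int (length u) + r p \<le> int n \<and> (p, u) \<noteq> (top, [])" for p u
    proof -
      have "wd x \<in> words t n" using w by (simp add: words_def)
      moreover have "(b, p) \<in> P \<longleftrightarrow> p \<in> Field P" using b_le by (auto simp: Field_def)
      ultimately show ?thesis
        using w b_neq_top by (auto simp: link_def tree_product_iff rank_b strict_prefix_def)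
    qed
    show "bij_betw (h x) (Field (Q x)) (link (wd x))"
    proof (rule bij_betw_byWitness[where f' = "\<lambda>(p, u). (p, fst x - 1 - length u)"])
      have sp: "strict_prefix (take m (wd x)) (wd x)" if "m < fst x" for m
        using that w(2) by (auto simp: strict_prefix_def take_is_prefix)
      show "\<forall>y\<in>Field (Q x). (\<lambda>(p, u). (p, fst x - 1 - length u)) (h x y) = y"
        using w(2) by (auto simp: FQ h_simp)
      show "\<forall>y\<in>link (wd x). h x ((\<lambda>(p, u). (p, fst x - 1 - length u)) y) = y"
      proof
        fix y assume "y \<in> link (wd x)"
        moreover obtain p u where y: "y = (p, u)" by force
        ultimately have "strict_prefix u (wd x)" by (simp add: link)
        then have "prefix u (wd x)" "length u < fst x"
          using w(2) prefix_length_less[of u "wd x"] by (simp_all add: strict_prefix_def)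
        then show "h x ((\<lambda>(p, u). (p, fst x - 1 - length u)) y) = y"
          using w(2) by (auto simp: y h_simp prefix_def)
      qed
      show "h x ` Field (Q x) \<subseteq> link (wd x)"
        using w by (auto simp: FQ h_simp link sp)
      show "(\<lambda>(p, u). (p, fst x - 1 - length u)) ` link (wd x) \<subseteq> Field (Q x)"
      proof safe
        fix p u assume pu: "(p, u) \<in> link (wd x)"
        then have "length u < fst x"
          using w(2) prefix_length_less[of u "wd x"] by (simp add: link)
        \<comment> \<open>As \<open>length u < fst x\<close>, no truncation occurs, and only the
          empty prefix is sent to the index that is excluded at \<open>top\<close>.\<close>
        moreover from this have "fst x - Suc (length u) = fst x - Suc 0 \<longleftrightarrow> u = []"
          by (cases u) auto
        ultimately show "(p, fst x - 1 - length u) \<in> Field (Q x)"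
          using pu by (auto simp: link FQ)
      qed
    qed
    show "(h x z, h x y) \<in> tree_product t \<longleftrightarrow> (y, z) \<in> Q x"
      if yz: "y \<in> Field (Q x)" "z \<in> Field (Q x)" for y z
    proof -
      obtain p i q l where [simp]: "y = (p, i)" "z = (q, l)" by force
      have pre: "prefix (take a (wd x)) (take c (wd x)) \<longleftrightarrow> a \<le> c" if "a < fst x" "c < fst x" for a c
        using that w(2) prefix_length_le[of "take a (wd x)" "take c (wd x)"]
        by (auto simp: take_is_prefix prefix_def) (metis append_take_drop_id le_add_diff_inverse take_add)
      have "take c (wd x) \<in> words t n" for c
        using w words_prefix[of "wd x" t n, OF _ take_is_prefix] by (auto simp: words_def)
      then show ?thesis
        using yz w unfolding FQ Q_def
        by (auto simp: lower_ideal_iff[OF w(3,4)] tree_product_iff h_simp FQ[unfolded Q_def] pre)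
    qed
    show "order_aut (Q x) (act_fst \<phi> g)" if "g \<in> carrier G" for g
      unfolding Q_def by (rule order_aut_lower_ideal[OF assms that w(3,4)])
    show "h x (act_fst \<phi> g y) = act_fst \<phi> g (h x y)" for g y
      by (cases y) (simp add: act_fst_def h_simp)
  next
    show "order_aut (tree_product t) (act_fst \<phi> g)" if "g \<in> carrier G" for g
      by (rule order_aut_tree_product[OF assms that])
    show "act_fst \<phi> g (b, w) = (b, w)" if "g \<in> carrier G" for g and w :: "nat list"
      using G_action(4)[OF assms that] by (simp add: act_fst_def)
  qed
  have "(\<lambda>x. homology_rep (act_fst \<phi>) (Q x) (k - 1)) =
      (\<lambda>(j, m). homology_rep (act_fst \<phi>) (lower_ideal j) (k - 1))"
    by (auto simp: Q_def)
  then show ?thesis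
    using main rep_iso_trans[OF rep_sum_Sigma[of G "{1..n}" "\<lambda>j. {..<t ^ j}"
        "\<lambda>j m. homology_rep (act_fst \<phi>) (lower_ideal j) (k - 1)"]]
    unfolding rep_copies_def by simp
qed

text \<open>The parameter \<open>d\<close> selects the parity: \<open>d = 0\<close> compares the
  even degrees of the ideals with the odd degrees of the tree product, \<open>d = 1\<close> the odd
  with the even ones.\<close>

lemma homology_sum_tree_product:
  assumes "group G" "G_poset G \<phi> P"
  shows "rep_iso G
    (rep_sum {1..n} (\<lambda>j. rep_sum {..<t ^ j} (\<lambda>_.
       rep_sum {i \<in> {-1..poset_length (lower_ideal j)}. even (i + d)} (homology_rep (act_fst \<phi>) (lower_ideal j)))))
    (rep_sum {i \<in> {-1..poset_length (tree_product t)}. odd (i + d)}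
       (homology_rep (act_fst \<phi>) (tree_product t)))"
proof -
  let ?H = "\<lambda>j. homology_rep (act_fst \<phi>) (lower_ideal j)"
  let ?HT = "homology_rep (act_fst \<phi>) (tree_product t)"
  \<comment> \<open>The ideals have lengths of their own; \<open>N\<close> bounds all lengths, so
    that one range of degrees serves every summand and the sums over degrees and over words can be
    exchanged.\<close>
  define N where "N = Max (insert (poset_length (tree_product t)) ((\<lambda>j. poset_length (lower_ideal j)) ` {1..n}))"
  have N: "poset_length (tree_product t) \<le> N" "\<And>j. j \<in> {1..n} \<Longrightarrow> poset_length (lower_ideal j) \<le> N"
    unfolding N_def by (rule Max_ge; simp)+
  define E where "E = {i \<in> {-2..N}. even (i + d)}"
  \<comment> \<open>The shift by one maps \<open>K\<close> onto \<open>E\<close>, which is why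
    \<open>E\<close> starts at -2; the added degrees have zero homology.\<close>
  define K where "K = {i \<in> {-1..N + 1}. odd (i + d)}"
  have 1: "rep_iso G (rep_sum {i \<in> {-1..poset_length (lower_ideal j)}. even (i + d)} (?H j)) (rep_sum E (?H j))"
    if j: "j \<in> {1..n}" for j
  proof (rule rep_sum_restrict(2))
    show "{i \<in> {-1..poset_length (lower_ideal j)}. even (i + d)} \<subseteq> E"
      using N(2)[OF j] by (auto simp: E_def)
    fix i assume i: "i \<in> E - {i \<in> {-1..poset_length (lower_ideal j)}. even (i + d)}"
    show "carrier (space (?H j i)) = {\<zero>\<^bsub>space (?H j i)\<^esub>}"
      unfolding homology_rep_simps
      by (rule reduced_homology_trivial, rule simplices_empty[OF finite_lower_ideal])
        (use i j in \<open>auto simp: E_def\<close>)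
    show "rep_ok G (?H j i)"
      by (rule rep_ok_homology_rep) (use order_aut_lower_ideal[OF assms] j in auto)
  qed
  have 2: "rep_iso G (rep_sum K ?HT) (rep_sum {i \<in> {-1..poset_length (tree_product t)}. odd (i + d)} ?HT)"
  proof (rule rep_sum_restrict(1))
    show "{i \<in> {-1..poset_length (tree_product t)}. odd (i + d)} \<subseteq> K"
      using N(1) by (auto simp: K_def)
    fix i assume i: "i \<in> K - {i \<in> {-1..poset_length (tree_product t)}. odd (i + d)}"
    show "carrier (space (?HT i)) = {\<zero>\<^bsub>space (?HT i)\<^esub>}"
      unfolding homology_rep_simps
      by (rule reduced_homology_trivial, rule simplices_empty[OF finite_tree_product])
        (use i in \<open>auto simp: K_def\<close>)
    show "rep_ok G (?HT i)"
      by (rule rep_ok_homology_rep) (use order_aut_tree_product[OF assms] in auto)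
  qed
  have 3: "bij_betw (\<lambda>i. i - 1) K E"
    by (rule bij_betw_byWitness[where f' = "\<lambda>i. i + 1"]) (auto simp: K_def E_def)
  have "rep_iso G
    (rep_sum {1..n} (\<lambda>j. rep_sum {..<t ^ j} (\<lambda>_.
       rep_sum {i \<in> {-1..poset_length (lower_ideal j)}. even (i + d)} (?H j))))
    (rep_sum {1..n} (\<lambda>j. rep_sum {..<t ^ j} (\<lambda>_. rep_sum E (?H j))))"
    by (intro rep_sum_cong 1)
  also have "rep_iso G \<dots> (rep_sum {1..n} (\<lambda>j. rep_sum E (\<lambda>i. rep_sum {..<t ^ j} (\<lambda>_. ?H j i))))"
    by (intro rep_sum_cong rep_sum_swap)
  also have "rep_iso G \<dots> (rep_sum E (\<lambda>i. rep_sum {1..n} (\<lambda>j. rep_sum {..<t ^ j} (\<lambda>_. ?H j i))))"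
    by (rule rep_sum_swap)
  also have "rep_iso G \<dots> (rep_sum E (\<lambda>i. ?HT (i + 1)))"
    by (rule rep_sum_cong)
      (use homology_tree_product[OF assms, of t "i + 1" for i] in \<open>simp add: rep_copies_def\<close>)
  also have "rep_iso G \<dots> (rep_sum K (\<lambda>i. ?HT (i - 1 + 1)))"
    by (rule rep_sum_reindex[OF 3])
  also have "rep_iso G \<dots> (rep_sum {i \<in> {-1..poset_length (tree_product t)}. odd (i + d)} ?HT)"
    using 2 by simp
  finally show ?thesis .
qed

end


theorem theorem4p5:
  fixes G :: "('g, 'm) monoid_scheme"
    and P :: "'a rel"
    and \<phi> :: "'g \<Rightarrow> 'a \<Rightarrow> 'a"
    and n :: nat
  assumes "group G"
    and "G_poset G \<phi> P"
    and "finite P"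
    and "bounded_poset P"
    and "ranked P"
    and "poset_length P = int n"
    and "n \<ge> 1"
  shows "(\<forall>t::nat. t \<ge> 1 \<longrightarrow>
      virtual_iso G
        (virtual_sum {1..n} (\<lambda>j.
           virtual_copies (t ^ j) (lefschetz (act_fst \<phi>) (rees_ideal P n (j - 1)))))
        (virtual_neg
           (lefschetz (act_fst \<phi>) (remove_min (rees_product (P\<inverse>) (tree_poset t n)))))) \<and>
    (cohen_macaulay P \<longrightarrow> (\<forall>t::nat. t \<ge> 1 \<longrightarrow>
      rep_iso G
        (rep_sum {1..n} (\<lambda>j.
           rep_copies (t ^ j) (homology_rep (act_fst \<phi>) (rees_ideal P n (j - 1)) (int n - 2))))
        (homology_rep (act_fst \<phi>)
           (remove_min (rees_product (P\<inverse>) (tree_poset t n))) (int n - 1))))"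
proof -
  obtain b top where "is_least P b" "is_greatest P top"
    using assms(4) by (auto simp: bounded_poset_def)
  then interpret graded_poset P n b top
    using assms by unfold_locales (auto simp: G_poset_def)
  have virtual: "virtual_iso G
        (virtual_sum {1..n} (\<lambda>j. virtual_copies (t ^ j) (lefschetz (act_fst \<phi>) (lower_ideal j))))
        (virtual_neg (lefschetz (act_fst \<phi>) (tree_product t)))" for t
  proof -
    have "rep_ok G (rep_sum {1..n} (\<lambda>j. rep_sum {..<t ^ j} (\<lambda>_.
       rep_sum {i \<in> {-1..poset_length (lower_ideal j)}. even (i + 1)} (homology_rep (act_fst \<phi>) (lower_ideal j)))))"
      by (intro rep_ok_rep_sum rep_ok_homology_rep order_aut_lower_ideal[OF assms(1,2)]) auto
    \<comment> \<open>An equation of differences compares even ideals plus even tree degrees with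
      odd tree degrees plus odd ideals, so the second isomorphism is used backwards.\<close>
    note odd = rep_iso_sym[OF homology_sum_tree_product[OF assms(1,2), of t 1] this]
    note even = homology_sum_tree_product[OF assms(1,2), of t 0]
    from even odd show ?thesis
      unfolding virtual_iso_def virtual_sum_def virtual_copies_def virtual_neg_def lefschetz_def
        fst_conv snd_conv
      by (intro rep_sum2_cong) simp_all
  qed
  \<comment> \<open>The single degree \<open>k = n - 1\<close> of the degreewise isomorphism, whose
    other side has degree \<open>n - 2\<close>.\<close>
  have "rep_iso G
        (rep_sum {1..n} (\<lambda>j. rep_copies (t ^ j) (homology_rep (act_fst \<phi>) (lower_ideal j) (int n - 2))))
        (homology_rep (act_fst \<phi>) (tree_product t) (int n - 1))" for t
    using homology_tree_product[OF assms(1,2), of t "int n - 1"] by simp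
  with virtual show ?thesis unfolding lower_ideal_def tree_product_def by blast
qed

end
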